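(* Let $p>1$, $\alpha_1=p-1$, $\alpha_0\ge-1$, and $\eta>-1$. Then there exists a constant $C=C(p,\eta)>0$ such that for all $u\in X^{1,p}_\infty(\alpha_0,\alpha_1)$ satisfying $\|u'\|_{L^p_{\alpha_1}}\le1$, $$\int_0^\infty\frac{\exp_p\left(\beta_{0,1}|u|^{\frac p{p-1}}\right)}{(1+|u|)^{\frac p{p-1}}}\,r^\eta\,dr\le C\|u\|^p_{L^p_\eta},$$ where $\beta_{0,1}=\eta+1$.
   Context: For $p\ge1$ and $\alpha\in\mathbb R$, $\|u\|_{L^p_\alpha}=\left(\int_0^\infty|u|^pr^\alpha\,dr\right)^{1/p}$, and $L^p_\alpha$ is the space of measurable $u:(0,\infty)\to\mathbb R$ with finite such norm. $X^{1,p}_\infty(\alpha_0,\alpha_1)$ is the space of functions $u:(0,\infty)\to\mathbb R$ (locally absolutely continuous) with $u\in L^p_{\alpha_0}$ and $u'\in L^p_{\alpha_1}$. For real $p>1$ and $t\ge0$, $\exp_p(t):=\sum_{j=0}^\infty\frac{t^{p-1+j}}{\Gamma(p+j)}$. *)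

theory Defs
  imports "HOL-Analysis.Analysis"
begin

(* Functions on (0,\<infinity>) are represented by total functions real \<Rightarrow> real of which only the values
   on {0<..} matter. *)

text \<open>Real powers of extended nonnegative numbers, used for positive exponents only.\<close>

definition ennreal_powr :: "ennreal \<Rightarrow> real \<Rightarrow> ennreal" where
  "ennreal_powr x a = (if x = top then top else ennreal (enn2real x powr a))"

text \<open>The weighted norm takes the value \<open>top\<close> when the integral diverges.\<close>

definition Lp_norm :: "real \<Rightarrow> real \<Rightarrow> (real \<Rightarrow> real) \<Rightarrow> ennreal" where
  "Lp_norm p \<alpha> u =
     ennreal_powr (\<integral>\<^sup>+r\<in>{0<..}. ennreal (\<bar>u r\<bar> powr p * r powr \<alpha>) \<partial>lebesgue) (1 / p)"

definition Lp_space :: "real \<Rightarrow> real \<Rightarrow> (real \<Rightarrow> real) set" where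
  "Lp_space p \<alpha> = {u. set_borel_measurable lebesgue {0<..} u \<and> Lp_norm p \<alpha> u < top}"

definition abs_continuous_on_interval :: "real \<Rightarrow> real \<Rightarrow> (real \<Rightarrow> real) \<Rightarrow> bool" where
  "abs_continuous_on_interval a b u \<longleftrightarrow>
     (\<forall>\<epsilon>>0. \<exists>\<delta>>0. \<forall>P :: (real \<times> real) set.
        finite P \<and> (\<forall>(x, y)\<in>P. a \<le> x \<and> x < y \<and> y \<le> b) \<and>
        disjoint_family_on (\<lambda>(x, y). {x<..<y}) P \<and>
        (\<Sum>(x, y)\<in>P. y - x) < \<delta> \<longrightarrow>
        (\<Sum>(x, y)\<in>P. \<bar>u y - u x\<bar>) < \<epsilon>)"

definition locally_abs_continuous :: "(real \<Rightarrow> real) \<Rightarrow> bool" where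
  "locally_abs_continuous u \<longleftrightarrow> (\<forall>a b. 0 < a \<and> a < b \<longrightarrow> abs_continuous_on_interval a b u)"

text \<open>The derivative \<open>u'\<close> is the pointwise one, \<open>deriv u\<close>. A locally absolutely continuous function
  is differentiable almost everywhere, and the value of \<open>deriv u\<close> at the remaining points, a null set,
  affects neither measurability with respect to \<open>lebesgue\<close> nor the norms.\<close>

definition X_space :: "real \<Rightarrow> real \<Rightarrow> real \<Rightarrow> (real \<Rightarrow> real) set" where
  "X_space p \<alpha>0 \<alpha>1 =
     {u. locally_abs_continuous u \<and> u \<in> Lp_space p \<alpha>0 \<and> deriv u \<in> Lp_space p \<alpha>1}"

definition exp_p :: "real \<Rightarrow> real \<Rightarrow> real" where
  "exp_p p t = (\<Sum>j. t powr (p - 1 + real j) / Gamma (p + real j))"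

end

theory Submission
  imports Defs
begin

text \<open>
  Put \<open>r = exp (- t)\<close> and \<open>w t = \<bar>u (exp (- t))\<bar>\<close>, and let \<open>q = p / (p - 1)\<close>. The weighted bound on \<open>u'\<close>
  says that the \<open>p\<close>-energy \<open>\<integral> \<bar>w'\<bar>\<^sup>p dt\<close> is at most 1, and \<open>r\<^sup>\<eta> dr\<close> becomes
  \<open>exp (- \<beta> t) dt\<close>. Let \<open>e t\<close> be the energy spent before \<open>t\<close>. Hoelder's inequality yields
  \<open>\<bar>w t - w s\<bar>\<^sup>p \<le> (t - s)\<^sup>p\<^sup>-\<^sup>1 (e t - e s)\<close> for \<open>s \<le> t\<close>, and the rest of the argument knows about
  \<open>u\<close> only this (\<open>controlled_function\<close>). What has to be bounded by a multiple of
  \<open>J = \<integral> w\<^sup>p exp (- \<beta> t) dt\<close> is the integral of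
  \<open>exp_p (\<beta> w\<^sup>q) (1 + w)\<^sup>-\<^sup>q exp (- \<beta> t)\<close>. Where \<open>w \<le> 1\<close> the two integrands are comparable, so only
  the times after the first one, \<open>b\<close>, with \<open>w b = 1\<close> matter, and there \<open>exp_p\<close> may be replaced by
  the exponential. Two estimates at a base point \<open>a\<close> of height \<open>h = w a \<ge> 1\<close> are played against each
  other.

  \<^item> Growth after \<open>a\<close> (\<open>growth_beyond_base_point\<close>). If at most half of the energy is left, then
  \<open>w\<^sup>q\<close> is at most \<open>2\<^sup>q\<^sup>-\<^sup>1 h\<^sup>q + \<bar>v\<bar>\<^sup>q\<close> for a function \<open>v\<close> that starts at 0 and has energy at
  most 1. Moser's inequality (\<open>moser_inequality\<close>) bounds the integral of \<open>exp (\<beta> (\<bar>v\<bar>\<^sup>q - s))\<close>, and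
  the integral after \<open>a\<close> is at most a multiple of
  \<open>h\<^sup>-\<^sup>q exp (\<beta> 2\<^sup>q\<^sup>-\<^sup>1 h\<^sup>q) exp (- \<beta> a)\<close>, where the factor \<open>h\<^sup>-\<^sup>q\<close> stems from the denominator.

  \<^item> Descent before \<open>a\<close> (\<open>level_descent\<close>). If at most half of the energy was spent before \<open>a\<close>, then
  \<open>w\<close> needs at least the time \<open>L = 2\<^sup>q\<^sup>-\<^sup>1 h\<^sup>q\<close> to climb from 0 to \<open>h\<close>. Already shortly after \<open>a - L\<close>, where
  the weight is about \<open>exp (\<beta> L) exp (- \<beta> a)\<close>, it has climbed so much that \<open>J\<close> is at least a multiple
  of \<open>h\<^sup>-\<^sup>q exp (\<beta> 2\<^sup>q\<^sup>-\<^sup>1 h\<^sup>q) exp (- \<beta> a)\<close>.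

  The two expressions are the same, which is the reason for the exponent \<open>p / (p - 1)\<close> of the
  denominator. Let \<open>a\<close> be the time at which half of the energy is spent: the growth after \<open>a\<close> is
  controlled by the descent before it. The times between \<open>b\<close> and \<open>a\<close> again use at most half of the
  energy, and there the growth estimate with base point \<open>b\<close> is controlled by the descent before
  \<open>b\<close>: at the fixed height 1 it does not matter how much of the energy that descent may use. If
  \<open>w a\<close> is less than 1, the descent before \<open>b\<close> controls the growth after \<open>a\<close> as well.

  The derivative in the statement is the pointwise one. To start with Hoelder's inequality one
  therefore needs \<open>\<bar>u b - u a\<bar> \<le> \<integral> \<bar>u'\<bar>\<close> for absolutely continuous \<open>u\<close>, that is, Lebesgue's
  theorem that such a function is differentiable almost everywhere and the fundamental theorem of
  calculus. Both are derived from the Vitali covering theorem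
  (\<open>abs_continuous_differentiable_ae\<close>, \<open>abs_continuous_FTC\<close>).
\<close>

section \<open>Differentiability almost everywhere of absolutely continuous functions\<close>

lemma measure_le_sum_lengths:
  fixes P :: "(real \<times> real) set"
  assumes "finite P" "\<And>x y. (x, y) \<in> P \<Longrightarrow> x < y"
  shows "measure lebesgue (\<Union>(x, y)\<in>P. {x<..<y}) \<le> (\<Sum>(x, y)\<in>P. y - x)"
proof -
  have "measure lebesgue (\<Union>i\<in>P. case i of (x,y) \<Rightarrow> {x<..<y}) \<le> (\<Sum>i\<in>P. measure lebesgue (case i of (x,y) \<Rightarrow> {x<..<y}))"
    by (rule measure_UNION_le) (use assms in auto)
  also have "\<dots> = (\<Sum>(x, y)\<in>P. y - x)"
    by (rule sum.cong) (use assms in \<open>auto simp: less_imp_le\<close>)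
  finally show ?thesis .
qed

lemma measure_eq_sum_lengths:
  fixes P :: "(real \<times> real) set"
  assumes "finite P" "\<And>x y. (x, y) \<in> P \<Longrightarrow> x < y"
    and "disjoint_family_on (\<lambda>(x, y). {x<..<y}) P"
  shows "measure lebesgue (\<Union>(x, y)\<in>P. {x<..<y}) = (\<Sum>(x, y)\<in>P. y - x)"
proof -
  have "measure lebesgue (\<Union>i\<in>P. case i of (x,y) \<Rightarrow> {x<..<y}) = (\<Sum>i\<in>P. measure lebesgue (case i of (x,y) \<Rightarrow> {x<..<y}))"
    by (rule measure_finite_Union) (use assms in \<open>auto simp: less_imp_le\<close>)
  also have "\<dots> = (\<Sum>(x, y)\<in>P. y - x)"
    by (rule sum.cong) (use assms in \<open>auto simp: less_imp_le\<close>)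
  finally show ?thesis .
qed

text \<open>The form of the Vitali covering theorem used below: if arbitrarily short intervals of \<open>K\<close> surround
  every point of \<open>S\<close>, countably many disjoint ones cover almost all of \<open>S\<close>, and finitely many of these
  all but \<open>\<epsilon>\<close> of it.\<close>

lemma Vitali_finite_intervals:
  fixes K :: "(real \<times> real) set"
  assumes S: "S \<in> lmeasurable"
    and K: "\<And>x y. (x, y) \<in> K \<Longrightarrow> x < y"
    and fine: "\<And>x \<delta>. x \<in> S \<Longrightarrow> 0 < \<delta> \<Longrightarrow> \<exists>c d. (c, d) \<in> K \<and> c < x \<and> x < d \<and> d - c < \<delta>"
    and "0 < \<epsilon>"
  obtains P where "finite P" "P \<subseteq> K" "disjoint_family_on (\<lambda>(x, y). {x<..<y}) P"
    "measure lebesgue (S \<inter> (\<Union>(x, y)\<in>P. {x<..<y})) > measure lebesgue S - \<epsilon>"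
proof -
  let ?a = "\<lambda>i::real \<times> real. (fst i + snd i) / 2" and ?r = "\<lambda>i::real \<times> real. (snd i - fst i) / 2"
  have cb: "cball (?a i) (?r i) = {fst i..snd i}" for i
    by (auto simp: cball_def dist_real_def abs_if field_simps split: if_splits)
  obtain C where C: "countable C" "C \<subseteq> K"
     and disj: "pairwise (\<lambda>i j. disjnt (cball (?a i) (?r i)) (cball (?a j) (?r j))) C"
     and neg: "negligible (S - (\<Union>i \<in> C. cball (?a i) (?r i)))"
  proof (rule Vitali_covering_theorem_cballs [of K ?r S ?a])
    fix x d :: real
    assume "x \<in> S" "0 < d"
    with fine[of x d] obtain c e where "(c, e) \<in> K" "c < x" "x < e" "e - c < d" by blast
    then show "\<exists>i. i \<in> K \<and> x \<in> cball (?a i) (?r i) \<and> ?r i < d"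
      by (intro exI[of _ "(c, e)"]) (simp only: cb, auto)
  qed (use K in auto)
  let ?I = "\<lambda>i::real \<times> real. {fst i<..<snd i}"
  have neg': "negligible (S - (\<Union>i \<in> C. ?I i))"
  proof (rule negligible_subset)
    have "countable ((fst ` C) \<union> (snd ` C))" using C by auto
    then show "negligible ((S - (\<Union>i \<in> C. cball (?a i) (?r i))) \<union> ((fst ` C) \<union> (snd ` C)))"
      using neg by (intro negligible_Un) (auto intro: negligible_iff_null_sets[THEN iffD2] countable_imp_null_set_lborel null_sets_completionI)
    show "S - (\<Union>i \<in> C. ?I i) \<subseteq> (S - (\<Union>i \<in> C. cball (?a i) (?r i))) \<union> ((fst ` C) \<union> (snd ` C))"
      unfolding cb by (force simp: less_le)
  qed
  let ?D = "(\<lambda>i. S \<inter> ?I i) ` C"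
  have "countable ?D" using C by auto
  have Dm: "\<And>D. D \<in> ?D \<Longrightarrow> D \<in> lmeasurable" using S by (auto intro: fmeasurable_Int_fmeasurable)
  have un: "\<Union>?D = S \<inter> (\<Union>i \<in> C. ?I i)" by auto
  have bound: "measure lebesgue (\<Union>D') \<le> measure lebesgue S" if "D' \<subseteq> ?D" "finite D'" for D'
  proof (rule measure_mono_fmeasurable)
    show "\<Union>D' \<in> sets lebesgue" using that Dm by (intro sets.finite_Union) auto
  qed (use that S in auto)
  obtain D' where D': "D' \<subseteq> ?D" "finite D'" "measure lebesgue (\<Union>?D) - \<epsilon> < measure lebesgue (\<Union>D')"
    using measure_countable_Union_approachable[OF \<open>countable ?D\<close> \<open>0 < \<epsilon>\<close> Dm bound] by blast
  obtain P where P: "P \<subseteq> C" "finite P" "D' = (\<lambda>i. S \<inter> ?I i) ` P"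
    using finite_subset_image[OF D'(2,1)] by blast
  show ?thesis
  proof
    show "finite P" "P \<subseteq> K" using P C by auto
    show "disjoint_family_on (\<lambda>(x, y). {x<..<y}) P"
      unfolding disjoint_family_on_def
    proof (intro ballI impI)
      fix i j assume "i \<in> P" "j \<in> P" "i \<noteq> j"
      then have "disjnt {fst i..snd i} {fst j..snd j}"
        using disj P unfolding cb pairwise_def by blast
      then show "(case i of (x, y) \<Rightarrow> {x<..<y}) \<inter> (case j of (x, y) \<Rightarrow> {x<..<y}) = {}"
        by (force simp: disjnt_def split: prod.splits)
    qed
    have Cm: "(\<Union>i \<in> C. ?I i) \<in> sets lebesgue" using C by (intro sets.countable_UN') auto
    have "measure lebesgue (\<Union>?D) = measure lebesgue S"
      unfolding un
    proof (rule measure_negligible_symdiff)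
      show "negligible (sym_diff S (S \<inter> (\<Union>i\<in>C. ?I i)))"
        using neg' by (rule negligible_subset) auto
    qed (use S Cm in auto)
    moreover have "\<Union>D' = S \<inter> (\<Union>(x, y)\<in>P. {x<..<y})"
      using P(3) by (auto simp: split_def)
    ultimately show "measure lebesgue (S \<inter> (\<Union>(x, y)\<in>P. {x<..<y})) > measure lebesgue S - \<epsilon>"
      using D'(3) by simp
  qed
qed

text \<open>The intervals of \<open>Q\<close> are the gaps that remain when those of \<open>R\<close> are removed from those of \<open>P\<close>.
  They are found by removing the intervals of \<open>R\<close> one by one, each from the single gap that still
  contains it. Increments of any function telescope over such a subdivision, and the identity
  function gives the same for lengths.\<close>

lemma subdivide_intervals:
  fixes P R :: "(real \<times> real) set"
  assumes P: "finite P" "\<And>c d. (c, d) \<in> P \<Longrightarrow> c < d" "disjoint_family_on (\<lambda>(x, y). {x<..<y}) P"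
    and R: "finite R" "\<And>x y. (x, y) \<in> R \<Longrightarrow> x < y \<and> (\<exists>c d. (c, d) \<in> P \<and> c \<le> x \<and> y \<le> d)"
      "disjoint_family_on (\<lambda>(x, y). {x<..<y}) R"
  obtains Q where "finite Q" "\<forall>(x, y) \<in> Q. x < y \<and> (\<exists>c d. (c, d) \<in> P \<and> c \<le> x \<and> y \<le> d)"
      "disjoint_family_on (\<lambda>(x, y). {x<..<y}) Q"
      "\<forall>f :: real \<Rightarrow> real. (\<Sum>(x, y)\<in>P. f y - f x) = (\<Sum>(x, y)\<in>R. f y - f x) + (\<Sum>(x, y)\<in>Q. f y - f x)"
proof -
  let ?I = "\<lambda>(x::real, y::real). {x<..<y}"
  let ?in = "\<lambda>x y T. \<exists>c d. (c, d) \<in> T \<and> c \<le> x \<and> y \<le> d"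
  \<comment> \<open>The last conjunct keeps the induction going: an interval disjoint from those removed so far lies in one gap.\<close>
  have "\<exists>Q. finite Q \<and> (\<forall>(x, y) \<in> Q. x < y \<and> ?in x y P) \<and> disjoint_family_on ?I Q \<and>
      (\<forall>f :: real \<Rightarrow> real. (\<Sum>(x, y)\<in>P. f y - f x) = (\<Sum>(x, y)\<in>R. f y - f x) + (\<Sum>(x, y)\<in>Q. f y - f x)) \<and>
      (\<forall>x y. x < y \<and> ?in x y P \<and> (\<forall>i\<in>R. {x<..<y} \<inter> ?I i = {}) \<longrightarrow> ?in x y Q)"
    using R
  proof (induction R rule: finite_induct)
    case empty
    show ?case
      by (rule exI[of _ P]) (use P in auto)
  next
    case (insert i R)
    obtain x y where i: "i = (x, y)" by (cases i)
    have "\<exists>Q. finite Q \<and> (\<forall>(x, y) \<in> Q. x < y \<and> ?in x y P) \<and> disjoint_family_on ?I Q \<and>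
      (\<forall>f :: real \<Rightarrow> real. (\<Sum>(x, y)\<in>P. f y - f x) = (\<Sum>(x, y)\<in>R. f y - f x) + (\<Sum>(x, y)\<in>Q. f y - f x)) \<and>
      (\<forall>x y. x < y \<and> ?in x y P \<and> (\<forall>i\<in>R. {x<..<y} \<inter> ?I i = {}) \<longrightarrow> ?in x y Q)"
    proof (rule insert.IH)
      show "disjoint_family_on ?I R"
        using insert.prems(2) by (rule disjoint_family_on_mono[rotated]) auto
    qed (use insert.prems(1) in auto)
    then obtain Q where Q0: "finite Q" "\<forall>(x, y) \<in> Q. x < y \<and> ?in x y P" "disjoint_family_on ?I Q"
      "\<forall>f :: real \<Rightarrow> real. (\<Sum>(x, y)\<in>P. f y - f x) = (\<Sum>(x, y)\<in>R. f y - f x) + (\<Sum>(x, y)\<in>Q. f y - f x)"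
      "\<forall>x y. x < y \<and> ?in x y P \<and> (\<forall>i\<in>R. {x<..<y} \<inter> ?I i = {}) \<longrightarrow> ?in x y Q"
      by (elim exE conjE)
    have Q: "finite Q" "\<And>x y. (x, y) \<in> Q \<Longrightarrow> x < y \<and> ?in x y P" "disjoint_family_on ?I Q"
      using Q0(1-3) by blast+
    note eq = Q0(4)[rule_format] and free = Q0(5)[rule_format, OF conjI, OF _ conjI]
    have xy: "x < y" "?in x y P" using insert.prems(1)[of x y] i by auto
    have dR: "{x<..<y} \<inter> ?I j = {}" if "j \<in> R" for j
    proof -
      have "i \<noteq> j" using insert.hyps that by auto
      then show ?thesis
        using disjoint_family_onD[OF insert.prems(2), of i j] that i by simp
    qed
    obtain c d where cd: "(c, d) \<in> Q" "c \<le> x" "y \<le> d"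
      using free[OF xy] dR by blast
    define N where "N = (if c < x then {(c, x)} else {}) \<union> (if y < d then {(y, d)} else {})"
    define Q' where "Q' = (Q - {(c, d)}) \<union> N"
    have finN: "finite N" by (auto simp: N_def)
    have Nin: "a < b \<and> c \<le> a \<and> b \<le> d \<and> (b \<le> x \<or> y \<le> a)" if "(a, b) \<in> N" for a b
      using that cd xy(1) by (auto simp: N_def split: if_splits)
    have Qd: "{a<..<b} \<inter> {a'<..<b'} = {}" if "(a, b) \<in> Q" "(a', b') \<in> Q" "(a, b) \<noteq> (a', b')" for a b a' b'
      using disjoint_family_onD[OF Q(3), of "(a, b)" "(a', b')"] that by simp
    have NQ: "N \<inter> (Q - {(c, d)}) = {}"
    proof (rule ccontr)
      assume "N \<inter> (Q - {(c, d)}) \<noteq> {}"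
      then obtain a b where ab: "(a, b) \<in> N" "(a, b) \<in> Q" "(a, b) \<noteq> (c, d)" by auto
      then have "{a<..<b} \<inter> {c<..<d} = {}" using Qd cd by blast
      moreover have "(a + b) / 2 \<in> {a<..<b} \<inter> {c<..<d}" using Nin[OF ab(1)] by auto
      ultimately show False by simp
    qed
    show ?case
    proof (intro exI[of _ Q'] conjI)
      show "finite Q'" using Q finN by (auto simp: Q'_def)
      show "\<forall>(x, y)\<in>Q'. x < y \<and> ?in x y P"
      proof clarify
        fix a b assume "(a, b) \<in> Q'"
        then consider "(a, b) \<in> Q" | "(a, b) \<in> N" by (auto simp: Q'_def)
        then show "a < b \<and> ?in a b P"
        proof cases
          case 2
          obtain c' d' where "(c', d') \<in> P" "c' \<le> c" "d \<le> d'" using Q(2)[OF cd(1)] by blast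
          then show ?thesis using Nin[OF 2] by (meson order_trans)
        qed (use Q in blast)
      qed
      show "disjoint_family_on ?I Q'"
        unfolding disjoint_family_on_def
      proof (intro ballI impI)
        fix j k assume jk: "j \<in> Q'" "k \<in> Q'" "j \<noteq> k"
        obtain a b a' b' where j: "j = (a, b)" and k: "k = (a', b')" by (cases j, cases k)
        have sub: "{a<..<b} \<subseteq> {c<..<d}" if "(a, b) \<in> N" for a b using Nin[OF that] by auto
        consider "j \<in> N" "k \<in> N" | "j \<in> N" "k \<in> Q" "k \<noteq> (c, d)" | "j \<in> Q" "k \<in> N" "j \<noteq> (c, d)" | "j \<in> Q" "k \<in> Q"
          using jk by (auto simp: Q'_def)
        then have "{a<..<b} \<inter> {a'<..<b'} = {}"
        proof cases
          case 1
          then show ?thesis using jk(3) xy(1) by (auto simp: N_def j k split: if_splits)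
        next
          case 2
          then show ?thesis using sub Qd[OF cd(1), of a' b'] j k by blast
        next
          case 3
          then show ?thesis using sub Qd[OF cd(1), of a b] j k by blast
        next
          case 4
          then show ?thesis using Qd jk(3) j k by blast
        qed
        then show "?I j \<inter> ?I k = {}" by (simp add: j k)
      qed
      show "\<forall>f :: real \<Rightarrow> real. (\<Sum>(x, y)\<in>P. f y - f x) = (\<Sum>(x, y)\<in>insert i R. f y - f x) + (\<Sum>(x, y)\<in>Q'. f y - f x)"
      proof
        fix f :: "real \<Rightarrow> real"
        have "(\<Sum>(x, y)\<in>N. f y - f x) = (f x - f c) + (f d - f y)"
          using cd xy(1) by (auto simp: N_def split: if_splits)
        moreover have "(\<Sum>(x, y)\<in>Q'. f y - f x) = (\<Sum>(x, y)\<in>Q - {(c, d)}. f y - f x) + (\<Sum>(x, y)\<in>N. f y - f x)"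
          unfolding Q'_def by (rule sum.union_disjoint) (use Q finN NQ in auto)
        moreover have "(\<Sum>(x, y)\<in>Q. f y - f x) = (f d - f c) + (\<Sum>(x, y)\<in>Q - {(c, d)}. f y - f x)"
          using sum.remove[OF Q(1) cd(1), of "\<lambda>(x, y). f y - f x"] by simp
        moreover have "(\<Sum>(x, y)\<in>insert i R. f y - f x) = (f y - f x) + (\<Sum>(x, y)\<in>R. f y - f x)"
          using insert.hyps i by simp
        ultimately show "(\<Sum>(x, y)\<in>P. f y - f x) = (\<Sum>(x, y)\<in>insert i R. f y - f x) + (\<Sum>(x, y)\<in>Q'. f y - f x)"
          using eq[of f] by simp
      qed
      show "\<forall>a b. a < b \<and> ?in a b P \<and> (\<forall>i\<in>insert i R. {a<..<b} \<inter> ?I i = {}) \<longrightarrow> ?in a b Q'"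
      proof (intro allI impI, elim conjE)
        fix a b assume ab: "a < b" "?in a b P" and dis: "\<forall>i\<in>insert i R. {a<..<b} \<inter> ?I i = {}"
        obtain c' d' where cd': "(c', d') \<in> Q" "c' \<le> a" "b \<le> d'" using free[OF ab] dis by blast
        show "?in a b Q'"
        proof (cases "(c', d') = (c, d)")
          case False
          then show ?thesis using cd' by (auto simp: Q'_def)
        next
          case True
          have "{a<..<b} \<inter> {x<..<y} = {}" using dis i by auto
          then have "\<not> max a x < min b y"
            using dense[of "max a x" "min b y"] by (auto simp: set_eq_iff)
          then have "b \<le> x \<or> y \<le> a"
            using ab(1) xy(1) by linarith
          then show ?thesis
          proof
            assume "b \<le> x"
            then have "(c, x) \<in> Q'" using ab(1) cd' True by (auto simp: Q'_def N_def)
            then show ?thesis using \<open>b \<le> x\<close> cd' True by blast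
          next
            assume "y \<le> a"
            then have "(y, d) \<in> Q'" using ab(1) cd' True by (auto simp: Q'_def N_def)
            then show ?thesis using \<open>y \<le> a\<close> cd' True by blast
          qed
        qed
      qed
    qed
  qed
  then obtain Q where "finite Q" "\<forall>(x, y) \<in> Q. x < y \<and> ?in x y P" "disjoint_family_on ?I Q"
    "\<forall>f :: real \<Rightarrow> real. (\<Sum>(x, y)\<in>P. f y - f x) = (\<Sum>(x, y)\<in>R. f y - f x) + (\<Sum>(x, y)\<in>Q. f y - f x)"
    by (elim exE conjE)
  then show ?thesis using that[of Q] by blast
qed

text \<open>The upper derivate of \<open>u\<close> at \<open>x\<close>, formed with intervals that contain \<open>x\<close> in their interior, is
  essentially greater than \<open>q\<close>. Such intervals serve directly as a Vitali cover, and the set of the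
  points where this holds is a countable intersection of open sets. That the lower derivate is less
  than \<open>p\<close> is expressed by steepness \<open>- p\<close> of \<open>- u\<close>.\<close>

definition steep_at :: "(real \<Rightarrow> real) \<Rightarrow> real \<Rightarrow> real \<Rightarrow> bool" where
  "steep_at u q x \<longleftrightarrow> (\<forall>\<delta>>0. \<exists>c d. c < x \<and> x < d \<and> d - c < \<delta> \<and> q * (d - c) < u d - u c)"

lemma steep_at_borel: "{x. steep_at u q x} \<in> sets borel"
proof -
  let ?U = "\<lambda>n::nat. \<Union>{{c<..<d} | c d. d - c < 1 / Suc n \<and> q * (d - c) < u d - u c}"
  have "{x. steep_at u q x} = (\<Inter>n. ?U n)"
  proof (intro equalityI subsetI)
    fix x assume "x \<in> {x. steep_at u q x}"
    then have *: "\<exists>c d. c < x \<and> x < d \<and> d - c < 1 / Suc n \<and> q * (d - c) < u d - u c" for n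
      unfolding steep_at_def by (simp del: of_nat_Suc)
    have "x \<in> ?U n" for n
      using *[of n] by (elim exE conjE) (rule UnionI, rule CollectI, rule exI, rule exI, rule conjI, rule refl, auto)
    then show "x \<in> (\<Inter>n. ?U n)" by blast
  next
    fix x assume x: "x \<in> (\<Inter>n. ?U n)"
    show "x \<in> {x. steep_at u q x}"
      unfolding steep_at_def
    proof (intro CollectI allI impI)
      fix \<delta> :: real assume "0 < \<delta>"
      then obtain n where n: "1 / Suc n < \<delta>" using nat_approx_posE by metis
      have "x \<in> ?U n" using x by blast
      then obtain c d where "c < x" "x < d" "d - c < 1 / Suc n" "q * (d - c) < u d - u c" by auto
      then show "\<exists>c d. c < x \<and> x < d \<and> d - c < \<delta> \<and> q * (d - c) < u d - u c" using n by force
    qed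
  qed
  moreover have "open (?U n)" for n by (rule open_Union) auto
  ultimately show ?thesis by (auto intro: borel_open)
qed

lemma steep_at_fine:
  assumes "steep_at u q x" "open G" "x \<in> G" "0 < \<delta>"
  shows "\<exists>c d. c < x \<and> x < d \<and> d - c < \<delta> \<and> q * (d - c) < u d - u c \<and> {c..d} \<subseteq> G"
proof -
  obtain e where e: "0 < e" "ball x e \<subseteq> G" using assms openE by blast
  obtain c d where cd: "c < x" "x < d" "d - c < min \<delta> e" "q * (d - c) < u d - u c"
    using assms(1,4) e(1) unfolding steep_at_def by (metis min_less_iff_conj)
  have "{c..d} \<subseteq> ball x e" using cd by (auto simp: dist_real_def)
  then show ?thesis using cd e by auto
qed

lemma abs_continuous_small_sum:
  assumes "abs_continuous_on_interval a b u" "0 < \<epsilon>"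
  obtains \<delta> where "0 < \<delta>"
    "\<And>P. finite P \<Longrightarrow> (\<And>x y. (x, y) \<in> P \<Longrightarrow> a \<le> x \<and> x < y \<and> y \<le> b) \<Longrightarrow>
      disjoint_family_on (\<lambda>(x, y). {x<..<y}) P \<Longrightarrow> (\<Sum>(x, y)\<in>P. y - x) < \<delta> \<Longrightarrow>
      \<bar>\<Sum>(x, y)\<in>P. u y - u x\<bar> < \<epsilon>"
proof -
  obtain \<delta> where \<delta>: "0 < \<delta>" "\<forall>P :: (real \<times> real) set.
        finite P \<and> (\<forall>(x, y)\<in>P. a \<le> x \<and> x < y \<and> y \<le> b) \<and>
        disjoint_family_on (\<lambda>(x, y). {x<..<y}) P \<and>
        (\<Sum>(x, y)\<in>P. y - x) < \<delta> \<longrightarrow>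
        (\<Sum>(x, y)\<in>P. \<bar>u y - u x\<bar>) < \<epsilon>"
    using assms unfolding abs_continuous_on_interval_def by blast
  show thesis
  proof (rule that[OF \<delta>(1)])
    fix P :: "(real \<times> real) set"
    assume "finite P" "\<And>x y. (x, y) \<in> P \<Longrightarrow> a \<le> x \<and> x < y \<and> y \<le> b"
      "disjoint_family_on (\<lambda>(x, y). {x<..<y}) P" "(\<Sum>(x, y)\<in>P. y - x) < \<delta>"
    then have "(\<Sum>(x, y)\<in>P. \<bar>u y - u x\<bar>) < \<epsilon>" using \<delta>(2) by blast
    moreover have "\<bar>\<Sum>(x, y)\<in>P. u y - u x\<bar> \<le> (\<Sum>(x, y)\<in>P. \<bar>u y - u x\<bar>)"
      unfolding split_def by (rule sum_abs)
    ultimately show "\<bar>\<Sum>(x, y)\<in>P. u y - u x\<bar> < \<epsilon>" by simp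
  qed
qed

text \<open>Otherwise some interval \<open>G\<close> contains a set of positive measure \<open>m\<close> on which \<open>u\<close> is infinitely steep,
  and may be taken so short that increments of \<open>u\<close> over disjoint subintervals of it sum to less than
  1. Half of the set is covered by disjoint intervals in \<open>G\<close> on which the slope exceeds \<open>2 / m\<close>,
  and there the increments sum to more than 1.\<close>

lemma negligible_infinite_derivate:
  assumes AC: "abs_continuous_on_interval a b u"
  shows "negligible {x \<in> {a<..<b}. \<forall>q. steep_at u q x}"
proof -
  define S where "S = {x. \<forall>n::nat. steep_at u n x}"
  have "S = (\<Inter>n::nat. {x. steep_at u n x})" by (auto simp: S_def)
  then have Sb: "S \<in> sets borel" using steep_at_borel by auto
  obtain \<delta> where \<delta>: "0 < \<delta>"
    "\<And>P. finite P \<Longrightarrow> (\<And>x y. (x, y) \<in> P \<Longrightarrow> a \<le> x \<and> x < y \<and> y \<le> b) \<Longrightarrow>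
      disjoint_family_on (\<lambda>(x, y). {x<..<y}) P \<Longrightarrow> (\<Sum>(x, y)\<in>P. y - x) < \<delta> \<Longrightarrow>
      \<bar>\<Sum>(x, y)\<in>P. u y - u x\<bar> < 1"
    using abs_continuous_small_sum[OF AC, of 1] by auto
  have short: "negligible (S \<inter> ({a<..<b} \<inter> {c<..<c+\<delta>/2}))" for c
  proof (rule ccontr)
    define G where "G = {a<..<b} \<inter> {c<..<c+\<delta>/2}"
    assume neg: "\<not> negligible (S \<inter> ({a<..<b} \<inter> {c<..<c+\<delta>/2}))"
    have SG: "S \<inter> G \<in> lmeasurable" unfolding G_def
      using Sb by (intro fmeasurable_Int_fmeasurable[OF fmeasurable_Int_fmeasurable] bounded_set_imp_lmeasurable) auto
    define m where "m = measure lebesgue (S \<inter> G)"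
    have m: "0 < m" using neg SG unfolding m_def G_def
      by (simp add: negligible_iff_measure0 zero_less_measure_iff)
    obtain n :: nat where n: "2 / m < n" using reals_Archimedean2 by blast
    define K :: "(real \<times> real) set" where "K = {(x, y). x < y \<and> n * (y - x) < u y - u x \<and> {x..y} \<subseteq> G}"
    have Kfine: "\<exists>c d. (c, d) \<in> K \<and> c < x \<and> x < d \<and> d - c < \<delta>'" if x: "x \<in> S \<inter> G" "0 < \<delta>'" for x \<delta>'
    proof -
      have "open G" by (auto simp: G_def)
      moreover have "steep_at u n x" "x \<in> G" using x by (simp_all add: S_def)
      ultimately obtain c d :: real where "c < x" "x < d" "d - c < \<delta>'" "real n * (d - c) < u d - u c" "{c..d} \<subseteq> G"
        using steep_at_fine x(2) by metis
      moreover from this have "(c, d) \<in> K" by (simp add: K_def)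
      ultimately show ?thesis by blast
    qed
    have Kpos: "x < y" if "(x, y) \<in> K" for x y using that by (simp add: K_def)
    obtain P where P: "finite P" "P \<subseteq> K" "disjoint_family_on (\<lambda>(x, y). {x<..<y}) P"
      "measure lebesgue (S \<inter> G \<inter> (\<Union>(x, y)\<in>P. {x<..<y})) > m - m / 2"
      unfolding m_def
      by (rule Vitali_finite_intervals[OF SG Kpos Kfine, where \<epsilon> = "measure lebesgue (S \<inter> G) / 2"]) (use m in \<open>simp_all add: m_def\<close>)
    have PK: "x < y \<and> n * (y - x) < u y - u x \<and> {x..y} \<subseteq> G" if "(x, y) \<in> P" for x y :: real
      using P(2) that by (auto simp: K_def)
    have Pin: "x \<in> G \<and> y \<in> G \<and> x < y" if "(x, y) \<in> P" for x y
    proof -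
      have "x \<in> {x..y}" "y \<in> {x..y}" using PK[OF that] by simp_all
      then show ?thesis using PK[OF that] by blast
    qed
    have Pab: "a \<le> x \<and> x < y \<and> y \<le> b" if "(x, y) \<in> P" for x y
      using Pin[OF that] by (simp add: G_def)
    have eq: "measure lebesgue (\<Union>(x, y)\<in>P. {x<..<y}) = (\<Sum>(x, y)\<in>P. y - x)"
      by (rule measure_eq_sum_lengths[OF P(1) _ P(3)]) (use PK in blast)
    have "{x<..<y} \<subseteq> {c<..<c+\<delta>/2}" if "(x, y) \<in> P" for x y
      using Pin[OF that] by (auto simp: G_def)
    then have "(\<Union>(x, y)\<in>P. {x<..<y}) \<subseteq> {c<..<c+\<delta>/2}" by blast
    then have "measure lebesgue (\<Union>(x, y)\<in>P. {x<..<y}) \<le> measure lebesgue {c<..<c+\<delta>/2}"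
      using P(1) by (intro measure_mono_fmeasurable) auto
    then have len: "(\<Sum>(x, y)\<in>P. y - x) < \<delta>" using \<delta>(1) eq by simp
    have "m / 2 < measure lebesgue (S \<inter> G \<inter> (\<Union>(x, y)\<in>P. {x<..<y}))" using P(4) by simp
    also have "\<dots> \<le> measure lebesgue (\<Union>(x, y)\<in>P. {x<..<y})"
    proof (rule measure_mono_fmeasurable)
      show UP: "(\<Union>(x, y)\<in>P. {x<..<y}) \<in> lmeasurable" using P(1) by (auto intro!: fmeasurable.finite_UN)
      show "S \<inter> G \<inter> (\<Union>(x, y)\<in>P. {x<..<y}) \<in> sets lebesgue"
        by (rule sets.Int) (use SG UP in \<open>auto simp only: fmeasurableD\<close>)
    qed auto
    also have "\<dots> = (\<Sum>(x, y)\<in>P. y - x)" by (rule eq)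
    finally have big: "m / 2 < (\<Sum>(x, y)\<in>P. y - x)" .
    have "1 \<le> n * (m / 2)" using n m by (simp add: field_simps)
    also have "\<dots> \<le> n * (\<Sum>(x, y)\<in>P. y - x)" using big by (intro mult_left_mono) auto
    also have "\<dots> = (\<Sum>(x, y)\<in>P. n * (y - x))" by (simp add: sum_distrib_left split_def)
    also have "\<dots> \<le> (\<Sum>(x, y)\<in>P. u y - u x)" using PK by (intro sum_mono) (clarsimp, blast intro: less_imp_le)
    also have "\<dots> < 1" using \<delta>(2)[OF P(1) Pab P(3) len] by linarith
    finally show False by simp
  qed
  have "negligible (\<Union>k::int. S \<inter> ({a<..<b} \<inter> {k*\<delta>/4<..<k*\<delta>/4+\<delta>/2}))"
    using short by (intro negligible_countable_Union) auto
  then show ?thesis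
  proof (rule negligible_subset, intro subsetI)
    fix x assume x: "x \<in> {x \<in> {a<..<b}. \<forall>q. steep_at u q x}"
    let ?k = "\<lceil>4 * x / \<delta>\<rceil> - 1"
    have "of_int ?k < 4 * x / \<delta>" "4 * x / \<delta> \<le> of_int ?k + 1" by linarith+
    then have "of_int ?k * \<delta> < 4 * x" "4 * x \<le> (of_int ?k + 1) * \<delta>"
      using \<delta>(1) by (simp_all only: pos_less_divide_eq pos_divide_le_eq)
    then have "of_int ?k * \<delta> / 4 < x" "x < of_int ?k * \<delta> / 4 + \<delta> / 2"
      using \<delta>(1) unfolding distrib_right by linarith+
    then show "x \<in> (\<Union>k::int. S \<inter> ({a<..<b} \<inter> {k*\<delta>/4<..<k*\<delta>/4+\<delta>/2}))"
      by (intro UN_I[of ?k] IntI) (use x in \<open>auto simp: S_def\<close>)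
  qed
qed

text \<open>Let \<open>S\<close> be the set and \<open>m > 0\<close> its measure. Cover \<open>S\<close> up to little measure, inside an open set
  hardly larger than \<open>S\<close>, by intervals \<open>P\<close> of slope less than \<open>p\<close>, and then \<open>S\<close> again by intervals
  \<open>R\<close> of slope greater than \<open>q\<close> inside those of \<open>P\<close>. The gaps \<open>Q\<close> between the two families have
  little total length, so that by absolute continuity \<open>u\<close> changes little over them. Hence \<open>q m\<close> is at
  most \<open>p m\<close> up to a small error, a contradiction.\<close>

lemma negligible_two_derivates:
  assumes AC: "abs_continuous_on_interval a b u" and "p < q"
  shows "negligible {x \<in> {a<..<b}. steep_at u q x \<and> steep_at (\<lambda>x. - u x) (- p) x}"
proof (rule ccontr)
  define S where "S = {x. steep_at u q x} \<inter> {x. steep_at (\<lambda>x. - u x) (- p) x} \<inter> {a<..<b}"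
  have Sm: "S \<in> lmeasurable" unfolding S_def
    using steep_at_borel by (intro bounded_set_imp_lmeasurable) (auto simp: bounded_Int)
  define m where "m = measure lebesgue S"
  assume "\<not> negligible {x \<in> {a<..<b}. steep_at u q x \<and> steep_at (\<lambda>x. - u x) (- p) x}"
  then have "\<not> negligible S" by (simp add: S_def Int_def conj_ac)
  then have m: "0 < m" using Sm unfolding m_def by (simp add: negligible_iff_measure0 zero_less_measure_iff)
  define \<epsilon> where "\<epsilon> = (q - p) * m / 4"
  have \<epsilon>: "0 < \<epsilon>" using m \<open>p < q\<close> by (simp add: \<epsilon>_def)
  obtain \<delta> where \<delta>: "0 < \<delta>"
    "\<And>P. finite P \<Longrightarrow> (\<And>x y. (x, y) \<in> P \<Longrightarrow> a \<le> x \<and> x < y \<and> y \<le> b) \<Longrightarrow>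
      disjoint_family_on (\<lambda>(x, y). {x<..<y}) P \<Longrightarrow> (\<Sum>(x, y)\<in>P. y - x) < \<delta> \<Longrightarrow>
      \<bar>\<Sum>(x, y)\<in>P. u y - u x\<bar> < \<epsilon>"
    using abs_continuous_small_sum[OF AC \<epsilon>] by auto
  \<comment> \<open>The last term makes the error \<open>q\<close> times the length of the gaps at most \<open>\<epsilon>\<close>.\<close>
  define \<theta> where "\<theta> = min (m / 4) (min (\<delta> / 4) (\<epsilon> / (3 * \<bar>q\<bar> + 3)))"
  have \<theta>: "0 < \<theta>" "\<theta> \<le> m / 4" "3 * \<theta> < \<delta>" "\<theta> \<le> \<epsilon> / (3 * \<bar>q\<bar> + 3)"
    unfolding \<theta>_def using m \<delta>(1) \<epsilon> by (simp_all add: add_nonneg_pos min_def)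
  have "\<bar>q\<bar> * (3 * \<theta>) \<le> \<theta> * (3 * \<bar>q\<bar> + 3)" using \<theta>(1) by (simp add: algebra_simps)
  also have "\<dots> \<le> \<epsilon>" using \<theta>(4) by (simp add: pos_le_divide_eq add_nonneg_pos)
  finally have q\<theta>: "\<bar>q\<bar> * (3 * \<theta>) \<le> \<epsilon>" .
  obtain G where G: "open G" "S \<subseteq> G" "G \<subseteq> {a<..<b}" "measure lebesgue G < m + \<theta>"
  proof -
    obtain T where T: "open T" "S \<subseteq> T" "(T - S) \<in> lmeasurable" "emeasure lebesgue (T - S) < ennreal \<theta>"
      using sets_lebesgue_outer_open[OF fmeasurableD[OF Sm] \<theta>(1)] by blast
    let ?G = "T \<inter> {a<..<b}"
    have "measure lebesgue (T - S) < \<theta>"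
      using T(4) \<theta>(1) unfolding emeasure_eq_measure2[OF T(3)] by (simp add: ennreal_less_iff)
    moreover have "measure lebesgue ?G \<le> measure lebesgue (S \<union> (T - S))"
    proof (rule measure_mono_fmeasurable)
      show "S \<union> (T - S) \<in> lmeasurable" using Sm T(3) by (rule fmeasurable.Un)
    qed (use T in auto)
    moreover have "measure lebesgue (S \<union> (T - S)) \<le> measure lebesgue S + measure lebesgue (T - S)"
      using Sm T by (intro measure_Un_le) auto
    ultimately show ?thesis using T by (intro that[of ?G]) (auto simp: S_def m_def)
  qed
  have Gm: "G \<in> lmeasurable"
  proof (rule bounded_set_imp_lmeasurable)
    show "bounded G" using G(3) by (rule bounded_subset[rotated]) simp
    show "G \<in> sets lebesgue" using G(1) by auto
  qed
  define K :: "(real \<times> real) set" where "K = {(x, y). x < y \<and> u y - u x < p * (y - x) \<and> {x..y} \<subseteq> G}"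
  have Kfine: "\<exists>c d. (c, d) \<in> K \<and> c < x \<and> x < d \<and> d - c < \<delta>'" if x: "x \<in> S" "0 < \<delta>'" for x \<delta>'
  proof -
    have "steep_at (\<lambda>x. - u x) (- p) x" "x \<in> G" using x G(2) by (auto simp: S_def)
    then obtain c d where "c < x" "x < d" "d - c < \<delta>'" "- p * (d - c) < - u d - - u c" "{c..d} \<subseteq> G"
      using steep_at_fine[of "\<lambda>x. - u x" "- p" x G \<delta>'] G(1) x(2) by metis
    moreover from this have "(c, d) \<in> K" by (simp add: K_def)
    ultimately show ?thesis by blast
  qed
  have Kpos: "x < y" if "(x, y) \<in> K" for x y using that by (simp add: K_def)
  obtain P where P: "finite P" "P \<subseteq> K" "disjoint_family_on (\<lambda>(x, y). {x<..<y}) P"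
      "measure lebesgue (S \<inter> (\<Union>(x, y)\<in>P. {x<..<y})) > m - \<theta>"
    unfolding m_def by (rule Vitali_finite_intervals[OF Sm Kpos Kfine \<theta>(1)])
  have PK: "x < y \<and> u y - u x < p * (y - x) \<and> {x..y} \<subseteq> G" if "(x, y) \<in> P" for x y :: real
    using P(2) that by (auto simp: K_def)
  define U where "U = (\<Union>(x, y)\<in>P. {x<..<y})"
  have U: "open U" "U \<subseteq> G" "U \<in> lmeasurable"
    unfolding U_def using PK P(1) by (force intro!: open_UN fmeasurable.finite_UN)+
  have SU: "S \<inter> U \<in> lmeasurable" using Sm U by blast
  define L :: "(real \<times> real) set" where
    "L = {(x, y). x < y \<and> q * (y - x) < u y - u x \<and> (\<exists>c d. (c, d) \<in> P \<and> c \<le> x \<and> y \<le> d)}"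
  have Lfine: "\<exists>c d. (c, d) \<in> L \<and> c < x \<and> x < d \<and> d - c < \<delta>'" if x: "x \<in> S \<inter> U" "0 < \<delta>'" for x \<delta>'
  proof -
    from x obtain c d where cd: "(c, d) \<in> P" "x \<in> {c<..<d}" by (auto simp: U_def)
    have "steep_at u q x" using x by (simp add: S_def)
    then obtain c' d' where *: "c' < x" "x < d'" "d' - c' < \<delta>'" "q * (d' - c') < u d' - u c'" "{c'..d'} \<subseteq> {c<..<d}"
      using steep_at_fine[of u q x "{c<..<d}" \<delta>'] cd(2) x(2) by (metis open_greaterThanLessThan)
    then have "c' \<in> {c'..d'}" "d' \<in> {c'..d'}" by simp_all
    then have "c' \<in> {c<..<d}" "d' \<in> {c<..<d}" using *(5) by blast+
    then have "c \<le> c'" "d' \<le> d" by simp_all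
    then have "(c', d') \<in> L" using cd(1) * unfolding L_def by (simp, blast)
    then show ?thesis using * by blast
  qed
  have Lpos: "x < y" if "(x, y) \<in> L" for x y using that by (simp add: L_def)
  obtain R where R: "finite R" "R \<subseteq> L" "disjoint_family_on (\<lambda>(x, y). {x<..<y}) R"
      "measure lebesgue (S \<inter> U \<inter> (\<Union>(x, y)\<in>R. {x<..<y})) > measure lebesgue (S \<inter> U) - \<theta>"
    by (rule Vitali_finite_intervals[OF SU Lpos Lfine \<theta>(1)])
  have RL: "x < y \<and> q * (y - x) < u y - u x \<and> (\<exists>c d. (c, d) \<in> P \<and> c \<le> x \<and> y \<le> d)" if "(x, y) \<in> R" for x y
    using R(2) that by (auto simp: L_def)
  have Ppos: "x < y" if "(x, y) \<in> P" for x y using PK[OF that] by blast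
  have Rin: "x < y \<and> (\<exists>c d. (c, d) \<in> P \<and> c \<le> x \<and> y \<le> d)" if "(x, y) \<in> R" for x y
    using RL[OF that] by blast
  obtain Q where Q0: "finite Q" "\<forall>(x, y) \<in> Q. x < y \<and> (\<exists>c d. (c, d) \<in> P \<and> c \<le> x \<and> y \<le> d)"
      "disjoint_family_on (\<lambda>(x, y). {x<..<y}) Q"
      "\<forall>f :: real \<Rightarrow> real. (\<Sum>(x, y)\<in>P. f y - f x) = (\<Sum>(x, y)\<in>R. f y - f x) + (\<Sum>(x, y)\<in>Q. f y - f x)"
    by (rule subdivide_intervals[OF P(1) Ppos P(3) R(1) Rin R(3)])
  have Q: "finite Q" "\<And>x y. (x, y) \<in> Q \<Longrightarrow> x < y \<and> (\<exists>c d. (c, d) \<in> P \<and> c \<le> x \<and> y \<le> d)"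
      "disjoint_family_on (\<lambda>(x, y). {x<..<y}) Q"
    using Q0(1-3) by blast+
  note telescope = Q0(4)[rule_format]
  define A B g where "A = (\<Sum>(x, y)\<in>P. y - x)" and "B = (\<Sum>(x, y)\<in>R. y - x)" and "g = (\<Sum>(x, y)\<in>Q. y - x)"
  have ABg: "A = B + g" using telescope[of "\<lambda>x. x"] by (simp add: A_def B_def g_def)
  have AU: "A = measure lebesgue U"
    unfolding A_def U_def by (rule measure_eq_sum_lengths[OF P(1) Ppos P(3), symmetric])
  have "measure lebesgue U \<le> measure lebesgue G"
    using U Gm by (intro measure_mono_fmeasurable) auto
  then have A1: "A < m + \<theta>" using AU G(4) by simp
  have "measure lebesgue (S \<inter> U) \<le> measure lebesgue U"
    using U SU by (intro measure_mono_fmeasurable) auto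
  then have A2: "m - \<theta> < A" using P(4) AU unfolding U_def[symmetric] by simp
  have RU: "(\<Union>(x, y)\<in>R. {x<..<y}) \<in> lmeasurable" using R(1) by (auto intro!: fmeasurable.finite_UN)
  have "measure lebesgue (S \<inter> U \<inter> (\<Union>(x, y)\<in>R. {x<..<y})) \<le> measure lebesgue (\<Union>(x, y)\<in>R. {x<..<y})"
    using RU SU by (intro measure_mono_fmeasurable) auto
  also have "\<dots> \<le> B" unfolding B_def by (rule measure_le_sum_lengths[OF R(1)]) (use RL in blast)
  finally have B1: "m - 2 * \<theta> < B" using R(4) P(4) unfolding U_def[symmetric] by simp
  have g0: "0 \<le> g" unfolding g_def using Q(2) by (intro sum_nonneg) (clarsimp, blast intro: less_imp_le)
  have g1: "g < 3 * \<theta>" using A1 B1 ABg by simp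
  have Qin: "a \<le> x \<and> x < y \<and> y \<le> b" if xy: "(x, y) \<in> Q" for x y
  proof -
    obtain c d where cd: "(c, d) \<in> P" "c \<le> x" "y \<le> d" "x < y" using Q(2)[OF xy] by blast
    then have "c \<in> {c..d}" "d \<in> {c..d}" using PK[OF cd(1)] by simp_all
    moreover have "{c..d} \<subseteq> {a<..<b}" using PK[OF cd(1)] G(3) by blast
    ultimately have "c \<in> {a<..<b}" "d \<in> {a<..<b}" by blast+
    then show ?thesis using cd by simp
  qed
  have gap: "\<bar>\<Sum>(x, y)\<in>Q. u y - u x\<bar> < \<epsilon>"
    by (rule \<delta>(2)[OF Q(1) Qin Q(3)]) (use g1 \<theta>(3) g_def in auto)
  have "q * B = (\<Sum>(x, y)\<in>R. q * (y - x))" by (simp add: B_def sum_distrib_left split_def)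
  also have "\<dots> \<le> (\<Sum>(x, y)\<in>R. u y - u x)" using RL by (intro sum_mono) (clarsimp, blast intro: less_imp_le)
  also have "\<dots> = (\<Sum>(x, y)\<in>P. u y - u x) - (\<Sum>(x, y)\<in>Q. u y - u x)" using telescope[of u] by simp
  also have "\<dots> \<le> (\<Sum>(x, y)\<in>P. p * (y - x)) + \<epsilon>"
  proof -
    have "(\<Sum>(x, y)\<in>P. u y - u x) \<le> (\<Sum>(x, y)\<in>P. p * (y - x))"
      using PK by (intro sum_mono) (clarsimp, blast intro: less_imp_le)
    then show ?thesis using gap by linarith
  qed
  also have "(\<Sum>(x, y)\<in>P. p * (y - x)) = p * A" by (simp add: A_def sum_distrib_left split_def)
  finally have "(q - p) * A \<le> q * g + \<epsilon>" using ABg by (simp add: algebra_simps)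
  also have "q * g \<le> \<bar>q\<bar> * (3 * \<theta>)" using g0 g1 by (intro mult_mono) auto
  also have "\<dots> \<le> \<epsilon>" by (rule q\<theta>)
  finally have "(q - p) * A \<le> (q - p) * (m / 2)" by (simp add: \<epsilon>_def algebra_simps)
  then have "A \<le> m / 2" using \<open>p < q\<close> by simp
  then show False using A2 \<theta>(2) m by simp
qed

lemma abs_continuous_imp_continuous_on:
  assumes AC: "abs_continuous_on_interval a b u"
  shows "continuous_on {a..b} u"
  unfolding continuous_on_iff
proof (intro ballI allI impI)
  fix x \<epsilon> :: real assume x: "x \<in> {a..b}" and "0 < \<epsilon>"
  then obtain \<delta> where \<delta>: "0 < \<delta>"
    "\<And>P. finite P \<Longrightarrow> (\<And>x y. (x, y) \<in> P \<Longrightarrow> a \<le> x \<and> x < y \<and> y \<le> b) \<Longrightarrow>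
      disjoint_family_on (\<lambda>(x, y). {x<..<y}) P \<Longrightarrow> (\<Sum>(x, y)\<in>P. y - x) < \<delta> \<Longrightarrow>
      \<bar>\<Sum>(x, y)\<in>P. u y - u x\<bar> < \<epsilon>"
    using abs_continuous_small_sum[OF AC] by blast
  have one: "\<bar>u d - u c\<bar> < \<epsilon>" if "a \<le> c" "c < d" "d \<le> b" "d - c < \<delta>" for c d
    using \<delta>(2)[of "{(c, d)}"] that by (simp add: disjoint_family_on_def)
  have "\<bar>u y - u x\<bar> < \<epsilon>" if "y \<in> {a..b}" "\<bar>y - x\<bar> < \<delta>" for y
  proof (cases x y rule: linorder_cases)
    case less
    then show ?thesis using one[of x y] x that by auto
  next
    case equal
    then show ?thesis using \<open>0 < \<epsilon>\<close> by simp
  next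
    case greater
    then show ?thesis using one[of y x] x that by (auto simp: abs_minus_commute)
  qed
  then show "\<exists>d>0. \<forall>x'\<in>{a..b}. dist x' x < d \<longrightarrow> dist (u x') (u x) < \<epsilon>"
    using \<delta>(1) by (intro exI[of _ \<delta>]) (auto simp: dist_real_def)
qed

lemma steep_at_mono: "steep_at u q x \<Longrightarrow> q' \<le> q \<Longrightarrow> steep_at u q' x"
  unfolding steep_at_def
proof (intro allI impI)
  fix \<delta> :: real assume *: "\<forall>\<delta>>0. \<exists>c d. c < x \<and> x < d \<and> d - c < \<delta> \<and> q * (d - c) < u d - u c" "q' \<le> q" "0 < \<delta>"
  then obtain c d where cd: "c < x" "x < d" "d - c < \<delta>" "q * (d - c) < u d - u c" by blast
  moreover have "q' * (d - c) \<le> q * (d - c)" using *(2) cd by (intro mult_right_mono) auto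
  ultimately have "c < x \<and> x < d \<and> d - c < \<delta> \<and> q' * (d - c) < u d - u c" by linarith
  then show "\<exists>c d. c < x \<and> x < d \<and> d - c < \<delta> \<and> q' * (d - c) < u d - u c" by blast
qed

lemma not_steep_at: 
  assumes "\<not> steep_at u q x"
  obtains \<delta> where "0 < \<delta>" "\<And>c d. c < x \<Longrightarrow> x < d \<Longrightarrow> d - c < \<delta> \<Longrightarrow> u d - u c \<le> q * (d - c)"
proof -
  obtain \<delta> where \<delta>: "0 < \<delta>" "\<not> (\<exists>c d. c < x \<and> x < d \<and> d - c < \<delta> \<and> q * (d - c) < u d - u c)"
    using assms unfolding steep_at_def by blast
  have "u d - u c \<le> q * (d - c)" if "c < x" "x < d" "d - c < \<delta>" for c d
    using \<delta>(2) that by (meson not_less)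
  with \<delta>(1) show ?thesis by (rule that)
qed

text \<open>The derivative is the infimum \<open>L\<close> of the slopes at which \<open>u\<close> is not steep. The slopes over short
  intervals around \<open>x\<close> tend to \<open>L\<close>; intervals with end point \<open>x\<close> are reached by continuity.\<close>

lemma differentiable_if_derivates_agree:
  assumes cont: "isCont u x"
    and up: "\<not> steep_at u q0 x" and low: "\<not> steep_at (\<lambda>x. - u x) (- p0) x"
    and agree: "\<And>p q. p \<in> \<rat> \<Longrightarrow> q \<in> \<rat> \<Longrightarrow> p < q \<Longrightarrow> \<not> (steep_at u q x \<and> steep_at (\<lambda>x. - u x) (- p) x)"
  shows "u differentiable (at x)"
proof -
  define A where "A = {q. \<not> steep_at u q x}"
  have "q0 \<in> A" using up by (simp add: A_def)
  obtain \<delta>0 where \<delta>0: "0 < \<delta>0" "\<And>c d. c < x \<Longrightarrow> x < d \<Longrightarrow> d - c < \<delta>0 \<Longrightarrow> - u d - - u c \<le> - p0 * (d - c)"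
    using not_steep_at[OF low] by blast
  have Alow: "p0 \<le> q" if "q \<in> A" for q
  proof -
    obtain \<delta>1 where \<delta>1: "0 < \<delta>1" "\<And>c d. c < x \<Longrightarrow> x < d \<Longrightarrow> d - c < \<delta>1 \<Longrightarrow> u d - u c \<le> q * (d - c)"
      using not_steep_at \<open>q \<in> A\<close> unfolding A_def by blast
    define \<delta> where "\<delta> = min \<delta>0 \<delta>1"
    have "0 < \<delta>" using \<delta>0 \<delta>1 by (simp add: \<delta>_def)
    define c d where "c = x - \<delta> / 4" and "d = x + \<delta> / 4"
    have "c < x" "x < d" "d - c < \<delta>0" "d - c < \<delta>1"
      using \<open>0 < \<delta>\<close> unfolding c_def d_def \<delta>_def by linarith+
    then have "p0 * (d - c) \<le> q * (d - c)" using \<delta>0(2)[of c d] \<delta>1(2)[of c d]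
      unfolding mult_minus_left by linarith
    moreover have "0 < d - c" using \<open>c < x\<close> \<open>x < d\<close> by simp
    ultimately show ?thesis by (rule mult_right_le_imp_le)
  qed
  define L where "L = Inf A"
  have bdd: "bdd_below A" using Alow by (rule bdd_belowI)
  have above: "\<not> steep_at u q x" if "L < q" for q
  proof -
    have "A \<noteq> {}" "Inf A < q" using that \<open>q0 \<in> A\<close> by (auto simp: L_def)
    then obtain q' where "q' \<in> A" "q' < q" using cInf_lessD by blast
    then have "\<not> steep_at u q' x" "q' \<le> q" by (simp_all add: A_def)
    then show ?thesis using steep_at_mono by blast
  qed
  have below: "steep_at u q x" if "q < L" for q
  proof (rule ccontr)
    assume "\<not> steep_at u q x"
    then have "Inf A \<le> q" by (intro cInf_lower bdd) (simp add: A_def)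
    then show False using that by (simp add: L_def)
  qed
  have below': "\<not> steep_at (\<lambda>x. - u x) (- p) x" if pL: "p < L" for p
  proof
    assume st: "steep_at (\<lambda>x. - u x) (- p) x"
    obtain p' where p': "p' \<in> \<rat>" "p < p'" "p' < L" using Rats_dense_in_real[OF pL] by blast
    obtain q' where q': "q' \<in> \<rat>" "p' < q'" "q' < L" using Rats_dense_in_real[OF p'(3)] by blast
    have "steep_at (\<lambda>x. - u x) (- p') x" using steep_at_mono[OF st] p' by simp
    then show False using agree[OF p'(1) q'(1,2)] below[OF q'(3)] by blast
  qed
  have two: "\<exists>\<delta>>0. \<forall>c d. c < x \<and> x < d \<and> d - c < \<delta> \<longrightarrow> \<bar>u d - u c - L * (d - c)\<bar> \<le> \<epsilon> * (d - c)" if \<epsilon>: "0 < \<epsilon>" for \<epsilon>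
  proof -
    have "\<not> steep_at u (L + \<epsilon>) x" "\<not> steep_at (\<lambda>x. - u x) (- (L - \<epsilon>)) x"
      using above[of "L + \<epsilon>"] below'[of "L - \<epsilon>"] \<epsilon> by simp_all
    note flat = this
    obtain \<delta>1 where \<delta>1: "0 < \<delta>1" "\<And>c d. c < x \<Longrightarrow> x < d \<Longrightarrow> d - c < \<delta>1 \<Longrightarrow> u d - u c \<le> (L + \<epsilon>) * (d - c)"
      using not_steep_at[OF flat(1)] by blast
    obtain \<delta>2 where \<delta>2: "0 < \<delta>2" "\<And>c d. c < x \<Longrightarrow> x < d \<Longrightarrow> d - c < \<delta>2 \<Longrightarrow> - u d - - u c \<le> - (L - \<epsilon>) * (d - c)"
      using not_steep_at[OF flat(2)] by blast
    have "\<bar>u d - u c - L * (d - c)\<bar> \<le> \<epsilon> * (d - c)" if "c < x" "x < d" "d - c < min \<delta>1 \<delta>2" for c d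
      using \<delta>1(2)[of c d] \<delta>2(2)[of c d] that by (simp add: algebra_simps abs_le_iff)
    then show ?thesis using \<delta>1(1) \<delta>2(1) by (intro exI[of _ "min \<delta>1 \<delta>2"]) auto
  qed
  have one: "\<exists>\<delta>>0. \<forall>y. norm (y - x) < \<delta> \<longrightarrow> norm (u y - u x - L * (y - x)) \<le> \<epsilon> * norm (y - x)" if \<epsilon>: "0 < \<epsilon>" for \<epsilon>
  proof -
    obtain \<delta> where \<delta>: "0 < \<delta>" "\<And>c d. c < x \<Longrightarrow> x < d \<Longrightarrow> d - c < \<delta> \<Longrightarrow> \<bar>u d - u c - L * (d - c)\<bar> \<le> \<epsilon> * (d - c)"
      using two[OF \<epsilon>] by blast
    have u: "(u \<longlongrightarrow> u x) (at_left x)" "(u \<longlongrightarrow> u x) (at_right x)"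
      using cont unfolding isCont_def by (simp_all add: filterlim_at_split)
    have R: "\<bar>u y - u x - L * (y - x)\<bar> \<le> \<epsilon> * (y - x)" if "x < y" "y - x < \<delta>" for y
    proof (rule tendsto_le[where F = "at_left x"])
      show "((\<lambda>c. \<bar>u y - u c - L * (y - c)\<bar>) \<longlongrightarrow> \<bar>u y - u x - L * (y - x)\<bar>) (at_left x)"
        by (intro tendsto_intros u)
      show "((\<lambda>c. \<epsilon> * (y - c)) \<longlongrightarrow> \<epsilon> * (y - x)) (at_left x)" by (intro tendsto_intros)
      have "\<forall>\<^sub>F c in at_left x. c \<in> {y - \<delta><..<x}" using that by (intro eventually_at_left_real) auto
      then show "\<forall>\<^sub>F c in at_left x. \<bar>u y - u c - L * (y - c)\<bar> \<le> \<epsilon> * (y - c)"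
        by eventually_elim (use \<delta>(2) that in auto)
    qed simp
    have Lf: "\<bar>u x - u y - L * (x - y)\<bar> \<le> \<epsilon> * (x - y)" if "y < x" "x - y < \<delta>" for y
    proof (rule tendsto_le[where F = "at_right x"])
      show "((\<lambda>c. \<bar>u c - u y - L * (c - y)\<bar>) \<longlongrightarrow> \<bar>u x - u y - L * (x - y)\<bar>) (at_right x)"
        by (intro tendsto_intros u)
      show "((\<lambda>c. \<epsilon> * (c - y)) \<longlongrightarrow> \<epsilon> * (x - y)) (at_right x)" by (intro tendsto_intros)
      have "\<forall>\<^sub>F c in at_right x. c \<in> {x<..<y + \<delta>}" using that by (intro eventually_at_right_real) auto
      then show "\<forall>\<^sub>F c in at_right x. \<bar>u c - u y - L * (c - y)\<bar> \<le> \<epsilon> * (c - y)"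
        by eventually_elim (use \<delta>(2) that in auto)
    qed simp
    have "\<bar>u y - u x - L * (y - x)\<bar> \<le> \<epsilon> * \<bar>y - x\<bar>" if "\<bar>y - x\<bar> < \<delta>" for y
    proof (cases x y rule: linorder_cases)
      case less
      then show ?thesis using R[of y] that by simp
    next
      case greater
      have "\<bar>u y - u x - L * (y - x)\<bar> = \<bar>u x - u y - L * (x - y)\<bar>"
        by (subst abs_minus_cancel[symmetric]) (simp add: algebra_simps)
      then show ?thesis using Lf[of y] that greater by simp
    qed simp
    then show ?thesis using \<delta>(1) by auto
  qed
  have "(u has_derivative (\<lambda>h. L * h)) (at x)"
    unfolding has_derivative_at_alt using one by (simp add: bounded_linear_mult_right)
  then show ?thesis unfolding differentiable_def by blast
qed

theorem abs_continuous_differentiable_ae: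
  assumes AC: "abs_continuous_on_interval a b u"
  shows "negligible {x \<in> {a<..<b}. \<not> u differentiable (at x)}"
proof -
  have AC': "abs_continuous_on_interval a b (\<lambda>x. - u x)"
  proof -
    have "\<bar>- u y - - u x\<bar> = \<bar>u y - u x\<bar>" for x y by simp
    then show ?thesis using AC unfolding abs_continuous_on_interval_def by simp
  qed
  define N where "N = {x \<in> {a<..<b}. \<forall>q. steep_at u q x} \<union> {x \<in> {a<..<b}. \<forall>q. steep_at (\<lambda>x. - u x) q x}
    \<union> (\<Union>(p, q)\<in>(\<rat> \<times> \<rat>) \<inter> {(p, q). p < q}. {x \<in> {a<..<b}. steep_at u q x \<and> steep_at (\<lambda>x. - u x) (- p) x})"
  have "negligible N" unfolding N_def
    using negligible_infinite_derivate[OF AC] negligible_infinite_derivate[OF AC'] negligible_two_derivates[OF AC]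
    by (intro negligible_Un negligible_countable_Union countable_image countable_Int1 countable_SIGMA countable_rat) auto
  then show ?thesis
  proof (rule negligible_subset, intro subsetI)
    fix x assume x: "x \<in> {x \<in> {a<..<b}. \<not> u differentiable (at x)}"
    show "x \<in> N"
    proof (rule ccontr)
      assume "x \<notin> N"
      have "isCont u x"
        using continuous_on_interior[OF abs_continuous_imp_continuous_on[OF AC], of x] x by simp
      moreover obtain q0 where "\<not> steep_at u q0 x" using x \<open>x \<notin> N\<close> unfolding N_def by blast
      moreover obtain q1 where "\<not> steep_at (\<lambda>x. - u x) q1 x"
        using x \<open>x \<notin> N\<close> unfolding N_def by blast
      then have "\<not> steep_at (\<lambda>x. - u x) (- (- q1)) x" by simp
      moreover have "\<not> (steep_at u q x \<and> steep_at (\<lambda>x. - u x) (- p) x)" if "p \<in> \<rat>" "q \<in> \<rat>" "p < q" for p q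
        using x \<open>x \<notin> N\<close> that unfolding N_def by blast
      ultimately have "u differentiable (at x)"
        by (rule differentiable_if_derivates_agree)
      then show False using x by blast
    qed
  qed
qed

section \<open>The fundamental theorem of calculus\<close>

text \<open>A gauge proof. At a tag where the derivative exists the gauge makes the increment of \<open>u\<close> close to
  derivative times length; the other tags form a null set and the gauge keeps their intervals inside
  an open set so small that, by absolute continuity, \<open>u\<close> has small total increment there.\<close>

theorem abs_continuous_FTC:
  fixes u u' :: "real \<Rightarrow> real"
  assumes AC: "abs_continuous_on_interval a b u" and "a < b" and N: "negligible N"
    and deriv: "\<And>x. x \<in> {a<..<b} - N \<Longrightarrow> (u has_real_derivative u' x) (at x)"
  shows "(u' has_integral (u b - u a)) {a..b}"
proof -
  define N' where "N' = N \<union> {a, b}"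
  have N': "negligible N'" using N by (auto simp: N'_def intro!: negligible_Un)
  define g where "g x = (if x \<in> N' then 0 else u' x)" for x
  have "(g has_integral (u b - u a)) (cbox a b)"
    unfolding has_integral
  proof (intro allI impI)
    fix \<epsilon> :: real assume \<epsilon>: "0 < \<epsilon>"
    obtain \<delta> where \<delta>: "0 < \<delta>"
      "\<And>P. finite P \<Longrightarrow> (\<And>x y. (x, y) \<in> P \<Longrightarrow> a \<le> x \<and> x < y \<and> y \<le> b) \<Longrightarrow>
        disjoint_family_on (\<lambda>(x, y). {x<..<y}) P \<Longrightarrow> (\<Sum>(x, y)\<in>P. y - x) < \<delta> \<Longrightarrow>
        \<bar>\<Sum>(x, y)\<in>P. u y - u x\<bar> < \<epsilon> / 2"
      using abs_continuous_small_sum[OF AC, of "\<epsilon> / 2"] \<epsilon> by auto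
    have N'm: "N' \<in> null_sets lebesgue" using N' by (simp add: negligible_iff_null_sets)
    obtain G where G: "open G" "N' \<subseteq> G" "G \<in> lmeasurable" "measure lebesgue G < \<delta>"
    proof -
      obtain T where T: "open T" "N' \<subseteq> T" "emeasure lebesgue (T - N') < ennreal \<delta>"
        using sets_lebesgue_outer_open[OF null_setsD2[OF N'm] \<delta>(1)] by blast
      have "emeasure lebesgue T = emeasure lebesgue (T - N')"
        using T(1) N'm by (intro emeasure_Diff_null_set[symmetric]) auto
      then have em: "emeasure lebesgue T < ennreal \<delta>" using T by simp
      then have "T \<in> lmeasurable" using T(1) by (intro fmeasurableI) (auto simp: less_top[symmetric])
      moreover have "measure lebesgue T < \<delta>"
        using em \<delta>(1) unfolding emeasure_eq_measure2[OF \<open>T \<in> lmeasurable\<close>] by (simp add: ennreal_less_iff)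
      ultimately show ?thesis using T by (intro that[of T])
    qed
    define \<epsilon>' where "\<epsilon>' = \<epsilon> / (2 * (b - a))"
    have \<epsilon>': "0 < \<epsilon>'" "\<epsilon>' * (b - a) = \<epsilon> / 2" using \<epsilon> \<open>a < b\<close> by (auto simp: \<epsilon>'_def field_simps)
    have "\<exists>d>0. \<forall>y. norm (y - x) < d \<longrightarrow> norm (u y - u x - u' x * (y - x)) \<le> \<epsilon>' * norm (y - x)"
      if "x \<in> {a..b} - N'" for x
    proof -
      have "(u has_derivative (\<lambda>h. u' x * h)) (at x)"
        using deriv[of x] that unfolding has_field_derivative_def N'_def by auto
      then show ?thesis using \<epsilon>'(1) unfolding has_derivative_at_alt by blast
    qed
    then obtain d where d: "\<And>x. x \<in> {a..b} - N' \<Longrightarrow> 0 < d x"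
      "\<And>x y. x \<in> {a..b} - N' \<Longrightarrow> \<bar>y - x\<bar> < d x \<Longrightarrow> \<bar>u y - u x - u' x * (y - x)\<bar> \<le> \<epsilon>' * \<bar>y - x\<bar>"
      unfolding real_norm_def by metis
    \<comment> \<open>At tags in the null set the intervals stay inside \<open>G\<close>.\<close>
    define \<gamma> where "\<gamma> x = (if x \<in> N' then G else if x \<in> {a..b} then ball x (d x) else UNIV)" for x
    have gau: "gauge \<gamma>" unfolding gauge_def \<gamma>_def using G d(1) by auto
    have bnd: "norm ((\<Sum>(x, k)\<in>D. measure lborel k *\<^sub>R g x) - (u b - u a)) < \<epsilon>"
      if D: "D tagged_division_of cbox a b" "\<gamma> fine D" for D
    proof -
      have finD: "finite D" using D(1) by blast
      have Dk: "\<exists>c e. k = {c..e} \<and> c \<le> x \<and> x \<le> e \<and> a \<le> c \<and> e \<le> b \<and> Inf k = c \<and> Sup k = e \<and> measure lborel k = e - c"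
        if xk: "(x, k) \<in> D" for x k
      proof -
        obtain c e where ce: "k = cbox c e" using tagged_division_ofD(4)[OF D(1) xk] by blast
        have "x \<in> k" "k \<subseteq> cbox a b" using tagged_division_ofD(2,3)[OF D(1) xk] by auto
        then show ?thesis using ce by (auto simp: cbox_interval)
      qed
      define h where "h = (\<lambda>(x::real, k::real set). measure lborel k *\<^sub>R g x - (u (Sup k) - u (Inf k)))"
      have "(\<Sum>(x, k)\<in>D. u (Sup k) - u (Inf k)) = u b - u a"
        using additive_tagged_division_1[of a b D u] \<open>a < b\<close> D(1) by (simp add: cbox_interval)
      then have eq: "(\<Sum>(x, k)\<in>D. measure lborel k *\<^sub>R g x) - (u b - u a) = (\<Sum>i\<in>D. h i)"
        unfolding h_def by (simp add: split_def sum_subtractf)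
      define D1 D2 where "D1 = {i\<in>D. fst i \<in> N'}" and "D2 = {i\<in>D. fst i \<notin> N'}"
      have split: "(\<Sum>i\<in>D. h i) = (\<Sum>i\<in>D1. h i) + (\<Sum>i\<in>D2. h i)"
        using finD by (subst sum.union_disjoint[symmetric]) (auto simp: D1_def D2_def intro: sum.cong)
      have "\<bar>\<Sum>i\<in>D2. h i\<bar> \<le> (\<Sum>i\<in>D2. \<bar>h i\<bar>)" by (rule sum_abs)
      also have "\<dots> \<le> (\<Sum>(x, k)\<in>D2. \<epsilon>' * measure lborel k)"
      proof (rule sum_mono)
        fix i assume i: "i \<in> D2"
        obtain x k where xk: "i = (x, k)" by (cases i)
        obtain c e where ce: "k = {c..e}" "c \<le> x" "x \<le> e" "a \<le> c" "e \<le> b" "Inf k = c" "Sup k = e" "measure lborel k = e - c"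
          using Dk[of x k] i by (auto simp: D2_def xk)
        have xN: "x \<in> {a..b} - N'" using i ce by (auto simp: D2_def xk)
        have "k \<subseteq> \<gamma> x" using D(2) i by (auto simp: fine_def D2_def xk)
        then have "k \<subseteq> ball x (d x)" using xN by (simp add: \<gamma>_def)
        moreover have "c \<in> k" "e \<in> k" using ce by auto
        ultimately have "c \<in> ball x (d x)" "e \<in> ball x (d x)" by blast+
        then have "\<bar>u c - u x - u' x * (c - x)\<bar> \<le> \<epsilon>' * \<bar>c - x\<bar>" "\<bar>u e - u x - u' x * (e - x)\<bar> \<le> \<epsilon>' * \<bar>e - x\<bar>"
          using d(2)[OF xN] by (auto simp: dist_real_def abs_minus_commute)
        moreover have "h i = (u c - u x - u' x * (c - x)) - (u e - u x - u' x * (e - x))"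
          using ce xN by (simp add: h_def xk g_def algebra_simps)
        moreover have "\<epsilon>' * \<bar>c - x\<bar> + \<epsilon>' * \<bar>e - x\<bar> = \<epsilon>' * measure lborel k"
          using ce by (simp add: algebra_simps)
        ultimately show "\<bar>h i\<bar> \<le> (case i of (x, k) \<Rightarrow> \<epsilon>' * measure lborel k)" unfolding xk by simp
      qed
      also have "\<dots> \<le> (\<Sum>(x, k)\<in>D. \<epsilon>' * measure lborel k)"
        by (rule sum_mono2) (use finD \<epsilon>'(1) in \<open>auto simp: D2_def\<close>)
      also have "\<dots> = \<epsilon>' * (\<Sum>(x, k)\<in>D. measure lborel k)" by (simp add: sum_distrib_left split_def)
      also have "(\<Sum>(x, k)\<in>D. measure lborel k) = measure lborel (cbox a b)"
        using D(1) by (rule additive_content_tagged_division)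
      also have "\<epsilon>' * measure lborel (cbox a b) = \<epsilon> / 2" using \<epsilon>'(2) \<open>a < b\<close> by simp
      finally have part2: "\<bar>\<Sum>i\<in>D2. h i\<bar> \<le> \<epsilon> / 2" .
      \<comment> \<open>Degenerate intervals contribute nothing, and only the others can be told apart by their end points.\<close>
      define D3 where "D3 = {i\<in>D1. Inf (snd i) < Sup (snd i)}"
      define \<phi> where "\<phi> = (\<lambda>i::real \<times> real set. (Inf (snd i), Sup (snd i)))"
      define P where "P = \<phi> ` D3"
      have D3D: "D3 \<subseteq> D" "D3 \<subseteq> D1" by (auto simp: D3_def D1_def)
      have k_eq: "k = {Inf k..Sup k}" if "(x, k) \<in> D" for x k using Dk[OF that] by auto
      have k_le: "Inf k \<le> Sup k" if "(x, k) \<in> D" for x k using Dk[OF that] by auto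
      have int_k: "interior k = {Inf k<..<Sup k}" if "(x, k) \<in> D" for x k
        using k_eq[OF that] by (metis interior_atLeastAtMost_real)
      have dis: "{Inf (snd i)<..<Sup (snd i)} \<inter> {Inf (snd j)<..<Sup (snd j)} = {}" if ij: "i \<in> D" "j \<in> D" "i \<noteq> j" for i j
      proof -
        obtain x k y l where xk: "i = (x, k)" "j = (y, l)" by (cases i, cases j)
        have "interior k \<inter> interior l = {}" using tagged_division_ofD(5)[OF D(1), of x k y l] ij xk by blast
        moreover have "interior k = {Inf k<..<Sup k}" "interior l = {Inf l<..<Sup l}"
          using int_k ij xk by blast+
        ultimately show ?thesis by (simp add: xk)
      qed
      have inj: "inj_on \<phi> D3"
      proof (rule inj_onI, rule ccontr)
        fix i j assume ij: "i \<in> D3" "j \<in> D3" "\<phi> i = \<phi> j" "i \<noteq> j"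
        then have "{Inf (snd i)<..<Sup (snd i)} = {}" using dis[of i j] D3D by (auto simp: \<phi>_def)
        moreover have "Inf (snd i) < Sup (snd i)" using ij by (simp add: D3_def)
        ultimately show False using dense by auto
      qed
      have P: "finite P" using finD D3D by (auto simp: P_def intro: finite_subset)
      have Pin: "a \<le> x \<and> x < y \<and> y \<le> b" if "(x, y) \<in> P" for x y
      proof -
        obtain z k where zk: "(z, k) \<in> D3" "x = Inf k" "y = Sup k" using \<open>(x, y) \<in> P\<close> by (auto simp: P_def \<phi>_def)
        then show ?thesis using Dk[of z k] D3D by (auto simp: D3_def)
      qed
      have Pdis: "disjoint_family_on (\<lambda>(x, y). {x<..<y}) P"
        unfolding disjoint_family_on_def P_def
      proof (intro ballI impI)
        fix m n assume "m \<in> \<phi> ` D3" "n \<in> \<phi> ` D3" "m \<noteq> n"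
        then obtain i j where "i \<in> D3" "j \<in> D3" "i \<noteq> j" "m = \<phi> i" "n = \<phi> j" by blast
        then show "(case m of (x, y) \<Rightarrow> {x<..<y}) \<inter> (case n of (x, y) \<Rightarrow> {x<..<y}) = {}"
          using dis[of i j] D3D by (auto simp: \<phi>_def)
      qed
      have PG: "{x<..<y} \<subseteq> G" if "(x, y) \<in> P" for x y
      proof -
        obtain z k where zk: "(z, k) \<in> D3" "x = Inf k" "y = Sup k" using \<open>(x, y) \<in> P\<close> by (auto simp: P_def \<phi>_def)
        then have "(z, k) \<in> D" "z \<in> N'" using D3D by (auto simp: D1_def)
        then have "k \<subseteq> \<gamma> z" using D(2) unfolding fine_def by blast
        then have "k \<subseteq> G" using \<open>z \<in> N'\<close> by (simp add: \<gamma>_def)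
        moreover have "k = {x..y}" unfolding zk(2,3) by (rule k_eq[OF \<open>(z, k) \<in> D\<close>])
        then have "{x<..<y} \<subseteq> k" by auto
        ultimately show ?thesis by blast
      qed
      have "(\<Sum>(x, y)\<in>P. y - x) = measure lebesgue (\<Union>(x, y)\<in>P. {x<..<y})"
        by (rule measure_eq_sum_lengths[OF P _ Pdis, symmetric]) (use Pin in blast)
      also have "\<dots> \<le> measure lebesgue G"
      proof (rule measure_mono_fmeasurable)
        show "(\<Union>(x, y)\<in>P. {x<..<y}) \<subseteq> G" using PG by blast
        show "(\<Union>(x, y)\<in>P. {x<..<y}) \<in> sets lebesgue" by (rule sets.finite_UN) (use P in auto)
      qed (rule G(3))
      finally have len: "(\<Sum>(x, y)\<in>P. y - x) < \<delta>" using G(4) by simp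
      have "(\<Sum>i\<in>D1. h i) = (\<Sum>i\<in>D3. h i)"
      proof (rule sum.mono_neutral_right)
        show "\<forall>i\<in>D1 - D3. h i = 0"
        proof
          fix i assume i: "i \<in> D1 - D3"
          obtain x k where xk: "i = (x, k)" by (cases i)
          have "(x, k) \<in> D" "x \<in> N'" "\<not> Inf k < Sup k" using i by (auto simp: xk D1_def D3_def)
          then have "Inf k = Sup k" using k_le[of x k] by simp
          then show "h i = 0" using \<open>x \<in> N'\<close> by (simp add: xk h_def g_def)
        qed
      qed (use finD D3D in \<open>auto simp: D1_def\<close>)
      also have "\<dots> = (\<Sum>i\<in>D3. - (u (Sup (snd i)) - u (Inf (snd i))))"
        by (rule sum.cong) (auto simp: D3_def D1_def h_def g_def)
      also have "\<dots> = - (\<Sum>(x, y)\<in>P. u y - u x)"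
        unfolding P_def by (subst sum.reindex[OF inj]) (simp add: sum_negf[symmetric] \<phi>_def)
      finally have "\<bar>\<Sum>i\<in>D1. h i\<bar> < \<epsilon> / 2" using \<delta>(2)[OF P Pin Pdis len] by simp
      then show ?thesis using part2 split eq by simp
    qed
    show "\<exists>\<gamma>. gauge \<gamma> \<and> (\<forall>D. D tagged_division_of cbox a b \<and> \<gamma> fine D \<longrightarrow>
        norm ((\<Sum>(x, k)\<in>D. measure lborel k *\<^sub>R g x) - (u b - u a)) < \<epsilon>)"
    proof (intro exI[of _ \<gamma>] conjI allI impI)
      show "gauge \<gamma>" by (rule gau)
      fix D assume "D tagged_division_of cbox a b \<and> \<gamma> fine D"
      then show "norm ((\<Sum>(x, k)\<in>D. measure lborel k *\<^sub>R g x) - (u b - u a)) < \<epsilon>"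
        by (elim conjE) (rule bnd)
    qed
  qed
  then show ?thesis
    unfolding cbox_interval by (rule has_integral_spike[OF N', rotated]) (auto simp: g_def)
qed

lemma abs_continuous_increment_le:
  assumes AC: "abs_continuous_on_interval a b u" and "a < b"
    and meas: "set_borel_measurable lebesgue {a..b} (deriv u)"
  shows "ennreal \<bar>u b - u a\<bar> \<le> (\<integral>\<^sup>+x\<in>{a..b}. ennreal \<bar>deriv u x\<bar> \<partial>lebesgue)"
proof (cases "(\<integral>\<^sup>+x\<in>{a..b}. ennreal \<bar>deriv u x\<bar> \<partial>lebesgue) = \<infinity>")
  case False
  have "(deriv u has_integral (u b - u a)) {a..b}"
  proof (rule abs_continuous_FTC[OF AC \<open>a < b\<close> abs_continuous_differentiable_ae[OF AC]])
    fix x assume "x \<in> {a<..<b} - {x \<in> {a<..<b}. \<not> u differentiable (at x)}"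
    then have "u differentiable (at x)" by auto
    then show "(u has_real_derivative deriv u x) (at x)"
      by (simp add: DERIV_deriv_iff_real_differentiable)
  qed
  have eq: "(\<integral>\<^sup>+x. ennreal (norm (indicator {a..b} x *\<^sub>R deriv u x)) \<partial>lebesgue) = (\<integral>\<^sup>+x\<in>{a..b}. ennreal \<bar>deriv u x\<bar> \<partial>lebesgue)"
    by (rule nn_integral_cong) (auto simp: indicator_def)
  have int: "set_integrable lebesgue {a..b} (deriv u)"
    unfolding set_integrable_def
  proof (rule integrableI_bounded)
    show "(\<integral>\<^sup>+x. ennreal (norm (indicator {a..b} x *\<^sub>R deriv u x)) \<partial>lebesgue) < \<infinity>"
      unfolding eq using False by (simp add: less_top)
  qed (use meas in \<open>simp add: set_borel_measurable_def\<close>)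
  have "u b - u a = (LINT x:{a..b}|lebesgue. deriv u x)"
    using has_integral_set_lebesgue[OF int] \<open>(deriv u has_integral (u b - u a)) {a..b}\<close>
    by (meson has_integral_unique)
  then have "\<bar>u b - u a\<bar> \<le> (\<integral>x. norm (indicator {a..b} x *\<^sub>R deriv u x) \<partial>lebesgue)"
    unfolding set_lebesgue_integral_def using integral_norm_bound by (metis real_norm_def)
  also have "ennreal \<dots> = (\<integral>\<^sup>+x. ennreal (norm (indicator {a..b} x *\<^sub>R deriv u x)) \<partial>lebesgue)"
    using int unfolding set_integrable_def by (intro nn_integral_eq_integral[symmetric] integrable_norm) auto
  finally show ?thesis unfolding eq by (simp add: ennreal_leI)
qed simp

section \<open>Bounds for the truncated exponential and for powers\<close>

lemma Gamma_ge_fact: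
  fixes p :: real assumes "p > 1"
  shows "Gamma p * fact j \<le> Gamma (p + real j)"
proof (induction j)
  case (Suc j)
  have "p + real j \<notin> \<int>\<^sub>\<le>\<^sub>0" using assms nonpos_Ints_nonpos by fastforce
  then have "Gamma (p + real (Suc j)) = (p + real j) * Gamma (p + real j)"
    using Gamma_plus1[of "p + real j"] by (simp add: add_ac)
  moreover have "real (Suc j) * (Gamma p * fact j) \<le> (p + real j) * Gamma (p + real j)"
    using Suc assms Gamma_real_pos[of p] by (intro mult_mono) auto
  ultimately show ?case by (simp add: mult_ac)
qed simp

lemma exp_p_term_le_small:
  fixes p x :: real assumes "p > 1" "0 \<le> x"
  shows "x powr (p - 1 + real j) / Gamma (p + real j) \<le> x powr (p - 1) / Gamma p * (x ^ j / fact j)"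
proof (cases "x = 0")
  case True
  then show ?thesis using assms by (simp add: add_nonneg_eq_0_iff)
next
  case False
  then have eq: "x powr (p - 1 + real j) = x powr (p - 1) * x ^ j"
    using assms by (simp add: powr_add powr_realpow)
  have "0 < Gamma p" "0 < Gamma (p + real j)" using assms by (auto intro!: Gamma_real_pos)
  then have "x powr (p - 1) * x ^ j / Gamma (p + real j) \<le> x powr (p - 1) * x ^ j / (Gamma p * fact j)"
    using assms Gamma_ge_fact[OF assms(1), of j] by (intro divide_left_mono) auto
  then show ?thesis unfolding eq by simp
qed

lemma exp_p_summable:
  fixes p x :: real assumes "p > 1" "0 \<le> x"
  shows "summable (\<lambda>j. x powr (p - 1 + real j) / Gamma (p + real j))"
proof (rule summable_comparison_test')
  show "summable (\<lambda>j. x powr (p - 1) / Gamma p * (x ^ j / fact j))"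
    using summable_exp[of x] by (intro summable_mult) (simp add: divide_inverse mult_ac)
  show "norm (x powr (p - 1 + real j) / Gamma (p + real j)) \<le> x powr (p - 1) / Gamma p * (x ^ j / fact j)" for j
  proof -
    have "0 < Gamma (p + real j)" using assms by (auto intro!: Gamma_real_pos)
    then show ?thesis using exp_p_term_le_small[OF assms, of j] by simp
  qed
qed

lemma exp_series_sums: "(\<lambda>j. x ^ j / fact j) sums exp (x :: real)"
  using exp_converges[of x] by (simp add: divide_inverse mult_ac)

text \<open>Sharp for small \<open>x\<close>: it rests on \<open>Gamma (p + j) \<ge> Gamma p * j!\<close>.\<close>

lemma exp_p_le_powr_exp:
  assumes "p > 1" "0 \<le> x"
  shows "exp_p p x \<le> x powr (p - 1) / Gamma p * exp x"
  unfolding exp_p_def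
proof -
  have S: "(\<lambda>j. x powr (p - 1) / Gamma p * (x ^ j / fact j)) sums (x powr (p - 1) / Gamma p * exp x)"
    by (intro sums_mult exp_series_sums)
  have "(\<Sum>j. x powr (p - 1 + real j) / Gamma (p + real j)) \<le> (\<Sum>j. x powr (p - 1) / Gamma p * (x ^ j / fact j))"
    by (rule suminf_le[OF exp_p_term_le_small[OF assms] exp_p_summable[OF assms] sums_summable[OF S]])
  then show "(\<Sum>j. x powr (p - 1 + real j) / Gamma (p + real j)) \<le> x powr (p - 1) / Gamma p * exp x"
    using sums_unique[OF S] by simp
qed

text \<open>A bound of Gautschi type: logarithmic convexity of \<open>Gamma\<close> at
  \<open>m + 1 = \<theta> s + (1 - \<theta>) (s + 1)\<close>, where \<open>s = m + \<theta>\<close>.\<close>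

lemma fact_powr_le_Gamma:
  fixes \<theta> :: real
  assumes "0 \<le> \<theta>" "\<theta> \<le> 1" "0 < real m + \<theta>"
  shows "fact m * (real m + \<theta>) powr \<theta> \<le> Gamma (real m + \<theta> + 1)"
proof -
  let ?s = "real m + \<theta>"
  have "(ln \<circ> Gamma) ((1 - \<theta>) *\<^sub>R (?s + 1) + \<theta> *\<^sub>R ?s) \<le> (1 - \<theta>) * (ln \<circ> Gamma) (?s + 1) + \<theta> * (ln \<circ> Gamma) ?s"
    by (rule convex_onD[OF log_convex_Gamma_real]) (use assms in auto)
  moreover have "(1 - \<theta>) *\<^sub>R (?s + 1) + \<theta> *\<^sub>R ?s = real m + 1" by (simp add: algebra_simps)
  moreover have "?s \<notin> \<int>\<^sub>\<le>\<^sub>0" using assms nonpos_Ints_nonpos by fastforce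
  then have G: "Gamma (?s + 1) = ?s * Gamma ?s" by (rule Gamma_plus1)
  have pos: "0 < Gamma ?s" using assms by (intro Gamma_real_pos)
  have "ln (Gamma (?s + 1)) = ln ?s + ln (Gamma ?s)"
    unfolding G using assms pos by (intro ln_mult_pos) auto
  then have "ln (Gamma ?s) = ln (Gamma (?s + 1)) - ln ?s" by simp
  ultimately have "ln (Gamma (real m + 1)) \<le> (1 - \<theta>) * ln (Gamma (?s + 1)) + \<theta> * (ln (Gamma (?s + 1)) - ln ?s)"
    by simp
  then have "ln (fact m) + \<theta> * ln ?s \<le> ln (Gamma (?s + 1))"
    using Gamma_fact[of m, where 'a = real] by (simp add: algebra_simps)
  then have "exp (ln (fact m) + \<theta> * ln ?s) \<le> exp (ln (Gamma (?s + 1)))" by simp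
  then show ?thesis
    using assms G pos by (simp add: exp_add powr_def)
qed

lemma powr_div_Gamma_le:
  fixes \<theta> s x :: real
  assumes "0 \<le> \<theta>" "\<theta> \<le> 1" "s = real m + \<theta>" "0 < s" "0 < x"
  shows "x powr s / Gamma (s + 1) \<le> (1 + x / s) * (x ^ m / fact m)"
proof -
  have "s powr \<theta> * fact m \<le> Gamma (s + 1)"
    using fact_powr_le_Gamma[OF assms(1,2), of m] assms by (simp add: mult.commute)
  then have "x powr s / Gamma (s + 1) \<le> x powr s / (s powr \<theta> * fact m)"
    using assms(4,5) by (intro divide_left_mono mult_pos_pos Gamma_real_pos) auto
  also have "\<dots> = (x / s) powr \<theta> * (x ^ m / fact m)"
  proof -
    have "x powr s = x powr \<theta> * x ^ m"
      using assms(5) by (simp add: assms(3) powr_add powr_realpow)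
    then show ?thesis using assms(4,5) by (simp add: powr_divide)
  qed
  also have "\<dots> \<le> (1 + x / s) * (x ^ m / fact m)"
  proof (rule mult_right_mono)
    have "(x / s) powr \<theta> \<le> (1 + x / s) powr \<theta>" using assms by (intro powr_mono2) auto
    also have "\<dots> \<le> (1 + x / s) powr 1" using assms by (intro powr_mono) auto
    also have "\<dots> = 1 + x / s" using assms(4,5) by (simp add: add_nonneg_pos)
    finally show "(x / s) powr \<theta> \<le> 1 + x / s" .
  qed (use assms in auto)
  finally show ?thesis .
qed

text \<open>Each term of the series, with its possibly non-integer exponent \<open>s = m + \<theta>\<close>, is dominated by multiples of the terms with the
  exponents \<open>m\<close> and \<open>m + 1\<close> of the exponential series, so that no power of \<open>x\<close> is lost.\<close>

lemma exp_p_le_exp: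
  assumes "p > 1" "0 \<le> x"
  shows "exp_p p x \<le> (1 + p / (p - 1)) * exp x"
proof -
  define q where "q = p / (p - 1)"
  define n where "n = nat \<lfloor>p - 1\<rfloor>"
  define \<theta> where "\<theta> = p - 1 - real n"
  have \<theta>: "0 \<le> \<theta>" "\<theta> \<le> 1" using assms unfolding \<theta>_def n_def by linarith+
  have q: "q > 1" using assms by (simp add: q_def)
  let ?f = "\<lambda>m. x ^ m / fact m"
  have f0: "0 \<le> ?f m" for m using assms by simp
  have term_le: "x powr (p - 1 + real j) / Gamma (p + real j) \<le> ?f (j + n) + q * ?f (j + (n + 1))" for j
  proof (cases "x = 0")
    case True
    then show ?thesis using assms q f0 by (simp add: add_nonneg_eq_0_iff)
  next
    case False
    then have x: "0 < x" using assms by simp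
    define m s where "m = j + n" and "s = p - 1 + real j"
    have s: "s = real m + \<theta>" "0 < s" using assms by (auto simp: \<theta>_def m_def s_def)
    have "(p - 1) * (real m + 1) \<le> (p - 1) * (s + 1)" using s \<theta> assms by (intro mult_left_mono) auto
    also have "\<dots> \<le> p * s" using assms by (simp add: s_def algebra_simps)
    finally have "real m + 1 \<le> q * s" using assms by (simp add: q_def field_simps)
    then have "x * (real m + 1) \<le> x * (q * s)" using x by (intro mult_left_mono) auto
    then have "x / s \<le> x * (q / (real m + 1))"
      using x s(2) by (simp add: pos_divide_le_eq pos_le_divide_eq mult_ac add_pos_nonneg)
    then have xs: "x / s \<le> q * (x / (real m + 1))" by (simp add: mult_ac)
    have "p + real j = s + 1" by (simp add: s_def)
    then have "x powr (p - 1 + real j) / Gamma (p + real j) = x powr s / Gamma (s + 1)"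
      by (simp only: s_def)
    also have "\<dots> \<le> (1 + x / s) * ?f m"
      by (rule powr_div_Gamma_le[OF \<theta> s x])
    also have "\<dots> \<le> (1 + q * (x / (real m + 1))) * ?f m"
      using xs by (intro mult_right_mono f0) simp
    also have "\<dots> = ?f m + q * (x / (real m + 1) * ?f m)" by (simp only: distrib_right mult_1_left mult.assoc)
    also have "x / (real m + 1) * ?f m = ?f (Suc m)" by (simp add: add.commute)
    also have "Suc m = j + (n + 1)" by (simp add: m_def)
    also have "?f m = ?f (j + n)" by (simp add: m_def)
    finally show ?thesis .
  qed
  have shift: "summable (\<lambda>j. ?f (j + k))" "(\<Sum>j. ?f (j + k)) \<le> exp x" for k
  proof -
    show "summable (\<lambda>j. ?f (j + k))" using exp_series_sums[of x] by (auto simp: sums_iff intro: summable_ignore_initial_segment)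
    have "exp x = (\<Sum>j. ?f (j + k)) + (\<Sum>j<k. ?f j)"
      using suminf_split_initial_segment[of ?f k] exp_series_sums[of x] by (auto simp: sums_iff)
    moreover have "0 \<le> (\<Sum>j<k. ?f j)" using f0 by (intro sum_nonneg) auto
    ultimately show "(\<Sum>j. ?f (j + k)) \<le> exp x" by simp
  qed
  have "exp_p p x \<le> (\<Sum>j. ?f (j + n) + q * ?f (j + (n + 1)))"
    unfolding exp_p_def
    by (rule suminf_le[OF term_le exp_p_summable[OF assms]]) (intro summable_add summable_mult shift)
  also have "\<dots> = (\<Sum>j. ?f (j + n)) + q * (\<Sum>j. ?f (j + (n + 1)))"
    by (simp only: suminf_add[symmetric] suminf_mult[symmetric] shift summable_mult)
  also have "\<dots> \<le> exp x + q * exp x"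
    using q by (intro add_mono mult_left_mono shift(2)) simp
  finally show ?thesis by (simp add: q_def algebra_simps)
qed

text \<open>Concavity of \<open>x powr r\<close>: the graph is below its tangent at \<open>y\<close>, also at the boundary point 0.\<close>

lemma powr_le_tangent:
  fixes r x y :: real
  assumes "0 \<le> x" "0 < y" "0 \<le> r" "r \<le> 1"
  shows "x powr r \<le> y powr r + r * y powr (r - 1) * (x - y)"
proof (cases "x = 0")
  case True
  have "y powr (r - 1) * y = y powr r" using assms by (simp add: powr_diff)
  then have "r * y powr (r - 1) * (0 - y) = - (r * y powr r)" by (simp add: mult.assoc)
  moreover have "r * y powr r \<le> 1 * y powr r" using assms by (intro mult_right_mono) auto
  ultimately have "0 \<le> y powr r + r * y powr (r - 1) * (0 - y)" by linarith
  then show ?thesis using True by simp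
next
  case False
  then have x: "0 < x" using assms by simp
  have "(x / y) powr r * 1 powr (1 - r) \<le> r * (x / y) + (1 - r) * 1"
    using x assms by (intro Youngs_inequality_0) auto
  then have "y powr r * (x powr r / y powr r) \<le> y powr r * (r * (x / y) + (1 - r))"
    using x assms by (intro mult_left_mono) (auto simp: powr_divide)
  moreover have "y powr r * (r * (x / y) + (1 - r)) = y powr r + r * y powr (r - 1) * (x - y)"
    using assms by (simp add: powr_diff field_simps)
  ultimately show ?thesis using assms by simp
qed

lemma powr_sum_le:
  fixes a b q :: real
  assumes "0 \<le> a" "0 \<le> b" "1 \<le> q"
  shows "(a + b) powr q \<le> 2 powr (q - 1) * (a powr q + b powr q)"
proof (cases "a = 0 \<or> b = 0")
  case True
  have "1 \<le> (2::real) powr (q - 1)" using assms by (simp add: ge_one_powr_ge_zero)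
  then have "1 * c powr q \<le> 2 powr (q - 1) * c powr q" for c :: real by (intro mult_right_mono) auto
  then show ?thesis using True by auto
next
  case False
  then have ab: "0 < a" "0 < b" using assms by auto
  have "((a + b) / 2) powr q \<le> (a powr q + b powr q) / 2"
    using convex_onD[OF powr_convex, of q "1/2" a b] ab assms by (simp add: field_simps)
  then have "2 powr q * ((a + b) powr q / 2 powr q) \<le> 2 powr q * ((a powr q + b powr q) / 2)"
    using ab by (intro mult_left_mono) (simp_all add: powr_divide)
  then show ?thesis by (simp add: powr_diff)
qed

lemma Bernoulli_powr:
  fixes y r :: real
  assumes "0 \<le> y" "y \<le> 1" "0 < r"
  shows "1 - (r + 1) * y \<le> (1 - y) powr r"
proof (cases "y = 1")
  case False
  then have y: "0 < 1 - y" using assms by simp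
  have "((1 - y) powr (r + 1)) powr (1 / (r + 1)) * 1 powr (r / (r + 1))
      \<le> 1 / (r + 1) * (1 - y) powr (r + 1) + r / (r + 1) * 1"
    using y assms by (intro Youngs_inequality_0) (auto simp: field_simps)
  then have "1 - y \<le> ((1 - y) powr (r + 1) + r) / (r + 1)"
    using y assms by (simp add: powr_powr add_divide_distrib)
  then have "(1 - y) * (r + 1) \<le> (1 - y) powr (r + 1) + r" using assms by (simp add: pos_le_divide_eq)
  moreover have "(1 - y) powr (r + 1) \<le> (1 - y) powr r" using y assms by (intro powr_mono') auto
  ultimately show ?thesis by (simp add: algebra_simps)
qed (use assms in auto)

lemma conjugate_exponent:
  fixes p :: real assumes "p > 1"
  defines "q \<equiv> p / (p - 1)"
  shows "q > 1" "1 / q = 1 - 1 / p" "1 / q - 1 = - (1 / p)" "p / q = p - 1" "q / p = q - 1" "q * (p - 1) = p"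
    "1 / p + 1 / q = 1"
  using assms by (auto simp: q_def field_simps)

section \<open>Moser's inequality on the half-line\<close>

text \<open>The core of Moser's argument. For \<open>v\<close> with energy at most 1 and \<open>v 0 = 0\<close> the quantity
  \<open>s - \<bar>v s\<bar>\<^sup>q\<close> is nonnegative, and the times at which it is at most \<open>\<kappa>\<close> lie in two intervals of
  length of order \<open>\<kappa>\<close>. For at such a time \<open>s\<close>, if it is large compared with \<open>\<kappa>\<close>, almost all of the
  energy has been spent: at most \<open>p \<kappa> / s\<close> is left. If \<open>v\<close> is
  again almost extremal at a time \<open>t\<close> much later, it must have grown by more than this remainder
  allows.\<close>

lemma moser_sublevel_spread:
  fixes p :: real
  assumes "p > 1"
  defines "q \<equiv> p / (p - 1)"
  defines "D \<equiv> (2 * q) powr p * (2 * p)"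
  assumes st: "0 \<le> s" "s \<le> t" and lam: "1 \<le> \<kappa>"
    and en: "0 \<le> \<nu>" "\<mu> + \<nu> \<le> 1"
    and vs: "\<bar>v s\<bar> powr p \<le> s powr (p - 1) * \<mu>"
    and vst: "\<bar>v t - v s\<bar> powr p \<le> (t - s) powr (p - 1) * \<nu>"
    and Fs: "s - \<bar>v s\<bar> powr q \<le> \<kappa>" and Ft: "t - \<bar>v t\<bar> powr q \<le> \<kappa>"
  shows "s \<le> D * \<kappa> \<or> t - s \<le> D * \<kappa>"
proof (rule ccontr)
  note q = conjugate_exponent[OF \<open>p > 1\<close>, folded q_def]
  assume far: "\<not> (s \<le> D * \<kappa> \<or> t - s \<le> D * \<kappa>)"
  define d where "d = t - s"
  have big: "D * \<kappa> < s" "D * \<kappa> < d" using far by (auto simp: d_def)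
  have "1 \<le> (2 * q) powr p" using q(1) \<open>p > 1\<close> by (intro ge_one_powr_ge_zero) auto
  then have "1 * 2 \<le> D" unfolding D_def using \<open>p > 1\<close> by (intro mult_mono) auto
  then have D2: "2 * \<kappa> \<le> D * \<kappa>" using lam by (intro mult_right_mono) auto
  have s0: "0 < s" "\<kappa> < s" and d0: "0 < d" "2 * \<kappa> < d" using big D2 lam by linarith+
  have "((s - \<kappa>) / s) powr (p - 1) * s powr (p - 1) = (s - \<kappa>) powr (p - 1)"
    using s0 by (simp add: powr_divide)
  also have "\<dots> \<le> (\<bar>v s\<bar> powr q) powr (p - 1)"
    using Fs s0 \<open>p > 1\<close> by (intro powr_mono2) auto
  also have "\<dots> = \<bar>v s\<bar> powr p" using q(6) by (simp add: powr_powr)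
  also have "\<dots> \<le> \<mu> * s powr (p - 1)" using vs by (simp add: mult.commute)
  finally have "((s - \<kappa>) / s) powr (p - 1) \<le> \<mu>" using s0 by simp
  moreover have "1 - (p - 1 + 1) * (\<kappa> / s) \<le> (1 - \<kappa> / s) powr (p - 1)"
    using s0 lam \<open>p > 1\<close> by (intro Bernoulli_powr) auto
  moreover have "(s - \<kappa>) / s = 1 - \<kappa> / s" using s0 by (simp add: diff_divide_distrib)
  ultimately have e2: "\<nu> \<le> p * (\<kappa> / s)" using en by simp
  have vs1: "\<bar>v s\<bar> \<le> s powr (1 / q)"
  proof -
    have "\<bar>v s\<bar> powr p \<le> s powr (p - 1) * 1" using vs en by (elim order_trans) (intro mult_left_mono, auto)
    then have "(\<bar>v s\<bar> powr p) powr (1 / p) \<le> (s powr (p - 1)) powr (1 / p)"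
      using \<open>p > 1\<close> by (intro powr_mono2) auto
    then show ?thesis using \<open>p > 1\<close> q(2) by (simp add: powr_powr diff_divide_distrib)
  qed
  define y where "y = s + d / 2"
  have "y powr (1 / q) \<le> (t - \<kappa>) powr (1 / q)"
  proof (rule powr_mono2)
    have "y + d / 2 = t" by (simp add: y_def d_def)
    then show "y \<le> t - \<kappa>" using d0 by linarith
  qed (use d0 s0 q(1) in \<open>auto simp: y_def\<close>)
  also have "\<dots> \<le> (\<bar>v t\<bar> powr q) powr (1 / q)"
    using Ft q(1) d0 s0 by (intro powr_mono2) (auto simp: d_def)
  also have "\<dots> = \<bar>v t\<bar>" using q(1) by (simp add: powr_powr)
  also have "\<dots> \<le> s powr (1 / q) + \<bar>v t - v s\<bar>" using vs1 by linarith
  finally have up: "y powr (1 / q) - s powr (1 / q) \<le> \<bar>v t - v s\<bar>" by simp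
  have "s powr (1 / q) \<le> y powr (1 / q) + 1 / q * y powr (1 / q - 1) * (s - y)"
    using s0 d0 q(1) by (intro powr_le_tangent) (auto simp: y_def)
  then have "d / (2 * q) * y powr (- (1 / p)) \<le> \<bar>v t - v s\<bar>"
    using up unfolding q(3) by (simp add: y_def algebra_simps)
  \<comment> \<open>Whichever of \<open>s\<close> and \<open>d\<close> is larger, the increment bound says that the smaller one is at most \<open>D \<kappa>\<close>.\<close>
  define m where "m = max s d"
  have ym: "0 < y" "y \<le> 2 * m" using s0 d0 by (auto simp: y_def m_def)
  have "(2 * m) powr (- (1 / p)) \<le> y powr (- (1 / p))"
    using ym \<open>p > 1\<close> by (intro powr_mono2') auto
  then have "d / (2 * q) * (2 * m) powr (- (1 / p)) \<le> d / (2 * q) * y powr (- (1 / p))"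
    using d0 q(1) by (intro mult_left_mono) auto
  also have "\<dots> \<le> \<bar>v t - v s\<bar>" by fact
  finally have "(d / (2 * q) * (2 * m) powr (- (1 / p))) powr p \<le> \<bar>v t - v s\<bar> powr p"
    using d0 q(1) \<open>p > 1\<close> by (intro powr_mono2) auto
  also have "\<dots> \<le> d powr (p - 1) * (p * (\<kappa> / s))"
    using vst e2 unfolding d_def by (elim order_trans) (intro mult_left_mono, auto)
  also have "(d / (2 * q) * (2 * m) powr (- (1 / p))) powr p = d powr p / (2 * q) powr p / (2 * m)"
    using d0 q(1) ym \<open>p > 1\<close> by (simp add: powr_mult powr_divide powr_powr powr_minus_divide)
  finally have "d powr p / (2 * q) powr p / (2 * m) * ((2 * q) powr p * (2 * m) * s)
      \<le> d powr (p - 1) * (p * (\<kappa> / s)) * ((2 * q) powr p * (2 * m) * s)"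
    using s0 ym by (intro mult_right_mono) auto
  then have "d powr p * s \<le> d powr (p - 1) * (D * \<kappa> * m)"
    using s0 ym q(1) by (simp add: D_def mult_ac)
  moreover have "d powr p = d powr (p - 1) * d" using d0 by (simp add: powr_diff)
  ultimately have "d * s \<le> D * \<kappa> * m" using d0 by (simp add: mult.assoc)
  moreover have "D * \<kappa> * m < d * s"
  proof (cases "s \<le> d")
    case True
    then show ?thesis using big d0 by (simp add: m_def mult.commute)
  next
    case False
    then show ?thesis using big s0 by (simp add: m_def)
  qed
  ultimately show False by simp
qed

text \<open>The sum over \<open>n\<close> of \<open>exp (- \<beta> n)\<close> times a bound for the measure of the set where
  \<open>s - \<bar>v s\<bar>\<^sup>q \<le> n + 1\<close>.\<close>

definition moser_const :: "real \<Rightarrow> real \<Rightarrow> real" where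
  "moser_const p \<beta> = (\<Sum>n. exp (- \<beta>) ^ n * (3 * ((2 * (p / (p - 1))) powr p * (2 * p)) * real (Suc n)))"

lemma moser_const_summable:
  assumes "\<beta> > 0"
  shows "summable (\<lambda>n. exp (- \<beta>) ^ n * (c * real (Suc n)))"
proof -
  have "norm (exp (- \<beta>)) < 1" using assms by simp
  from geometric_deriv_sums[OF this] have "summable (\<lambda>n. c * (real (Suc n) * exp (- \<beta>) ^ n))"
    by (intro summable_mult) (auto simp: sums_iff)
  then show ?thesis by (simp only: mult_ac)
qed

text \<open>Moser's inequality, by summation over the layers \<open>n \<le> s - \<bar>v s\<bar>\<^sup>q \<le> n + 1\<close>, whose measure grows only
  linearly in \<open>n\<close>. The constraint is imposed only between points of \<open>A\<close>, so that no extension of \<open>v\<close>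
  has to be constructed when the energy is controlled on a part of the half-line.\<close>

lemma moser_inequality:
  fixes p \<beta> :: real and v e :: "real \<Rightarrow> real"
  assumes "p > 1" "\<beta> > 0"
  defines "q \<equiv> p / (p - 1)"
  assumes A: "A \<in> sets borel" "A \<subseteq> {0..}" "0 \<in> A"
    and v: "v \<in> borel_measurable borel" "v 0 = 0"
    and energy: "\<And>s t. s \<in> A \<Longrightarrow> t \<in> A \<Longrightarrow> s \<le> t \<Longrightarrow>
        e s \<le> e t \<and> \<bar>v t - v s\<bar> powr p \<le> (t - s) powr (p - 1) * (e t - e s)"
    and total: "\<And>t. t \<in> A \<Longrightarrow> e t - e 0 \<le> 1"
  shows "(\<integral>\<^sup>+s\<in>A. ennreal (exp (\<beta> * (\<bar>v s\<bar> powr q - s))) \<partial>lborel) \<le> ennreal (moser_const p \<beta>)"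
proof -
  note q = conjugate_exponent[OF \<open>p > 1\<close>, folded q_def]
  define D where "D = (2 * q) powr p * (2 * p)"
  have D: "0 \<le> D" using \<open>p > 1\<close> by (simp add: D_def)
  define F where "F s = s - \<bar>v s\<bar> powr q" for s
  have Fm: "F \<in> borel_measurable borel" unfolding F_def using v(1) by measurable
  define E where "E n = {s \<in> A. F s \<le> real (Suc n)}" for n
  have Em: "E n \<in> sets borel" for n
    unfolding E_def using A(1) Fm by measurable
  have F0: "0 \<le> F s" if s: "s \<in> A" for s
  proof -
    have s0: "0 \<le> s" using A(2) s by auto
    have "\<bar>v s\<bar> powr p \<le> s powr (p - 1) * (e s - e 0)" using energy[OF A(3) s s0] v(2) by simp
    also have "\<dots> \<le> s powr (p - 1) * 1" using total[OF s] by (intro mult_left_mono) auto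
    finally have "(\<bar>v s\<bar> powr p) powr (q / p) \<le> (s powr (p - 1)) powr (q / p)"
      using \<open>p > 1\<close> q(1) by (intro powr_mono2) auto
    then have "\<bar>v s\<bar> powr q \<le> s powr ((p - 1) * (q / p))" using \<open>p > 1\<close> by (simp add: powr_powr)
    moreover have "(p - 1) * (q / p) = 1" using \<open>p > 1\<close> by (simp add: q_def)
    ultimately show ?thesis using s0 by (simp add: F_def)
  qed
  have spread: "s \<le> D * real (Suc n) \<or> t - s \<le> D * real (Suc n)" if "s \<in> E n" "t \<in> E n" "s \<le> t" for s t n
    unfolding D_def q_def
  proof (rule moser_sublevel_spread[where v = v and \<mu> = "e s - e 0" and \<nu> = "e t - e s"])
    have sA: "s \<in> A" "t \<in> A" "0 \<le> s" using that A(2) by (auto simp: E_def)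
    show "0 \<le> e t - e s" "\<bar>v t - v s\<bar> powr p \<le> (t - s) powr (p - 1) * (e t - e s)"
      using energy[OF sA(1,2) that(3)] by auto
    show "\<bar>v s\<bar> powr p \<le> s powr (p - 1) * (e s - e 0)" using energy[OF A(3) sA(1,3)] v(2) by simp
    show "e s - e 0 + (e t - e s) \<le> 1" using total[OF sA(2)] by simp
    show "s - \<bar>v s\<bar> powr (p / (p - 1)) \<le> real (Suc n)" "t - \<bar>v t\<bar> powr (p / (p - 1)) \<le> real (Suc n)"
      using that by (auto simp: E_def F_def q_def)
  qed (use \<open>p > 1\<close> that A(2) in \<open>auto simp: E_def\<close>)
  have Eme: "emeasure lborel (E n) \<le> ennreal (3 * D * real (Suc n))" for n
  proof -
    let ?l = "D * real (Suc n)"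
    have l0: "0 \<le> ?l" using D by simp
    obtain c where c: "E n \<subseteq> {0..?l} \<union> {c - ?l..c + ?l}"
    proof (cases "E n \<subseteq> {0..?l}")
      case True
      then show ?thesis using that by blast
    next
      case False
      then obtain c where c: "c \<in> E n" "c \<notin> {0..?l}" by blast
      then have cl: "?l < c" using A(2) by (auto simp: E_def)
      show ?thesis
      proof (rule that[of c], rule subsetI)
        fix s assume s: "s \<in> E n"
        have "0 \<le> s" using s A(2) by (auto simp: E_def)
        then show "s \<in> {0..?l} \<union> {c - ?l..c + ?l}"
          using spread[OF s c(1)] spread[OF c(1) s] cl l0 by (cases "s \<le> c") auto
      qed
    qed
    have "emeasure lborel (E n) \<le> emeasure lborel ({0..?l} \<union> {c - ?l..c + ?l})"
      using c by (intro emeasure_mono) auto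
    also have "\<dots> \<le> emeasure lborel {0..?l} + emeasure lborel {c - ?l..c + ?l}"
      by (intro emeasure_subadditive) auto
    also have "\<dots> = ennreal ?l + ennreal (2 * ?l)"
      using l0 by (subst (1 2) emeasure_lborel_Icc) auto
    also have "\<dots> = ennreal (3 * D * real (Suc n))"
      using l0 by (subst ennreal_plus[symmetric]) (auto simp: algebra_simps simp del: of_nat_Suc)
    finally show ?thesis .
  qed
  let ?c = "\<lambda>n. exp (- \<beta>) ^ n"
  have pw: "ennreal (exp (\<beta> * (\<bar>v s\<bar> powr q - s))) * indicator A s \<le> (\<Sum>n. ennreal (?c n) * indicator (E n) s)" for s
  proof (cases "s \<in> A")
    case True
    define n where "n = nat \<lfloor>F s\<rfloor>"
    have n: "real n \<le> F s" "F s \<le> real (Suc n)" using F0[OF True] unfolding n_def by linarith+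
    have "exp (\<beta> * (\<bar>v s\<bar> powr q - s)) = exp (- (\<beta> * F s))" by (simp add: F_def algebra_simps)
    also have "\<dots> \<le> exp (- (\<beta> * real n))" using n(1) \<open>\<beta> > 0\<close> by (simp add: mult_left_mono)
    also have "\<dots> = ?c n" by (simp add: exp_of_nat_mult[symmetric] mult.commute)
    finally have "ennreal (exp (\<beta> * (\<bar>v s\<bar> powr q - s))) * indicator A s \<le> ennreal (?c n) * indicator (E n) s"
      using True n(2) by (simp add: E_def ennreal_leI)
    also have "\<dots> \<le> (\<Sum>n. ennreal (?c n) * indicator (E n) s)"
    proof -
      have "f n \<le> suminf f" for f :: "nat \<Rightarrow> ennreal"
        using sum_le_suminf[OF summableI, of "{n}" f] by simp
      then show ?thesis .
    qed
    finally show ?thesis .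
  qed simp
  have "(\<integral>\<^sup>+s\<in>A. ennreal (exp (\<beta> * (\<bar>v s\<bar> powr q - s))) \<partial>lborel)
      \<le> (\<integral>\<^sup>+s. (\<Sum>n. ennreal (?c n) * indicator (E n) s) \<partial>lborel)"
    by (intro nn_integral_mono pw)
  also have "\<dots> = (\<Sum>n. \<integral>\<^sup>+s. ennreal (?c n) * indicator (E n) s \<partial>lborel)"
    by (intro nn_integral_suminf borel_measurable_times_ennreal borel_measurable_const borel_measurable_indicator) (simp add: Em)
  also have "\<dots> = (\<Sum>n. ennreal (?c n) * emeasure lborel (E n))"
    using Em by (intro suminf_cong nn_integral_cmult_indicator) simp
  also have "\<dots> \<le> (\<Sum>n. ennreal (?c n * (3 * D * real (Suc n))))"
  proof (rule suminf_le)
    fix n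
    have "ennreal (?c n) * emeasure lborel (E n) \<le> ennreal (?c n) * ennreal (3 * D * real (Suc n))"
      by (intro mult_left_mono Eme) simp
    also have "\<dots> = ennreal (?c n * (3 * D * real (Suc n)))"
      using D by (intro ennreal_mult[symmetric]) auto
    finally show "ennreal (?c n) * emeasure lborel (E n) \<le> ennreal (?c n * (3 * D * real (Suc n)))" .
  qed auto
  also have "\<dots> = ennreal (\<Sum>n. ?c n * (3 * D * real (Suc n)))"
    using D by (intro suminf_ennreal2 moser_const_summable \<open>\<beta> > 0\<close>) auto
  also have "\<dots> = ennreal (moser_const p \<beta>)" by (simp add: moser_const_def D_def q_def)
  finally show ?thesis .
qed

section \<open>Descent before and growth after a base point\<close>

text \<open>If \<open>w\<close> decreases from the height \<open>h\<close> at most at the extremal rate \<open>k s powr (1 / q)\<close> backwards in time,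
  it stays positive for the time \<open>L\<close>. On the interval from \<open>a - L + 1/2\<close> to \<open>a - L + 1\<close> the tangent
  of the concave profile bounds \<open>w\<close> below by a multiple of \<open>L powr (- 1 / p)\<close>, hence \<open>w powr p\<close> by a
  multiple of \<open>h powr (- q)\<close>, while the weight is about \<open>exp (\<beta> L) exp (- \<beta> a)\<close>.\<close>

lemma level_descent:
  fixes p \<beta> k h a :: real and w :: "real \<Rightarrow> real"
  assumes "p > 1" "\<beta> > 0"
  defines "q \<equiv> p / (p - 1)"
  defines "L \<equiv> (h / k) powr q"
  assumes k: "1 / 2 \<le> k" "k \<le> 1" and h: "1 \<le> h"
    and slow: "\<And>s. 0 \<le> s \<Longrightarrow> s \<le> L \<Longrightarrow> h - k * s powr (1 / q) \<le> w (a - s)"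
  shows "ennreal ((1 / 2) powr (p + q) * (2 * q) powr (- p) * exp (- \<beta>) / 2 * h powr (- q) * exp (\<beta> * L) * exp (- \<beta> * a))
    \<le> (\<integral>\<^sup>+t. ennreal (w t powr p * exp (- \<beta> * t)) \<partial>lborel)"
proof -
  note q = conjugate_exponent[OF \<open>p > 1\<close>, folded q_def]
  have "1 \<le> L" unfolding L_def using k h q(1) by (intro ge_one_powr_ge_zero) (auto simp: field_simps)
  have L: "L powr (1 / q) = h / k" using k h q(1) by (simp add: L_def powr_powr)
  define c where "c = (1 / 2) powr (p + q) * (2 * q) powr (- p) * h powr (- q) * (exp (\<beta> * (L - 1)) * exp (- \<beta> * a))"
  have c0: "0 \<le> c" by (simp add: c_def)
  let ?I = "{a - L + 1 / 2..a - L + 1}"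
  have "c \<le> w t powr p * exp (- \<beta> * t)" if t: "t \<in> ?I" for t
  proof -
    define s where "s = a - t"
    have s: "L - 1 \<le> s" "s \<le> L - 1 / 2" "0 \<le> s" using t \<open>1 \<le> L\<close> by (auto simp: s_def)
    have "s powr (1 / q) \<le> L powr (1 / q) + 1 / q * L powr (1 / q - 1) * (s - L)"
      using s \<open>1 \<le> L\<close> q(1) by (intro powr_le_tangent) auto
    also have "\<dots> \<le> L powr (1 / q) + 1 / q * L powr (1 / q - 1) * (- (1 / 2))"
      using s q(1) by (intro add_left_mono mult_left_mono) auto
    finally have "L powr (- (1 / p)) / (2 * q) \<le> h / k - s powr (1 / q)"
      unfolding q(3) L by simp
    then have "k * (L powr (- (1 / p)) / (2 * q)) \<le> k * (h / k - s powr (1 / q))"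
      using k by (intro mult_left_mono) auto
    also have "\<dots> = h - k * s powr (1 / q)" using k by (simp add: right_diff_distrib)
    also have "\<dots> \<le> w t" using slow[of s] s by (simp add: s_def)
    finally have "(k * (L powr (- (1 / p)) / (2 * q))) powr p \<le> w t powr p"
      using k q(1) \<open>p > 1\<close> by (intro powr_mono2) auto
    moreover have "(k * (L powr (- (1 / p)) / (2 * q))) powr p = k powr p * (2 * q) powr (- p) / L"
      using k q(1) \<open>p > 1\<close> \<open>1 \<le> L\<close> by (simp add: powr_mult powr_divide powr_powr powr_minus_divide)
    moreover have "1 / L = k powr q * h powr (- q)"
      using k h by (simp add: L_def powr_divide powr_minus_divide)
    moreover have "(1 / 2) powr (p + q) \<le> k powr (p + q)"
      using k q(1) \<open>p > 1\<close> by (intro powr_mono2) auto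
    then have "(1 / 2) powr (p + q) * ((2 * q) powr (- p) * h powr (- q)) \<le> k powr (p + q) * ((2 * q) powr (- p) * h powr (- q))"
      by (intro mult_right_mono) auto
    moreover have "k powr p * (2 * q) powr (- p) / L = k powr p * (2 * q) powr (- p) * (1 / L)" by simp
    ultimately have wt: "(1 / 2) powr (p + q) * (2 * q) powr (- p) * h powr (- q) \<le> w t powr p"
      by (simp only: powr_add mult_ac)
    have "exp (\<beta> * (L - 1)) * exp (- \<beta> * a) = exp (\<beta> * (L - 1 - a))"
      by (simp add: exp_add[symmetric] algebra_simps)
    also have "\<dots> \<le> exp (- \<beta> * t)"
    proof -
      have "\<beta> * (L - 1 - a) \<le> \<beta> * (- t)" using t \<open>\<beta> > 0\<close> by (intro mult_left_mono) auto
      then show ?thesis by simp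
    qed
    finally show ?thesis unfolding c_def using wt by (intro mult_mono) auto
  qed
  then have "(\<integral>\<^sup>+t. ennreal c * indicator ?I t \<partial>lborel) \<le> (\<integral>\<^sup>+t. ennreal (w t powr p * exp (- \<beta> * t)) \<partial>lborel)"
    by (intro nn_integral_mono) (auto simp: indicator_def intro: ennreal_leI)
  also have "(\<integral>\<^sup>+t. ennreal c * indicator ?I t \<partial>lborel) = ennreal (c * (1 / 2))"
  proof -
    have "emeasure lborel ?I = ennreal (1 / 2)" by (subst emeasure_lborel_Icc) auto
    then show ?thesis using c0 nn_integral_cmult_indicator[of ?I lborel "ennreal c"] by (simp only: ennreal_mult) simp
  qed
  also have "c * (1 / 2) = (1 / 2) powr (p + q) * (2 * q) powr (- p) * exp (- \<beta>) / 2 * h powr (- q) * exp (\<beta> * L) * exp (- \<beta> * a)"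
  proof -
    have "exp (\<beta> * (L - 1)) = exp (- \<beta>) * exp (\<beta> * L)" by (simp add: exp_add[symmetric] algebra_simps)
    then show ?thesis by (simp add: c_def)
  qed
  finally show ?thesis .
qed

lemma exp_minus_le_inverse: "0 < x \<Longrightarrow> exp (- x) \<le> 1 / (x :: real)"
proof -
  assume x: "0 < x"
  have "x \<le> exp x" using exp_ge_add_one_self[of x] by linarith
  then show ?thesis using x by (simp add: exp_minus field_simps)
qed

text \<open>Let \<open>v\<close> be the increment of \<open>w\<close> after \<open>a\<close>, multiplied by \<open>2 powr (1 / p)\<close> so that its energy is at
  most 1. By convexity \<open>w powr q \<le> 2 powr (q - 1) * h powr q + \<bar>v\<bar> powr q\<close>, and Moser's inequality
  applies to \<open>v\<close>. The factor \<open>h powr (- q)\<close> comes from the denominator where \<open>w \<ge> h / 2\<close>; where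
  \<open>w < h / 2\<close> the exponential is smaller than claimed by a factor \<open>exp (- \<beta> h powr q / 2)\<close>, which
  yields \<open>h powr (- q)\<close> as well.\<close>

lemma growth_beyond_base_point:
  fixes p \<beta> a :: real and w e :: "real \<Rightarrow> real"
  assumes "p > 1" "\<beta> > 0"
  defines "q \<equiv> p / (p - 1)"
  defines "h \<equiv> max 1 (w a)"
  assumes A: "A \<in> sets borel" "A \<subseteq> {a..}" "a \<in> A"
    and w: "w \<in> borel_measurable borel" "\<And>t. 0 \<le> w t"
    and energy: "\<And>s t. s \<in> A \<Longrightarrow> t \<in> A \<Longrightarrow> s \<le> t \<Longrightarrow>
        e s \<le> e t \<and> \<bar>w t - w s\<bar> powr p \<le> (t - s) powr (p - 1) * (e t - e s)"
    and total: "\<And>t. t \<in> A \<Longrightarrow> e t - e a \<le> 1 / 2"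
  shows "(\<integral>\<^sup>+t\<in>A. ennreal (exp (\<beta> * w t powr q) / (1 + w t) powr q * exp (- \<beta> * t)) \<partial>lborel)
    \<le> ennreal ((2 powr q + 2 / \<beta>) * moser_const p \<beta>
        * (h powr (- q) * exp (\<beta> * (2 powr (q - 1) * h powr q)) * exp (- \<beta> * a)))"
proof -
  note q = conjugate_exponent[OF \<open>p > 1\<close>, folded q_def]
  define v where "v s = 2 powr (1 / p) * (w (a + s) - w a)" for s
  define K where "K = h powr (- q) * exp (\<beta> * (2 powr (q - 1) * h powr q)) * exp (- \<beta> * a)"
  have K0: "0 \<le> K" by (simp add: K_def)
  define A' where "A' = {s. a + s \<in> A}"
  have h: "1 \<le> h" "w a \<le> h" by (auto simp: h_def)
  have hq: "0 < h powr q" using h by simp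
  have A'm: "A' \<in> sets borel"
  proof -
    have "(\<lambda>s. a + s) -` A \<inter> space borel \<in> sets borel"
      by (rule measurable_sets[OF _ A(1)]) simp
    then show ?thesis by (simp add: A'_def vimage_def)
  qed
  have moser: "(\<integral>\<^sup>+s\<in>A'. ennreal (exp (\<beta> * (\<bar>v s\<bar> powr q - s))) \<partial>lborel) \<le> ennreal (moser_const p \<beta>)"
    unfolding q_def
  proof (rule moser_inequality[where e = "\<lambda>s. 2 * e (a + s)"])
    have "(\<lambda>s. w (a + s)) \<in> borel_measurable borel"
      by (rule measurable_compose[OF _ w(1)]) simp
    then show "v \<in> borel_measurable borel" unfolding v_def by measurable
    show "2 * e (a + s) \<le> 2 * e (a + t) \<and> \<bar>v t - v s\<bar> powr p \<le> (t - s) powr (p - 1) * (2 * e (a + t) - 2 * e (a + s))"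
      if "s \<in> A'" "t \<in> A'" "s \<le> t" for s t
    proof -
      have en: "e (a + s) \<le> e (a + t)" "\<bar>w (a + t) - w (a + s)\<bar> powr p \<le> (t - s) powr (p - 1) * (e (a + t) - e (a + s))"
        using energy[of "a + s" "a + t"] that by (auto simp: A'_def)
      have "v t - v s = 2 powr (1 / p) * (w (a + t) - w (a + s))" by (simp add: v_def right_diff_distrib)
      then have "\<bar>v t - v s\<bar> powr p = 2 * \<bar>w (a + t) - w (a + s)\<bar> powr p"
        using \<open>p > 1\<close> by (simp add: abs_mult powr_mult powr_powr)
      then show ?thesis using en by (simp add: algebra_simps)
    qed
    show "2 * e (a + t) - 2 * e (a + 0) \<le> 1" if "t \<in> A'" for t
      using total[of "a + t"] that by (simp add: A'_def)
  qed (use assms A'm in \<open>auto simp: A'_def v_def\<close>)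
  have pw: "exp (\<beta> * w (a + s) powr q) / (1 + w (a + s)) powr q * exp (- \<beta> * (a + s))
      \<le> (2 powr q + 2 / \<beta>) * K * exp (\<beta> * (\<bar>v s\<bar> powr q - s))" if s: "s \<in> A'" for s
  proof -
    let ?w = "w (a + s)"
    let ?e = "exp (- \<beta> * a) * exp (\<beta> * (\<bar>v s\<bar> powr q - s))"
    have eas: "exp (- \<beta> * (a + s)) = exp (- \<beta> * a) * exp (- \<beta> * s)"
      by (simp add: exp_add[symmetric] algebra_simps)
    have evs: "exp (\<beta> * \<bar>v s\<bar> powr q) * exp (- \<beta> * s) = exp (\<beta> * (\<bar>v s\<bar> powr q - s))"
      by (simp add: exp_add[symmetric] algebra_simps)
    have wq: "?w powr q \<le> 2 powr (q - 1) * h powr q + \<bar>v s\<bar> powr q"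
    proof -
      have t1: "2 powr (- (1 / p)) * 2 powr (1 / p) = (1 :: real)" by (simp add: powr_add[symmetric])
      have "?w = w a + 2 powr (- (1 / p)) * v s" by (simp add: v_def mult.assoc[symmetric] t1)
      also have "\<dots> \<le> h + 2 powr (- (1 / p)) * \<bar>v s\<bar>" using h by (intro add_mono mult_left_mono) auto
      also have "\<dots> = 2 powr (- (1 / p)) * (2 powr (1 / p) * h + \<bar>v s\<bar>)"
        by (simp add: distrib_left mult.assoc[symmetric] t1)
      finally have "?w powr q \<le> (2 powr (- (1 / p)) * (2 powr (1 / p) * h + \<bar>v s\<bar>)) powr q"
        using w(2) q(1) by (intro powr_mono2) auto
      also have "\<dots> = 2 powr (- (q - 1)) * (2 powr (1 / p) * h + \<bar>v s\<bar>) powr q"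
        using h q(5) by (simp add: powr_mult powr_powr)
      also have "\<dots> \<le> 2 powr (- (q - 1)) * (2 powr (q - 1) * ((2 powr (1 / p) * h) powr q + \<bar>v s\<bar> powr q))"
        using h q(1) by (intro mult_left_mono powr_sum_le) auto
      also have "\<dots> = (2 powr (1 / p) * h) powr q + \<bar>v s\<bar> powr q"
        by (simp add: mult.assoc[symmetric] powr_add[symmetric])
      also have "(2 powr (1 / p) * h) powr q = 2 powr (q - 1) * h powr q"
        using h q(5) by (simp add: powr_mult powr_powr)
      finally show ?thesis .
    qed
    show ?thesis
    proof (cases "h / 2 \<le> ?w")
      case True
      have "(h / 2) powr q \<le> (1 + ?w) powr q" using True h q(1) by (intro powr_mono2) auto
      then have "1 / (1 + ?w) powr q \<le> 1 / (h / 2) powr q" using h w(2)[of "a + s"] by (intro divide_left_mono) auto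
      also have "1 / (h / 2) powr q = 2 powr q * h powr (- q)" using h by (simp add: powr_divide powr_minus_divide)
      finally have inv: "1 / (1 + ?w) powr q \<le> 2 powr q * h powr (- q)" .
      have "exp (\<beta> * ?w powr q) \<le> exp (\<beta> * (2 powr (q - 1) * h powr q + \<bar>v s\<bar> powr q))"
        using wq \<open>\<beta> > 0\<close> by simp
      also have "\<dots> = exp (\<beta> * (2 powr (q - 1) * h powr q)) * exp (\<beta> * \<bar>v s\<bar> powr q)"
        by (simp add: distrib_left exp_add)
      finally have "exp (\<beta> * ?w powr q) * (1 / (1 + ?w) powr q) * exp (- \<beta> * (a + s))
        \<le> exp (\<beta> * (2 powr (q - 1) * h powr q)) * exp (\<beta> * \<bar>v s\<bar> powr q) * (2 powr q * h powr (- q)) * exp (- \<beta> * (a + s))"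
        using inv by (intro mult_mono) auto
      also have "\<dots> = 2 powr q * K * (exp (\<beta> * \<bar>v s\<bar> powr q) * exp (- \<beta> * s))"
        unfolding eas K_def by (simp only: mult_ac)
      also have "\<dots> \<le> (2 powr q + 2 / \<beta>) * K * exp (\<beta> * (\<bar>v s\<bar> powr q - s))"
        unfolding evs using K0 \<open>\<beta> > 0\<close> by (intro mult_right_mono) auto
      finally show ?thesis by simp
    next
      case False
      have "?w powr q \<le> (h / 2) powr q" using False w(2)[of "a + s"] q(1) by (intro powr_mono2) auto
      also have "\<dots> = h powr q * (1 / 2 powr q)" using h by (simp add: powr_divide)
      also have "\<dots> \<le> h powr q * (1 / 2)"
      proof (rule mult_left_mono)
        have "2 powr 1 \<le> (2 :: real) powr q" using q(1) by (intro powr_mono) auto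
        then show "1 / 2 powr q \<le> 1 / (2 :: real)" by (simp add: field_simps)
      qed (use hq in simp)
      also have "\<dots> \<le> 2 powr (q - 1) * h powr q - h powr q / 2"
      proof -
        have "1 \<le> (2 :: real) powr (q - 1)" using q(1) by (intro ge_one_powr_ge_zero) auto
        then have "1 * h powr q \<le> 2 powr (q - 1) * h powr q" using hq by (intro mult_right_mono) auto
        then show ?thesis by simp
      qed
      finally have "exp (\<beta> * ?w powr q) \<le> exp (\<beta> * (2 powr (q - 1) * h powr q - h powr q / 2))"
        using \<open>\<beta> > 0\<close> by simp
      also have "\<dots> = exp (\<beta> * (2 powr (q - 1) * h powr q)) * exp (- (\<beta> * h powr q / 2))"
        by (simp only: exp_add[symmetric]) (simp add: right_diff_distrib)
      also have "\<dots> \<le> exp (\<beta> * (2 powr (q - 1) * h powr q)) * (1 / (\<beta> * h powr q / 2))"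
        using hq \<open>\<beta> > 0\<close> by (intro mult_left_mono exp_minus_le_inverse) auto
      also have "1 / (\<beta> * h powr q / 2) = 2 / \<beta> * h powr (- q)" by (simp add: powr_minus_divide)
      finally have ew: "exp (\<beta> * ?w powr q) \<le> exp (\<beta> * (2 powr (q - 1) * h powr q)) * (2 / \<beta> * h powr (- q))" .
      have "1 \<le> (1 + ?w) powr q" using w(2)[of "a + s"] q(1) by (intro ge_one_powr_ge_zero) auto
      then have "1 / (1 + ?w) powr q \<le> 1" by (simp add: divide_le_eq_1)
      moreover have "exp (- \<beta> * s) \<le> exp (\<beta> * (\<bar>v s\<bar> powr q - s))"
        using \<open>\<beta> > 0\<close> by (simp add: right_diff_distrib)
      ultimately have "exp (\<beta> * ?w powr q) * (1 / (1 + ?w) powr q) * (exp (- \<beta> * a) * exp (- \<beta> * s))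
        \<le> exp (\<beta> * (2 powr (q - 1) * h powr q)) * (2 / \<beta> * h powr (- q)) * 1 * (exp (- \<beta> * a) * exp (\<beta> * (\<bar>v s\<bar> powr q - s)))"
        using ew \<open>\<beta> > 0\<close> by (intro mult_mono) auto
      also have "\<dots> = 2 / \<beta> * K * exp (\<beta> * (\<bar>v s\<bar> powr q - s))"
        unfolding K_def by (simp only: mult_ac mult_1_right mult_1_left)
      also have "\<dots> \<le> (2 powr q + 2 / \<beta>) * K * exp (\<beta> * (\<bar>v s\<bar> powr q - s))"
        using K0 by (intro mult_right_mono) auto
      finally show ?thesis unfolding eas by simp
    qed
  qed
  let ?C = "(2 powr q + 2 / \<beta>) * K"
  have C0: "0 \<le> ?C" using K0 \<open>\<beta> > 0\<close> by simp
  have "(\<integral>\<^sup>+t\<in>A. ennreal (exp (\<beta> * w t powr q) / (1 + w t) powr q * exp (- \<beta> * t)) \<partial>lborel)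
     = (\<integral>\<^sup>+s\<in>A'. ennreal (exp (\<beta> * w (a + s) powr q) / (1 + w (a + s)) powr q * exp (- \<beta> * (a + s))) \<partial>lborel)"
    using w(1) A(1) by (subst nn_integral_real_affine[of _ 1 a]) (auto simp: A'_def indicator_def)
  also have "\<dots> \<le> (\<integral>\<^sup>+s. ennreal ?C * (ennreal (exp (\<beta> * (\<bar>v s\<bar> powr q - s))) * indicator A' s) \<partial>lborel)"
  proof (rule nn_integral_mono)
    fix s
    show "ennreal (exp (\<beta> * w (a + s) powr q) / (1 + w (a + s)) powr q * exp (- \<beta> * (a + s))) * indicator A' s
      \<le> ennreal ?C * (ennreal (exp (\<beta> * (\<bar>v s\<bar> powr q - s))) * indicator A' s)"
    proof (cases "s \<in> A'")
      case True
      then show ?thesis using pw[OF True] C0 by (simp add: ennreal_mult[symmetric] ennreal_leI del: ennreal_mult)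
    qed simp
  qed
  also have "\<dots> = ennreal ?C * (\<integral>\<^sup>+s\<in>A'. ennreal (exp (\<beta> * (\<bar>v s\<bar> powr q - s))) \<partial>lborel)"
  proof (rule nn_integral_cmult)
    have "(\<lambda>s. w (a + s)) \<in> borel_measurable borel"
      by (rule measurable_compose[OF _ w(1)]) simp
    then show "(\<lambda>s. ennreal (exp (\<beta> * (\<bar>v s\<bar> powr q - s))) * indicator A' s) \<in> borel_measurable lborel"
      unfolding v_def using A'm by measurable
  qed
  also have "\<dots> \<le> ennreal ?C * ennreal (moser_const p \<beta>)" by (intro mult_left_mono moser) simp
  also have "\<dots> = ennreal (?C * moser_const p \<beta>)" using C0 by (simp add: ennreal_mult'[symmetric])
  finally show ?thesis by (simp add: K_def mult_ac)
qed

section \<open>Functions with controlled energy\<close>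

definition descent_const :: "real \<Rightarrow> real \<Rightarrow> real" where
  "descent_const p \<beta> = (1 / 2) powr (p + p / (p - 1)) * (2 * (p / (p - 1))) powr (- p) * exp (- \<beta>) / 2"

definition growth_const :: "real \<Rightarrow> real \<Rightarrow> real" where
  "growth_const p \<beta> = (2 powr (p / (p - 1)) + 2 / \<beta>) * moser_const p \<beta>"

lemma descent_const_pos: "p > 1 \<Longrightarrow> 0 < descent_const p \<beta>"
  by (simp add: descent_const_def)

lemma moser_const_nonneg:
  assumes "p > 1" "\<beta> > 0"
  shows "0 \<le> moser_const p \<beta>"
  unfolding moser_const_def
  by (intro suminf_nonneg moser_const_summable assms mult_nonneg_nonneg) (use assms in auto)

lemma growth_const_nonneg: "p > 1 \<Longrightarrow> \<beta> > 0 \<Longrightarrow> 0 \<le> growth_const p \<beta>"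
  by (simp add: growth_const_def moser_const_nonneg)

definition low_const :: "real \<Rightarrow> real \<Rightarrow> real" where
  "low_const p \<beta> = \<beta> powr (p - 1) * exp \<beta> / Gamma p"

text \<open>The first summand accounts for the times of height at most 1, each half of the second for one of the
  two base points; the factor \<open>1 + p / (p - 1)\<close> is the price for replacing \<open>exp_p\<close> by the exponential.\<close>

definition exact_const :: "real \<Rightarrow> real \<Rightarrow> real" where
  "exact_const p \<beta> = low_const p \<beta> + 2 * ((1 + p / (p - 1)) * growth_const p \<beta> 
     * exp (\<beta> * 2 powr (p / (p - 1) - 1)) / descent_const p \<beta>)"

lemma exact_const_pos:
  assumes "p > 1" "\<beta> > 0"
  shows "0 < exact_const p \<beta>"
proof -
  have "0 < low_const p \<beta>" unfolding low_const_def using assms by (auto intro!: divide_pos_pos mult_pos_pos Gamma_real_pos)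
  moreover have "0 \<le> 2 * ((1 + p / (p - 1)) * growth_const p \<beta> * exp (\<beta> * 2 powr (p / (p - 1) - 1)) / descent_const p \<beta>)"
    using assms(1) growth_const_nonneg[OF assms] less_imp_le[OF descent_const_pos[OF assms(1)]]
    by (intro mult_nonneg_nonneg divide_nonneg_nonneg) auto
  ultimately show ?thesis by (simp add: exact_const_def)
qed

lemma ennreal_affine:
  assumes "0 \<le> a" "0 \<le> b" "0 \<le> x" "0 \<le> y"
  shows "ennreal a * ennreal x + ennreal b * ennreal y = ennreal (a * x + b * y)"
  using assms by (simp add: ennreal_mult)

text \<open>All that the argument uses about \<open>w t = \<bar>u (exp (- t))\<bar>\<close>; \<open>e t\<close> stands for the energy spent before
  \<open>t\<close>.\<close>

locale controlled_function =
  fixes p \<beta> :: real and w e :: "real \<Rightarrow> real"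
  assumes p: "p > 1" and beta: "\<beta> > 0"
    and cont: "continuous_on UNIV w" and nonneg: "\<And>t. 0 \<le> w t"
    and e01: "\<And>t. 0 \<le> e t" "\<And>t. e t \<le> 1"
    and energy: "\<And>s t. s \<le> t \<Longrightarrow>
        e s \<le> e t \<and> \<bar>w t - w s\<bar> powr p \<le> (t - s) powr (p - 1) * (e t - e s)"
begin

definition q where "q = p / (p - 1)"

definition J where "J = (\<integral>\<^sup>+t. ennreal (w t powr p * exp (- \<beta> * t)) \<partial>lborel)"

definition g where "g t = exp_p p (\<beta> * w t powr q) / (1 + w t) powr q * exp (- \<beta> * t)"

definition G where "G t = exp (\<beta> * w t powr q) / (1 + w t) powr q * exp (- \<beta> * t)"

lemmas q = conjugate_exponent[OF p, folded q_def]

lemma w_borel[measurable]: "w \<in> borel_measurable borel"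
  using cont by (simp add: borel_measurable_continuous_onI)

lemma tendsto_w: "(w \<longlongrightarrow> w t) (at t within S)"
  using cont by (auto simp: continuous_on_eq_continuous_at isCont_def intro: tendsto_within_subset)

lemma increment_le:
  assumes "s \<le> t" "e t - e s \<le> K" "0 \<le> K"
  shows "\<bar>w t - w s\<bar> \<le> K powr (1 / p) * (t - s) powr (1 / q)"
proof -
  have "\<bar>w t - w s\<bar> powr p \<le> (t - s) powr (p - 1) * K"
    using energy[OF assms(1)] assms(2) by (elim conjE order_trans) (intro mult_left_mono, auto)
  then have "(\<bar>w t - w s\<bar> powr p) powr (1 / p) \<le> ((t - s) powr (p - 1) * K) powr (1 / p)"
    using p by (intro powr_mono2) auto
  also have "\<dots> = K powr (1 / p) * (t - s) powr ((p - 1) * (1 / p))"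
    using assms by (simp add: powr_mult powr_powr mult.commute)
  also have "(p - 1) * (1 / p) = 1 / q" using p by (simp add: q_def)
  finally show ?thesis using p by (simp add: powr_powr)
qed

lemma g_le_G: "g t \<le> (1 + q) * G t"
proof -
  have "exp_p p (\<beta> * w t powr q) \<le> (1 + q) * exp (\<beta> * w t powr q)"
    using exp_p_le_exp[OF p, of "\<beta> * w t powr q"] beta by (simp add: q_def)
  then have "exp_p p (\<beta> * w t powr q) / (1 + w t) powr q * exp (- \<beta> * t)
      \<le> (1 + q) * exp (\<beta> * w t powr q) / (1 + w t) powr q * exp (- \<beta> * t)"
    by (intro mult_right_mono divide_right_mono) auto
  then show ?thesis by (simp add: g_def G_def)
qed

lemma g_le_low:
  assumes "w t \<le> 1"
  shows "g t \<le> low_const p \<beta> * (w t powr p * exp (- \<beta> * t))"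
proof -
  have wq: "w t powr q \<le> 1" using assms nonneg q(1) by (intro powr_le1) auto
  have G0: "0 < Gamma p" using p by (intro Gamma_real_pos) auto
  have "exp_p p (\<beta> * w t powr q) \<le> (\<beta> * w t powr q) powr (p - 1) / Gamma p * exp (\<beta> * w t powr q)"
    using beta by (intro exp_p_le_powr_exp p) auto
  also have "\<dots> \<le> (\<beta> * w t powr q) powr (p - 1) / Gamma p * exp \<beta>"
    using wq beta G0 by (intro mult_left_mono) (auto simp: mult_left_le)
  also have "(\<beta> * w t powr q) powr (p - 1) = \<beta> powr (p - 1) * w t powr p"
    using beta q(6) by (simp add: powr_mult powr_powr)
  finally have num: "exp_p p (\<beta> * w t powr q) \<le> low_const p \<beta> * w t powr p"
    by (simp add: low_const_def mult_ac)
  have "1 \<le> (1 + w t) powr q" using nonneg[of t] q(1) by (intro ge_one_powr_ge_zero) auto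
  then have "low_const p \<beta> * w t powr p / (1 + w t) powr q \<le> low_const p \<beta> * w t powr p"
    using G0 mult_left_mono[of 1 "(1 + w t) powr q" "low_const p \<beta> * w t powr p"]
    by (subst pos_divide_le_eq) (auto simp: low_const_def)
  moreover have "exp_p p (\<beta> * w t powr q) / (1 + w t) powr q \<le> low_const p \<beta> * w t powr p / (1 + w t) powr q"
    using num by (intro divide_right_mono) auto
  ultimately have "exp_p p (\<beta> * w t powr q) / (1 + w t) powr q \<le> low_const p \<beta> * w t powr p" by linarith
  then have "exp_p p (\<beta> * w t powr q) / (1 + w t) powr q * exp (- \<beta> * t) \<le> low_const p \<beta> * w t powr p * exp (- \<beta> * t)"
    by (rule mult_right_mono) simp
  then show ?thesis by (simp add: g_def mult_ac)
qed

text \<open>Descent from height 1, where the whole energy may be available. In particular \<open>w\<close> stays below 1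
  for all sufficiently negative times if \<open>J\<close> is finite.\<close>

lemma descent_from_level_one:
  assumes "1 \<le> w t"
  shows "ennreal (descent_const p \<beta> * exp (- \<beta> * t)) \<le> J"
proof -
  have "ennreal ((1 / 2) powr (p + q) * (2 * q) powr (- p) * exp (- \<beta>) / 2 * 1 powr (- q)
      * exp (\<beta> * (1 / 1) powr q) * exp (- \<beta> * t)) \<le> J"
    unfolding J_def q_def
  proof (rule level_descent[OF p beta])
    fix s :: real assume s: "0 \<le> s"
    have "\<bar>w t - w (t - s)\<bar> \<le> 1 powr (1 / p) * (t - (t - s)) powr (1 / q)"
      using s e01(1)[of "t - s"] e01(2)[of t] by (intro increment_le) auto
    then show "1 - 1 * s powr (1 / (p / (p - 1))) \<le> w (t - s)"
      using assms by (simp add: q_def)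
  qed auto
  then have J: "ennreal (descent_const p \<beta> * exp (- \<beta> * t) * exp \<beta>) \<le> J"
    by (simp add: descent_const_def q_def mult_ac)
  have "descent_const p \<beta> * exp (- \<beta> * t) * 1 \<le> descent_const p \<beta> * exp (- \<beta> * t) * exp \<beta>"
    using beta descent_const_pos[OF p, of \<beta>] by (intro mult_left_mono) auto
  then have "ennreal (descent_const p \<beta> * exp (- \<beta> * t)) \<le> ennreal (descent_const p \<beta> * exp (- \<beta> * t) * exp \<beta>)"
    by (intro ennreal_leI) simp
  then show ?thesis using J by (rule order_trans)
qed

lemma growth_le:
  assumes "A \<in> sets borel" "A \<subseteq> {a..}" "a \<in> A" "w a \<le> h" "1 \<le> h" "h = 1 \<or> h = w a"
    and "\<And>s t. s \<in> A \<Longrightarrow> t \<in> A \<Longrightarrow> s \<le> t \<Longrightarrow>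
        e' s \<le> e' t \<and> \<bar>w t - w s\<bar> powr p \<le> (t - s) powr (p - 1) * (e' t - e' s)"
    and "\<And>t. t \<in> A \<Longrightarrow> e' t - e' a \<le> 1 / 2"
  shows "(\<integral>\<^sup>+t\<in>A. ennreal (G t) \<partial>lborel)
    \<le> ennreal (growth_const p \<beta> * (h powr (- q) * exp (\<beta> * (2 powr (q - 1) * h powr q)) * exp (- \<beta> * a)))"
proof -
  have "max 1 (w a) = h" using assms(4-6) by auto
  then show ?thesis
    using growth_beyond_base_point[OF p beta assms(1-3) w_borel nonneg assms(7,8)]
    unfolding G_def growth_const_def q_def by simp
qed

text \<open>The base point \<open>a\<close> is kept apart from the earlier time \<open>b\<close> of height 1 so that the bound serves both
  for \<open>a = b\<close> and for the time \<open>a\<close> at which half of the energy is spent, if \<open>w\<close> is at most 1 there: the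
  descent before \<open>b\<close> bounds \<open>J\<close> below, and the weight only decreases from \<open>b\<close> to \<open>a\<close>.\<close>

lemma growth_from_level_one:
  assumes "A \<in> sets borel" "A \<subseteq> {a..}" "a \<in> A" "w a \<le> 1" "b \<le> a" "w b = 1"
    and "\<And>s t. s \<in> A \<Longrightarrow> t \<in> A \<Longrightarrow> s \<le> t \<Longrightarrow>
        e' s \<le> e' t \<and> \<bar>w t - w s\<bar> powr p \<le> (t - s) powr (p - 1) * (e' t - e' s)"
    and "\<And>t. t \<in> A \<Longrightarrow> e' t - e' a \<le> 1 / 2"
  shows "(\<integral>\<^sup>+t\<in>A. ennreal (G t) \<partial>lborel)
    \<le> ennreal (growth_const p \<beta> * exp (\<beta> * 2 powr (q - 1)) / descent_const p \<beta>) * J"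
proof -
  let ?D = "descent_const p \<beta>" and ?k = "growth_const p \<beta> * exp (\<beta> * 2 powr (q - 1))"
  have D: "0 < ?D" and k: "0 \<le> ?k" using descent_const_pos growth_const_nonneg p beta by auto
  have "(\<integral>\<^sup>+t\<in>A. ennreal (G t) \<partial>lborel) \<le> ennreal (growth_const p \<beta> * (1 powr (- q) * exp (\<beta> * (2 powr (q - 1) * 1 powr q)) * exp (- \<beta> * a)))"
    by (rule growth_le[OF assms(1-4) order_refl _ assms(7,8)]) auto
  also have "\<dots> \<le> ennreal (?k / ?D * (?D * exp (- \<beta> * b)))"
  proof (rule ennreal_leI)
    have "exp (- \<beta> * a) \<le> exp (- \<beta> * b)" using assms(5) beta by simp
    then have "?k * exp (- \<beta> * a) \<le> ?k * exp (- \<beta> * b)" using k by (intro mult_left_mono)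
    then show "growth_const p \<beta> * (1 powr (- q) * exp (\<beta> * (2 powr (q - 1) * 1 powr q)) * exp (- \<beta> * a))
        \<le> ?k / ?D * (?D * exp (- \<beta> * b))" using D by (simp add: mult_ac)
  qed
  also have "\<dots> = ennreal (?k / ?D) * ennreal (?D * exp (- \<beta> * b))"
    using D k by (intro ennreal_mult) auto
  also have "\<dots> \<le> ennreal (?k / ?D) * J"
    using assms(6) by (intro mult_left_mono descent_from_level_one) auto
  finally show ?thesis .
qed

text \<open>With half of the energy on either side of \<open>a\<close>, the upper bound after \<open>a\<close> and the lower bound for \<open>J\<close>
  before \<open>a\<close> are multiples of the same expression in \<open>w a\<close>.\<close>

lemma growth_from_high_level:
  assumes A: "A \<in> sets borel" "A \<subseteq> {a..}" "a \<in> A" and wa: "1 \<le> w a"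
    and before: "\<And>s. s < a \<Longrightarrow> e s \<le> 1 / 2"
    and energy': "\<And>s t. s \<in> A \<Longrightarrow> t \<in> A \<Longrightarrow> s \<le> t \<Longrightarrow>
        e' s \<le> e' t \<and> \<bar>w t - w s\<bar> powr p \<le> (t - s) powr (p - 1) * (e' t - e' s)"
    and total: "\<And>t. t \<in> A \<Longrightarrow> e' t - e' a \<le> 1 / 2"
  shows "(\<integral>\<^sup>+t\<in>A. ennreal (G t) \<partial>lborel) \<le> ennreal (growth_const p \<beta> / descent_const p \<beta>) * J"
proof -
  let ?D = "descent_const p \<beta>" and ?k = "growth_const p \<beta>"
  let ?h = "w a" and ?\<kappa> = "(1 / 2) powr (1 / p) :: real"
  have D: "0 < ?D" and k: "0 \<le> ?k" using descent_const_pos growth_const_nonneg p beta by auto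
  have hL: "(?h / ?\<kappa>) powr q = 2 powr (q - 1) * ?h powr q"
  proof -
    have "?\<kappa> powr q = (1 / 2) powr (1 / p * q)" by (rule powr_powr)
    also have "1 / p * q = q - 1" using q(5) by simp
    finally have "(?h / ?\<kappa>) powr q = ?h powr q / (1 / 2) powr (q - 1)"
      using wa by (simp only: powr_divide)
    then show ?thesis by (simp add: powr_divide)
  qed
  have "(1 / 2) powr 1 \<le> ?\<kappa>" using p by (intro powr_mono') auto
  then have \<kappa>: "1 / 2 \<le> ?\<kappa>" by simp
  have \<kappa>1: "?\<kappa> \<le> 1" using p by (intro powr_le1) auto
  have "ennreal ((1 / 2) powr (p + q) * (2 * q) powr (- p) * exp (- \<beta>) / 2 * ?h powr (- q)
      * exp (\<beta> * (?h / ?\<kappa>) powr q) * exp (- \<beta> * a)) \<le> J"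
    unfolding J_def q_def
  proof (rule level_descent[OF p beta \<kappa> \<kappa>1 wa])
    fix s :: real assume s: "0 \<le> s"
    show "?h - ?\<kappa> * s powr (1 / (p / (p - 1))) \<le> w (a - s)"
    proof (cases "s = 0")
      case False
      have "\<bar>w a - w (a - s)\<bar> \<le> ?\<kappa> * (a - (a - s)) powr (1 / q)"
      proof (rule tendsto_le[where F = "at_left a"])
        show "((\<lambda>t. \<bar>w t - w (a - s)\<bar>) \<longlongrightarrow> \<bar>w a - w (a - s)\<bar>) (at_left a)"
          by (intro tendsto_intros tendsto_w)
        show "((\<lambda>t. ?\<kappa> * (t - (a - s)) powr (1 / q)) \<longlongrightarrow> ?\<kappa> * (a - (a - s)) powr (1 / q)) (at_left a)"
          using False s by (intro tendsto_intros) auto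
        have "\<forall>\<^sub>F t in at_left a. t \<in> {a - s<..<a}" using False s by (intro eventually_at_left_real) auto
        then show "\<forall>\<^sub>F t in at_left a. \<bar>w t - w (a - s)\<bar> \<le> ?\<kappa> * (t - (a - s)) powr (1 / q)"
        proof eventually_elim
          case (elim t)
          then show ?case using before[of t] e01(1)[of "a - s"] by (intro increment_le) auto
        qed
      qed simp
      then show ?thesis by (simp add: q_def)
    qed simp
  qed
  then have J: "ennreal (?D * (?h powr (- q) * exp (\<beta> * (2 powr (q - 1) * ?h powr q)) * exp (- \<beta> * a))) \<le> J"
    unfolding hL by (simp add: descent_const_def q_def mult_ac)
  let ?X = "?h powr (- q) * exp (\<beta> * (2 powr (q - 1) * ?h powr q)) * exp (- \<beta> * a)"
  have "(\<integral>\<^sup>+t\<in>A. ennreal (G t) \<partial>lborel) \<le> ennreal (?k * ?X)"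
    by (rule growth_le[OF A order_refl wa _ energy' total]) auto
  also have "?k * ?X = ?k / ?D * (?D * ?X)" using D by simp
  also have "ennreal \<dots> = ennreal (?k / ?D) * ennreal (?D * ?X)"
    using D k by (intro ennreal_mult) auto
  also have "\<dots> \<le> ennreal (?k / ?D) * J" by (intro mult_left_mono J) auto
  finally show ?thesis .
qed

text \<open>The times are divided at the first time \<open>t1\<close> of height 1 and at the time \<open>t0\<close> at which the energy
  passes 1/2. The energy \<open>e\<close> may jump, so \<open>t0\<close> is an infimum, and the constraints involving \<open>t0\<close>
  itself are obtained as limits.\<close>

lemma exact_growth:
  "(\<integral>\<^sup>+t. ennreal (g t) \<partial>lborel) \<le> ennreal (exact_const p \<beta>) * J"
proof (cases "J = top")
  case True
  have "0 < exact_const p \<beta>" by (rule exact_const_pos[OF p beta])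
  then show ?thesis using True by (simp add: ennreal_mult_top)
next
  case False
  let ?D = "descent_const p \<beta>" and ?L = "low_const p \<beta>"
  define k where "k = growth_const p \<beta> * exp (\<beta> * 2 powr (q - 1)) / ?D"
  have D: "0 < ?D" by (rule descent_const_pos[OF p])
  have gr: "0 \<le> growth_const p \<beta>" by (rule growth_const_nonneg[OF p beta])
  have k0: "0 \<le> k" using D gr by (simp add: k_def)
  have L0: "0 \<le> ?L" unfolding low_const_def using p by (auto intro!: divide_nonneg_nonneg mult_nonneg_nonneg less_imp_le[OF Gamma_real_pos])
  have Lint: "(\<integral>\<^sup>+t. ennreal ?L * ennreal (w t powr p * exp (- \<beta> * t)) \<partial>lborel) = ennreal ?L * J"
    unfolding J_def by (rule nn_integral_cmult) measurable
  have low: "ennreal (g t) \<le> ennreal ?L * ennreal (w t powr p * exp (- \<beta> * t))" if "w t \<le> 1" for t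
    using g_le_low[OF that] L0 by (simp add: ennreal_mult'[symmetric] ennreal_leI)
  have C: "exact_const p \<beta> = ?L + (1 + q) * (k + k)" by (simp add: exact_const_def k_def q_def)
  define T where "T = {t. 1 \<le> w t}"
  show ?thesis
  proof (cases "T = {}")
    case True
    then have "w t \<le> 1" for t unfolding T_def by (metis (mono_tags) empty_iff mem_Collect_eq nle_le)
    then have "(\<integral>\<^sup>+t. ennreal (g t) \<partial>lborel) \<le> ennreal ?L * J"
      unfolding Lint[symmetric] by (intro nn_integral_mono low)
    also have "\<dots> \<le> ennreal (exact_const p \<beta>) * J"
      unfolding C using k0 q(1) by (intro mult_right_mono ennreal_leI) auto
    finally show ?thesis .
  next
    case False
    define j where "j = enn2real J"
    have j: "J = ennreal j" using \<open>J \<noteq> top\<close> by (simp add: j_def less_top)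
    \<comment> \<open>The descent bound at height 1 keeps the high times away from \<open>-\<infinity>\<close>.\<close>
    have "- ln (j / ?D) / \<beta> \<le> t" if "t \<in> T" for t
    proof -
      have "ennreal (?D * exp (- \<beta> * t)) \<le> ennreal j"
        using descent_from_level_one[of t] that by (simp add: T_def j)
      then have "?D * exp (- \<beta> * t) \<le> j"
        using D by (subst (asm) ennreal_le_iff2) (auto simp: mult_le_0_iff not_le)
      then have "exp (- \<beta> * t) \<le> j / ?D" using D by (simp add: field_simps)
      then have "ln (exp (- \<beta> * t)) \<le> ln (j / ?D)" by (intro ln_mono) auto
      then show ?thesis using beta by (simp add: field_simps)
    qed
    then have bdd: "bdd_below T" by (rule bdd_belowI)
    define t1 where "t1 = Inf T"
    have "closed T" unfolding T_def using cont by (intro closed_Collect_le) auto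
    then have "t1 \<in> T" unfolding t1_def using False bdd by (rule closed_contains_Inf[rotated 2])
    have before: "w t \<le> 1" if "t < t1" for t
    proof (rule ccontr)
      assume "\<not> w t \<le> 1"
      then have "t1 \<le> t" unfolding t1_def using bdd by (intro cInf_lower) (auto simp: T_def)
      then show False using that by simp
    qed
    have wt1: "w t1 = 1"
    proof (rule antisym)
      show "w t1 \<le> 1"
      proof (rule tendsto_upperbound[OF tendsto_w])
        show "\<forall>\<^sub>F t in at_left t1. w t \<le> 1" using before by (auto simp: eventually_at_filter)
      qed simp
      show "1 \<le> w t1" using \<open>t1 \<in> T\<close> by (simp add: T_def)
    qed
    have e_mono: "e s \<le> e t" if "s \<le> t" for s t using energy[OF that] by blast
    have e_borel[measurable]: "e \<in> borel_measurable borel"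
      using e_mono by (intro borel_measurable_mono monoI)
    define A where "A = {t. t1 \<le> t \<and> (e t \<le> 1 / 2 \<or> t = t1)}"
    define H where "H = {t. t1 \<le> t \<and> 1 / 2 < e t}"
    have Am: "A \<in> sets borel" and Hm: "H \<in> sets borel" unfolding A_def H_def by measurable
    have IA: "(\<integral>\<^sup>+t\<in>A. ennreal (G t) \<partial>lborel) \<le> ennreal k * J"
      unfolding k_def
    proof (rule growth_from_level_one[OF Am _ _ eq_refl[OF wt1] order_refl wt1])
      show "e t - e t1 \<le> 1 / 2" if "t \<in> A" for t using that e01(1)[of t1] by (auto simp: A_def)
    qed (use energy in \<open>auto simp: A_def\<close>)
    have IH: "(\<integral>\<^sup>+t\<in>H. ennreal (G t) \<partial>lborel) \<le> ennreal k * J"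
    proof (cases "H = {}")
      case False
      define t0 where "t0 = Inf H"
      have Hbdd: "bdd_below H" by (rule bdd_belowI[of _ t1]) (simp add: H_def)
      have t10: "t1 \<le> t0" unfolding t0_def using False by (intro cInf_greatest) (auto simp: H_def)
      have Ht0: "t0 \<le> t" if "t \<in> H" for t unfolding t0_def using that Hbdd by (rule cInf_lower)
      have after: "1 / 2 < e t" if t0t: "t0 < t" for t
      proof -
        obtain t' where "t' \<in> H" "t' < t" using t0t cInf_lessD[OF False] unfolding t0_def by blast
        then show ?thesis using e_mono[of t' t] by (auto simp: H_def)
      qed
      have limit: "\<bar>w t - w t0\<bar> powr p \<le> (t - t0) powr (p - 1) * (e t - 1 / 2)" if t: "t0 < t" for t
      proof (rule tendsto_le[where F = "at_right t0"])
        show "((\<lambda>s. (t - s) powr (p - 1) * (e t - 1 / 2)) \<longlongrightarrow> (t - t0) powr (p - 1) * (e t - 1 / 2)) (at_right t0)"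
          using t by (intro tendsto_intros) auto
        show "((\<lambda>s. \<bar>w t - w s\<bar> powr p) \<longlongrightarrow> \<bar>w t - w t0\<bar> powr p) (at_right t0)"
          using p by (intro tendsto_powr' tendsto_intros tendsto_w) auto
        have "\<forall>\<^sub>F s in at_right t0. s \<in> {t0<..<t}" using t by (rule eventually_at_right_real)
        then show "\<forall>\<^sub>F s in at_right t0. \<bar>w t - w s\<bar> powr p \<le> (t - s) powr (p - 1) * (e t - 1 / 2)"
        proof eventually_elim
          case (elim s)
          then have "\<bar>w t - w s\<bar> powr p \<le> (t - s) powr (p - 1) * (e t - e s)" using energy[of s t] by auto
          also have "\<dots> \<le> (t - s) powr (p - 1) * (e t - 1 / 2)"
            using after[of s] elim by (intro mult_left_mono) auto
          finally show ?case .
        qed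
      qed simp
      \<comment> \<open>Raising the energy at \<open>t0\<close> to 1/2 leaves at most 1/2 for the later times even if \<open>e\<close> jumps there.\<close>
      let ?e = "\<lambda>t. max (e t) (1 / 2)"
      let ?A = "insert t0 H"
      have A: "?A \<in> sets borel" "?A \<subseteq> {t0..}" "t0 \<in> ?A" using Hm Ht0 by auto
      have energy': "?e s \<le> ?e t \<and> \<bar>w t - w s\<bar> powr p \<le> (t - s) powr (p - 1) * (?e t - ?e s)"
        if st: "s \<in> ?A" "t \<in> ?A" "s \<le> t" for s t
      proof (cases "1 / 2 < e s")
        case True
        then show ?thesis using energy[OF st(3)] by (simp add: max_def)
      next
        case False
        then have s: "s = t0" using st(1) by (auto simp: H_def)
        show ?thesis
        proof (cases "t = t0")
          case True
          then show ?thesis using s p by simp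
        next
          case False
          then have "t0 < t" using s st(3) by simp
          then have "?e t = e t" "?e s = 1 / 2" using after[of t] \<open>\<not> 1 / 2 < e s\<close> by (auto simp: max_def)
          then show ?thesis using limit[OF \<open>t0 < t\<close>] after[OF \<open>t0 < t\<close>] s by simp
        qed
      qed
      have total: "?e t - ?e t0 \<le> 1 / 2" for t using e01(2)[of t] by (simp add: max_def)
      have "(\<integral>\<^sup>+t\<in>H. ennreal (G t) \<partial>lborel) \<le> (\<integral>\<^sup>+t\<in>?A. ennreal (G t) \<partial>lborel)"
        by (intro nn_integral_mono) (auto simp: indicator_def)
      also have "\<dots> \<le> ennreal k * J"
      proof (cases "w t0 \<le> 1")
        case True
        show ?thesis unfolding k_def
          by (rule growth_from_level_one[OF A True t10 wt1 energy' total])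
      next
        case False
        then have "t1 < t0" using t10 wt1 by (cases "t1 = t0") auto
        have "e s \<le> 1 / 2" if "s < t0" for s
        proof (rule ccontr)
          assume "\<not> e s \<le> 1 / 2"
          then have "max s t1 \<in> H" using e_mono[of s "max s t1"] by (auto simp: H_def)
          then have "t0 \<le> max s t1" by (rule Ht0)
          then show False using that \<open>t1 < t0\<close> by simp
        qed
        then have "(\<integral>\<^sup>+t\<in>?A. ennreal (G t) \<partial>lborel) \<le> ennreal (growth_const p \<beta> / ?D) * J"
          using False by (intro growth_from_high_level[OF A _ _ energy' total]) auto
        also have "\<dots> \<le> ennreal k * J"
        proof (intro mult_right_mono ennreal_leI)
          have "growth_const p \<beta> * 1 \<le> growth_const p \<beta> * exp (\<beta> * 2 powr (q - 1))"
            using gr beta by (intro mult_left_mono) auto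
          then show "growth_const p \<beta> / ?D \<le> k" unfolding k_def using D by (intro divide_right_mono) auto
        qed simp
        finally show ?thesis .
      qed
      finally show ?thesis .
    qed simp
    have G0: "0 \<le> G t" for t by (simp add: G_def)
    have Gm: "G \<in> borel_measurable borel" unfolding G_def[abs_def] by measurable
    let ?l = "\<lambda>t. ennreal ?L * ennreal (w t powr p * exp (- \<beta> * t))"
    let ?GA = "\<lambda>t. ennreal (G t) * indicator A t" and ?GH = "\<lambda>t. ennreal (G t) * indicator H t"
    define Q where "Q = 1 + q"
    have Q0: "0 \<le> Q" using q(1) by (simp add: Q_def)
    have pw: "ennreal (g t) \<le> ?l t + ennreal Q * (?GA t + ?GH t)" for t
    proof (cases "t < t1")
      case True
      show ?thesis using low[OF before[OF True]] by (rule add_increasing2[OF zero_le])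
    next
      case False
      have "ennreal (g t) \<le> ennreal (Q * G t)" unfolding Q_def by (rule ennreal_leI[OF g_le_G])
      also have "\<dots> = ennreal Q * ennreal (G t)" by (rule ennreal_mult[OF Q0 G0])
      also have "\<dots> \<le> ennreal Q * (?GA t + ?GH t)"
        using False by (intro mult_left_mono) (auto simp: A_def H_def indicator_def not_le)
      finally show ?thesis by (rule add_increasing[OF zero_le])
    qed
    have "(\<integral>\<^sup>+t. ennreal (g t) \<partial>lborel) \<le> (\<integral>\<^sup>+t. ?l t + ennreal Q * (?GA t + ?GH t) \<partial>lborel)"
      by (intro nn_integral_mono pw)
    also have "\<dots> = ennreal ?L * J + ennreal Q * ((\<integral>\<^sup>+t. ?GA t \<partial>lborel) + (\<integral>\<^sup>+t. ?GH t \<partial>lborel))"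
      using Am Hm Gm by (simp add: nn_integral_add nn_integral_cmult J_def)
    also have "\<dots> \<le> ennreal ?L * J + ennreal Q * (ennreal k * J + ennreal k * J)"
      by (intro add_left_mono mult_left_mono add_mono IA IH) simp
    also have "\<dots> = (ennreal ?L + ennreal Q * (ennreal k + ennreal k)) * J"
      by (simp only: distrib_right mult.assoc)
    also have "ennreal ?L + ennreal Q * (ennreal k + ennreal k) = ennreal (exact_const p \<beta>)"
    proof -
      have "ennreal k + ennreal k = ennreal (k + k)" by (rule ennreal_plus[symmetric, OF k0 k0])
      moreover have "ennreal Q * ennreal (k + k) = ennreal (Q * (k + k))"
        using Q0 k0 by (intro ennreal_mult[symmetric]) auto
      moreover have "ennreal ?L + ennreal (Q * (k + k)) = ennreal (?L + Q * (k + k))"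
        using Q0 k0 L0 by (intro ennreal_plus[symmetric]) auto
      ultimately show ?thesis by (simp only: C Q_def)
    qed
    finally show ?thesis .
  qed
qed

end

section \<open>The logarithmic coordinate\<close>

text \<open>Hoelder's inequality for \<open>\<bar>f\<bar> x powr (1 / q)\<close> and \<open>x powr (- 1 / q)\<close>, from Young's inequality with the
  optimal scaling \<open>c\<close>.\<close>

lemma Holder_logarithmic:
  fixes p a b X :: real and f :: "real \<Rightarrow> real"
  assumes "p > 1" "0 < a" "a < b" "0 \<le> X"
  defines "q \<equiv> p / (p - 1)"
  assumes meas: "set_borel_measurable lebesgue {a<..b} f"
    and X: "(\<integral>\<^sup>+x\<in>{a<..b}. ennreal (\<bar>f x\<bar> powr p * x powr (p - 1)) \<partial>lebesgue) = ennreal X"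
  shows "(\<integral>\<^sup>+x\<in>{a<..b}. ennreal \<bar>f x\<bar> \<partial>lebesgue) \<le> ennreal (X powr (1 / p) * (ln b - ln a) powr (1 / q))"
proof -
  note q = conjugate_exponent[OF \<open>p > 1\<close>, folded q_def]
  define F where "F x = indicator {a<..b} x * f x" for x
  have F[measurable]: "F \<in> borel_measurable lebesgue"
    using meas unfolding set_borel_measurable_def F_def[abs_def] by simp
  define Y where "Y = ln b - ln a"
  have Y: "0 < Y" using assms by (simp add: Y_def)
  have FX: "(\<integral>\<^sup>+x. ennreal (\<bar>F x\<bar> powr p * x powr (p - 1)) \<partial>lebesgue) = ennreal X"
    unfolding X[symmetric] by (rule nn_integral_cong) (auto simp: F_def indicator_def)
  have Ff: "(\<integral>\<^sup>+x\<in>{a<..b}. ennreal \<bar>f x\<bar> \<partial>lebesgue) = (\<integral>\<^sup>+x. ennreal \<bar>F x\<bar> \<partial>lebesgue)"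
    by (rule nn_integral_cong) (auto simp: F_def indicator_def)
  have xp: "(\<lambda>x::real. x powr (p - 1)) \<in> borel_measurable lebesgue"
    by (rule measurable_completion) simp
  have FXm: "(\<lambda>x. ennreal (\<bar>F x\<bar> powr p * x powr (p - 1))) \<in> borel_measurable lebesgue"
    using xp by measurable
  show ?thesis
  proof (cases "X = 0")
    case True
    then have "AE x in lebesgue. ennreal (\<bar>F x\<bar> powr p * x powr (p - 1)) = 0"
      using FX nn_integral_0_iff_AE[OF FXm] by simp
    then have "AE x in lebesgue. ennreal \<bar>F x\<bar> = 0"
    proof eventually_elim
      case (elim x)
      show ?case
      proof (cases "0 < x")
        case True
        have "\<bar>F x\<bar> powr p * x powr (p - 1) \<le> 0" using elim by (simp only: ennreal_eq_0_iff)
        then have "\<bar>F x\<bar> powr p \<le> 0" using True by (simp add: mult_le_0_iff)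
        then show ?thesis by simp
      next
        case False
        then show ?thesis using \<open>0 < a\<close> by (simp add: F_def)
      qed
    qed
    then have "(\<integral>\<^sup>+x. ennreal \<bar>F x\<bar> \<partial>lebesgue) = 0"
      by (subst nn_integral_0_iff_AE) auto
    then show ?thesis unfolding Ff by simp
  next
    case False
    then have X0: "0 < X" using \<open>0 \<le> X\<close> by simp
    \<comment> \<open>The scaling for which the two terms of Young's inequality are in the ratio \<open>1 / p\<close> to \<open>1 / q\<close>.\<close>
    define c where "c = (Y / X) powr (1 / (p * q))"
    have c0: "0 < c" using X0 Y by (simp add: c_def)
    have pw: "\<bar>F x\<bar> \<le> c powr p / p * (\<bar>F x\<bar> powr p * x powr (p - 1)) + c powr (- q) / q * (1 / x * indicator {a..b} x)" for x
    proof (cases "x \<in> {a<..b}")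
      case True
      then have x: "0 < x" using \<open>0 < a\<close> by simp
      have "\<bar>F x\<bar> = (c * (\<bar>F x\<bar> * x powr (1 / q))) * (1 / c * x powr (- (1 / q)))"
        using c0 x by (simp add: powr_minus_divide)
      also have "\<dots> \<le> (c * (\<bar>F x\<bar> * x powr (1 / q))) powr p / p + (1 / c * x powr (- (1 / q))) powr q / q"
        using c0 q \<open>p > 1\<close> by (intro Youngs_inequality) auto
      also have "(c * (\<bar>F x\<bar> * x powr (1 / q))) powr p = c powr p * (\<bar>F x\<bar> powr p * x powr (p - 1))"
        using c0 q(4) by (simp add: powr_mult powr_powr)
      also have "(1 / c * x powr (- (1 / q))) powr q = c powr (- q) * (1 / x)"
        using c0 x q(1) by (simp add: powr_mult powr_divide powr_powr powr_minus_divide)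
      finally show ?thesis using True by (simp add: field_simps)
    next
      case False
      then show ?thesis using c0 q(1) \<open>0 < a\<close> \<open>p > 1\<close>
        by (auto simp: F_def indicator_def intro!: divide_nonneg_nonneg)
    qed
    have inv: "(\<integral>\<^sup>+x. ennreal (1 / x * indicator {a..b} x) \<partial>lebesgue) = ennreal Y"
    proof -
      have "(\<integral>\<^sup>+x. ennreal (1 / x * indicator {a..b} x) \<partial>lebesgue) = (\<integral>\<^sup>+x. ennreal (1 / x) * indicator {a..b} x \<partial>lborel)"
        by (subst nn_integral_completion) (auto intro!: nn_integral_cong simp: indicator_def)
      also have "\<dots> = ennreal (ln b - ln a)"
        using assms by (intro nn_integral_FTC_Icc) (auto intro!: derivative_eq_intros)
      finally show ?thesis by (simp add: Y_def)
    qed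
    have cp: "c powr p = Y powr (1 / q) * X powr (- (1 / q))" "c powr (- q) = Y powr (- (1 / p)) * X powr (1 / p)"
      using X0 Y \<open>p > 1\<close> q(1) by (simp_all add: c_def powr_powr powr_divide powr_minus_divide)
    have "(\<integral>\<^sup>+x. ennreal \<bar>F x\<bar> \<partial>lebesgue)
      \<le> (\<integral>\<^sup>+x. ennreal (c powr p / p) * ennreal (\<bar>F x\<bar> powr p * x powr (p - 1))
          + ennreal (c powr (- q) / q) * ennreal (1 / x * indicator {a..b} x) \<partial>lebesgue)"
    proof (rule nn_integral_mono)
      fix x
      have "0 \<le> 1 / x * indicator {a..b} x" using \<open>0 < a\<close> by (auto simp: indicator_def)
      then show "ennreal \<bar>F x\<bar> \<le> ennreal (c powr p / p) * ennreal (\<bar>F x\<bar> powr p * x powr (p - 1))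
          + ennreal (c powr (- q) / q) * ennreal (1 / x * indicator {a..b} x)"
        using pw[of x] \<open>p > 1\<close> q(1) by (subst ennreal_affine) (auto intro: ennreal_leI)
    qed
    also have "\<dots> = ennreal (c powr p / p) * ennreal X + ennreal (c powr (- q) / q) * ennreal Y"
    proof -
      have im: "(\<lambda>x. ennreal (1 / x * indicator {a..b} x)) \<in> borel_measurable lebesgue"
        by (rule measurable_completion) simp
      show ?thesis
        using FXm im inv by (simp add: nn_integral_add nn_integral_cmult FX)
    qed
    also have "\<dots> = ennreal (c powr p / p * X + c powr (- q) / q * Y)"
      using \<open>p > 1\<close> q(1) X0 Y by (intro ennreal_affine) auto
    also have "c powr p / p * X + c powr (- q) / q * Y = X powr (1 / p) * Y powr (1 / q)"
    proof -
      have "X powr (- (1 / q)) * X = X powr (1 / p)"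
        using powr_add[of X "- (1 / q)" 1] X0 q(2) by simp
      moreover have "Y powr (- (1 / p)) * Y = Y powr (1 / q)"
        using powr_add[of Y "- (1 / p)" 1] Y q(2) by simp
      ultimately have "c powr p * X = X powr (1 / p) * Y powr (1 / q)" "c powr (- q) * Y = X powr (1 / p) * Y powr (1 / q)"
        unfolding cp by (simp_all add: mult_ac)
      then have "c powr p / p * X + c powr (- q) / q * Y = X powr (1 / p) * Y powr (1 / q) * (1 / p + 1 / q)"
        by (simp add: distrib_left)
      then show ?thesis using q(7) by simp
    qed
    finally show ?thesis unfolding Ff Y_def .
  qed
qed

text \<open>Monotone convergence from the compact intervals \<open>{- n..n}\<close>, and a reflection.\<close>

lemma nn_integral_exp_substitution:
  fixes \<phi> :: "real \<Rightarrow> ennreal"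
  assumes [measurable]: "\<phi> \<in> borel_measurable borel"
  shows "(\<integral>\<^sup>+x. \<phi> x * indicator {0<..} x \<partial>lborel) = (\<integral>\<^sup>+t. \<phi> (exp (- t)) * ennreal (exp (- t)) \<partial>lborel)"
proof -
  have S: "(SUP n::nat. c * indicator (I n) x) = c * indicator (\<Union>n. I n) x" if "incseq I" for I :: "nat \<Rightarrow> real set" and c :: ennreal and x
  proof (cases "x \<in> (\<Union>n. I n)")
    case True
    then obtain n where "x \<in> I n" by blast
    show ?thesis
    proof (rule antisym)
      show "(SUP n. c * indicator (I n) x) \<le> c * indicator (\<Union>n. I n) x"
        by (rule SUP_least) (use True in \<open>auto simp: indicator_def\<close>)
      show "c * indicator (\<Union>n. I n) x \<le> (SUP n. c * indicator (I n) x)"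
        by (rule SUP_upper2[of n]) (use True \<open>x \<in> I n\<close> in auto)
    qed
  qed auto
  let ?I = "\<lambda>n::nat. {exp (- real n)..exp (real n)}" and ?J = "\<lambda>n::nat. {- real n..real n}"
  have I: "incseq ?I" "(\<Union>n. ?I n) = {0<..}"
  proof -
    show "incseq ?I" by (intro monoI) (auto intro: order_trans[of "exp _"])
    show "(\<Union>n. ?I n) = {0<..}"
    proof (intro equalityI subsetI)
      fix x :: real assume "x \<in> {0<..}"
      then have x: "0 < x" by simp
      obtain n :: nat where "\<bar>ln x\<bar> \<le> real n" using real_arch_simple by blast
      then have "exp (- real n) \<le> exp (ln x)" "exp (ln x) \<le> exp (real n)" by auto
      then show "x \<in> (\<Union>n. ?I n)" using x by auto
    qed (auto intro: less_le_trans[OF exp_gt_zero])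
  qed
  have J: "incseq ?J" "(\<Union>n. ?J n) = UNIV"
  proof -
    show "incseq ?J" by (intro monoI) auto
    show "(\<Union>n. ?J n) = UNIV"
    proof (intro equalityI subsetI)
      fix x :: real
      obtain n :: nat where "\<bar>x\<bar> \<le> real n" using real_arch_simple by blast
      then show "x \<in> (\<Union>n. ?J n)" by (intro UN_I[of n]) auto
    qed auto
  qed
  have incf: "incseq (\<lambda>n x. c x * indicator (K n) x)" if "incseq K" for K :: "nat \<Rightarrow> real set" and c :: "real \<Rightarrow> ennreal"
    using that by (intro monoI le_funI mult_left_mono) (auto simp: indicator_def incseq_def)
  have "(\<integral>\<^sup>+x. \<phi> x * indicator {0<..} x \<partial>lborel) = (\<integral>\<^sup>+x. (SUP n. \<phi> x * indicator (?I n) x) \<partial>lborel)"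
    by (simp only: S[OF I(1)] I(2))
  also have "\<dots> = (SUP n. \<integral>\<^sup>+x. \<phi> x * indicator (?I n) x \<partial>lborel)"
    by (rule nn_integral_monotone_convergence_SUP[OF incf[OF I(1)]]) measurable
  also have "\<dots> = (SUP n. \<integral>\<^sup>+t. \<phi> (exp t) * ennreal (exp t) * indicator (?J n) t \<partial>lborel)"
  proof (rule SUP_cong[OF refl])
    fix n :: nat
    show "(\<integral>\<^sup>+x. \<phi> x * indicator (?I n) x \<partial>lborel) = (\<integral>\<^sup>+t. \<phi> (exp t) * ennreal (exp t) * indicator (?J n) t \<partial>lborel)"
    \<comment> \<open>The substitution rule requires a nondegenerate interval.\<close>
    proof (cases "n = 0")
      case True
      have 1: "(\<integral>\<^sup>+x. \<phi> x * indicator {1::real} x \<partial>lborel) = 0"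
        by (subst nn_integral_0_iff_AE) (use AE_lborel_singleton[of 1] in \<open>auto elim!: eventually_mono\<close>)
      have 2: "(\<integral>\<^sup>+t. \<phi> (exp t) * ennreal (exp t) * indicator {0::real} t \<partial>lborel) = 0"
        by (subst nn_integral_0_iff_AE) (use AE_lborel_singleton[of 0] in \<open>auto elim!: eventually_mono\<close>)
      show ?thesis using True 1 2 by simp
    next
      case False
      then show ?thesis
        by (intro nn_integral_substitution_aux) (auto intro!: derivative_eq_intros continuous_intros)
    qed
  qed
  also have "\<dots> = (\<integral>\<^sup>+t. (SUP n. \<phi> (exp t) * ennreal (exp t) * indicator (?J n) t) \<partial>lborel)"
    by (rule nn_integral_monotone_convergence_SUP[OF incf[OF J(1)], symmetric]) measurable
  also have "\<dots> = (\<integral>\<^sup>+t. \<phi> (exp t) * ennreal (exp t) \<partial>lborel)"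
    by (simp only: S[OF J(1)] J(2) indicator_UNIV mult_1_right)
  also have "\<dots> = (\<integral>\<^sup>+t. \<phi> (exp (- t)) * ennreal (exp (- t)) \<partial>lborel)"
    by (subst nn_integral_real_affine[of _ "-1" 0]) auto
  finally show ?thesis .
qed

lemma AE_lebesgue_neq: "AE x in lebesgue. x \<noteq> (a :: real)"
  using AE_completion[OF AE_lborel_singleton[of a]] by simp

lemma set_borel_measurable_lebesgue_subset:
  fixes f :: "real \<Rightarrow> real"
  assumes "set_borel_measurable lebesgue S f" "T \<in> sets lebesgue" "T \<subseteq> S"
  shows "set_borel_measurable lebesgue T f"
proof -
  have "(\<lambda>x. indicator T x *\<^sub>R (indicator S x *\<^sub>R f x)) \<in> borel_measurable lebesgue"
    using assms unfolding set_borel_measurable_def by measurable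
  also have "(\<lambda>x. indicator T x *\<^sub>R (indicator S x *\<^sub>R f x)) = (\<lambda>x. indicator T x *\<^sub>R f x)"
    by (rule ext) (use assms(3) in \<open>auto split: split_indicator\<close>)
  finally show ?thesis by (simp add: set_borel_measurable_def)
qed

lemma weighted_increment_le:
  fixes p a b X :: real and u :: "real \<Rightarrow> real"
  assumes "p > 1" "0 < a" "a < b" "0 \<le> X"
    and AC: "abs_continuous_on_interval a b u"
    and meas: "set_borel_measurable lebesgue {0<..} (deriv u)"
    and X: "(\<integral>\<^sup>+x\<in>{a<..b}. ennreal (\<bar>deriv u x\<bar> powr p * x powr (p - 1)) \<partial>lebesgue) = ennreal X"
  shows "\<bar>u b - u a\<bar> powr p \<le> (ln b - ln a) powr (p - 1) * X"
proof -
  define q where "q = p / (p - 1)"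
  note q = conjugate_exponent[OF \<open>p > 1\<close>, folded q_def]
  have Y: "0 < ln b - ln a" using assms by simp
  have "ennreal \<bar>u b - u a\<bar> \<le> (\<integral>\<^sup>+x\<in>{a..b}. ennreal \<bar>deriv u x\<bar> \<partial>lebesgue)"
    by (intro abs_continuous_increment_le AC \<open>a < b\<close> set_borel_measurable_lebesgue_subset[OF meas]) (use \<open>0 < a\<close> in auto)
  also have "\<dots> = (\<integral>\<^sup>+x\<in>{a<..b}. ennreal \<bar>deriv u x\<bar> \<partial>lebesgue)"
    by (rule nn_integral_cong_AE, rule eventually_mono[OF AE_lebesgue_neq[of a]]) (auto simp: indicator_def)
  also have "\<dots> \<le> ennreal (X powr (1 / p) * (ln b - ln a) powr (1 / q))"
    unfolding q_def
    by (intro Holder_logarithmic assms(1-4) X set_borel_measurable_lebesgue_subset[OF meas]) (use \<open>0 < a\<close> in auto)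
  finally have "\<bar>u b - u a\<bar> \<le> X powr (1 / p) * (ln b - ln a) powr (1 / q)"
    by (subst (asm) ennreal_le_iff) auto
  then have "\<bar>u b - u a\<bar> powr p \<le> (X powr (1 / p) * (ln b - ln a) powr (1 / q)) powr p"
    using \<open>p > 1\<close> by (intro powr_mono2) auto
  also have "\<dots> = (ln b - ln a) powr (p - 1) * X"
    using \<open>p > 1\<close> \<open>0 \<le> X\<close> q(4) by (simp add: powr_mult powr_powr)
  finally show ?thesis .
qed

lemma locally_abs_continuous_imp_continuous_on:
  assumes "locally_abs_continuous u"
  shows "continuous_on {0<..} u"
proof (rule continuous_at_imp_continuous_on, intro ballI)
  fix x :: real assume x: "x \<in> {0<..}"
  then have "abs_continuous_on_interval (x / 2) (2 * x) u"
    using assms unfolding locally_abs_continuous_def by auto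
  then have "continuous_on {x / 2..2 * x} u" by (rule abs_continuous_imp_continuous_on)
  then show "isCont u x" by (rule continuous_on_interior) (use x in auto)
qed

text \<open>The energy of a time \<open>t\<close> is the integral over \<open>x > exp (- t)\<close>, and a time span \<open>t - s\<close> is the logarithm
  of the quotient of the corresponding radii.\<close>

lemma controlled_function_log_coordinate:
  fixes p \<beta> :: real and u :: "real \<Rightarrow> real"
  assumes "p > 1" "\<beta> > 0"
    and AC: "locally_abs_continuous u"
    and meas: "set_borel_measurable lebesgue {0<..} (deriv u)"
    and total: "(\<integral>\<^sup>+x\<in>{0<..}. ennreal (\<bar>deriv u x\<bar> powr p * x powr (p - 1)) \<partial>lebesgue) \<le> 1"
  shows "\<exists>e. controlled_function p \<beta> (\<lambda>t. \<bar>u (exp (- t))\<bar>) e"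
proof -
  define E where "E S = (\<integral>\<^sup>+x\<in>S. ennreal (\<bar>deriv u x\<bar> powr p * x powr (p - 1)) \<partial>lebesgue)" for S
  have E1: "E S \<le> 1" if "S \<subseteq> {0<..}" for S
  proof -
    have "E S \<le> E {0<..}" unfolding E_def by (intro nn_integral_mono) (use that in \<open>auto simp: indicator_def\<close>)
    then show ?thesis using total by (simp add: E_def)
  qed
  have Efin: "E S = ennreal (enn2real (E S))" if "S \<subseteq> {0<..}" for S
    using E1[OF that] by (intro ennreal_enn2real[symmetric]) (rule le_less_trans[OF _ ennreal_one_less_top])
  have Eadd: "E (S \<union> T) = E S + E T"
    if ST: "S \<in> sets lebesgue" "T \<in> sets lebesgue" "S \<inter> T = {}" "S \<subseteq> {0<..}" "T \<subseteq> {0<..}" for S T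
  proof -
    have m: "(\<lambda>x. ennreal (\<bar>deriv u x\<bar> powr p * x powr (p - 1)) * indicator U x) \<in> borel_measurable lebesgue"
      if U: "U \<in> sets lebesgue" "U \<subseteq> {0<..}" for U
    proof -
      have F: "(\<lambda>x. indicator U x *\<^sub>R deriv u x) \<in> borel_measurable lebesgue"
        using set_borel_measurable_lebesgue_subset[OF meas U] by (simp add: set_borel_measurable_def)
      have xp: "(\<lambda>x::real. x powr (p - 1)) \<in> borel_measurable lebesgue"
        by (rule measurable_completion) simp
      have "(\<lambda>x. ennreal (\<bar>indicator U x *\<^sub>R deriv u x\<bar> powr p * x powr (p - 1))) \<in> borel_measurable lebesgue"
        using F xp by measurable
      also have "(\<lambda>x. ennreal (\<bar>indicator U x *\<^sub>R deriv u x\<bar> powr p * x powr (p - 1)))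
        = (\<lambda>x. ennreal (\<bar>deriv u x\<bar> powr p * x powr (p - 1)) * indicator U x)"
        by (rule ext) (use \<open>p > 1\<close> in \<open>auto split: split_indicator\<close>)
      finally show ?thesis .
    qed
    have "E (S \<union> T) = (\<integral>\<^sup>+x. ennreal (\<bar>deriv u x\<bar> powr p * x powr (p - 1)) * indicator S x
        + ennreal (\<bar>deriv u x\<bar> powr p * x powr (p - 1)) * indicator T x \<partial>lebesgue)"
      unfolding E_def by (rule nn_integral_cong) (use ST(3) in \<open>auto simp: indicator_def\<close>)
    also have "\<dots> = E S + E T"
      unfolding E_def using m ST by (intro nn_integral_add) auto
    finally show ?thesis .
  qed
  define e where "e t = enn2real (E {exp (- t)<..})" for t
  have sub: "{exp (- t)<..} \<subseteq> {0<..}" for t :: real by (auto intro: less_trans[OF exp_gt_zero])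
  have cont: "continuous_on UNIV (\<lambda>t. \<bar>u (exp (- t))\<bar>)"
  proof -
    have "continuous_on UNIV (\<lambda>t. u (exp (- t)))"
      by (rule continuous_on_compose2[OF locally_abs_continuous_imp_continuous_on[OF AC]])
        (auto intro!: continuous_intros)
    then show ?thesis by (rule continuous_on_rabs)
  qed
  have "controlled_function p \<beta> (\<lambda>t. \<bar>u (exp (- t))\<bar>) e"
  proof
    show "p > 1" "\<beta> > 0" by fact+
    show "continuous_on UNIV (\<lambda>t. \<bar>u (exp (- t))\<bar>)" by (rule cont)
    show "0 \<le> e t" for t by (simp add: e_def)
    show "e t \<le> 1" for t
    proof -
      have "ennreal (e t) \<le> ennreal 1" using E1[OF sub] Efin[OF sub] by (simp add: e_def)
      then show ?thesis by (subst (asm) ennreal_le_iff) auto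
    qed
    fix s t :: real assume "s \<le> t"
    show "e s \<le> e t \<and> \<bar>\<bar>u (exp (- t))\<bar> - \<bar>u (exp (- s))\<bar>\<bar> powr p \<le> (t - s) powr (p - 1) * (e t - e s)"
    proof (cases "s = t")
      case True
      then show ?thesis using \<open>p > 1\<close> by simp
    next
      case False
      define a b where "a = exp (- t)" and "b = exp (- s)"
      have ab: "0 < a" "a < b" using \<open>s \<le> t\<close> False by (auto simp: a_def b_def)
      have subab: "{a<..b} \<subseteq> {0<..}" using ab by auto
      define X where "X = enn2real (E {a<..b})"
      have "{a<..b} \<union> {b<..} = {a<..}" using ab(2) by (auto simp: set_eq_iff)
      moreover have "E ({a<..b} \<union> {b<..}) = E {a<..b} + E {b<..}"
        by (rule Eadd) (use ab in auto)
      ultimately have "E {a<..} = E {a<..b} + E {b<..}" by (simp only:)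
      then have "ennreal (e t) = ennreal X + ennreal (e s)"
        unfolding e_def X_def a_def[symmetric] b_def[symmetric]
        using Efin[OF subab] Efin[OF sub[of t]] Efin[OF sub[of s]] unfolding a_def[symmetric] b_def[symmetric] by (simp only:)
      then have "ennreal (e t) = ennreal (X + e s)" by (simp add: X_def e_def)
      then have eX: "e t = X + e s" by (subst (asm) ennreal_inj) (auto simp: X_def e_def)
      have "\<bar>u b - u a\<bar> powr p \<le> (ln b - ln a) powr (p - 1) * X"
      proof (rule weighted_increment_le[OF \<open>p > 1\<close> ab _ _ meas])
        show "abs_continuous_on_interval a b u" using AC ab unfolding locally_abs_continuous_def by auto
        show "(\<integral>\<^sup>+x\<in>{a<..b}. ennreal (\<bar>deriv u x\<bar> powr p * x powr (p - 1)) \<partial>lebesgue) = ennreal X"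
          using Efin[OF subab] by (simp add: E_def X_def)
      qed (simp add: X_def)
      moreover have "\<bar>\<bar>u a\<bar> - \<bar>u b\<bar>\<bar> powr p \<le> \<bar>u b - u a\<bar> powr p"
        using \<open>p > 1\<close> by (intro powr_mono2) auto
      moreover have "ln b - ln a = t - s" by (simp add: a_def b_def)
      moreover have "0 \<le> X" by (simp add: X_def)
      ultimately show ?thesis using eX by (simp add: a_def b_def)
    qed
  qed simp
  then show ?thesis by blast
qed

lemma ennreal_powr_Lp_norm:
  assumes "p > 0"
  shows "ennreal_powr (Lp_norm p \<alpha> u) p = (\<integral>\<^sup>+r\<in>{0<..}. ennreal (\<bar>u r\<bar> powr p * r powr \<alpha>) \<partial>lebesgue)"
proof -
  define I where "I = (\<integral>\<^sup>+r\<in>{0<..}. ennreal (\<bar>u r\<bar> powr p * r powr \<alpha>) \<partial>lebesgue)"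
  have "ennreal_powr (ennreal_powr I (1 / p)) p = I"
  proof (cases I)
    case (real x)
    then show ?thesis using assms by (simp add: ennreal_powr_def powr_powr)
  qed (simp add: ennreal_powr_def)
  then show ?thesis by (simp add: Lp_norm_def I_def)
qed

lemma Lp_norm_le_1:
  assumes "p > 0" "Lp_norm p \<alpha> u \<le> 1"
  shows "(\<integral>\<^sup>+r\<in>{0<..}. ennreal (\<bar>u r\<bar> powr p * r powr \<alpha>) \<partial>lebesgue) \<le> 1"
proof -
  obtain x where x: "0 \<le> x" "Lp_norm p \<alpha> u = ennreal x"
    using assms(2) by (cases "Lp_norm p \<alpha> u") (auto simp: top_unique)
  then have "x \<le> 1" using assms(2) by simp
  have "ennreal_powr (Lp_norm p \<alpha> u) p = ennreal (x powr p)" using x by (simp add: ennreal_powr_def)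
  also have "\<dots> \<le> 1" using x \<open>x \<le> 1\<close> assms(1) by (simp add: powr_le1)
  finally show ?thesis using ennreal_powr_Lp_norm[OF assms(1)] by simp
qed

lemma exp_p_borel: "exp_p p \<in> borel_measurable borel"
  unfolding exp_p_def[abs_def] by measurable

lemma nn_integral_log_coordinate:
  fixes u :: "real \<Rightarrow> real" and f :: "real \<Rightarrow> real"
  assumes u: "continuous_on {0<..} u" and f[measurable]: "f \<in> borel_measurable borel" and "\<beta> = \<eta> + 1"
  shows "(\<integral>\<^sup>+r\<in>{0<..}. ennreal (f \<bar>u r\<bar> * r powr \<eta>) \<partial>lebesgue)
    = (\<integral>\<^sup>+t. ennreal (f \<bar>u (exp (- t))\<bar> * exp (- \<beta> * t)) \<partial>lborel)"
proof -
  define U where "U r = indicator {0<..} r *\<^sub>R u r" for r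
  have U[measurable]: "U \<in> borel_measurable borel"
    unfolding U_def[abs_def] by (rule borel_measurable_continuous_on_indicator[OF _ u]) simp
  let ?\<phi> = "\<lambda>r. ennreal (f \<bar>U r\<bar> * r powr \<eta>)"
  have \<phi>: "?\<phi> \<in> borel_measurable borel" by measurable
  have "(\<integral>\<^sup>+r\<in>{0<..}. ennreal (f \<bar>u r\<bar> * r powr \<eta>) \<partial>lebesgue) = (\<integral>\<^sup>+r. ?\<phi> r * indicator {0<..} r \<partial>lebesgue)"
    by (rule nn_integral_cong) (auto simp: U_def indicator_def)
  also have "\<dots> = (\<integral>\<^sup>+r. ?\<phi> r * indicator {0<..} r \<partial>lborel)"
    by (rule nn_integral_completion) (use \<phi> in measurable)
  also have "\<dots> = (\<integral>\<^sup>+t. ?\<phi> (exp (- t)) * ennreal (exp (- t)) \<partial>lborel)"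
    by (rule nn_integral_exp_substitution[OF \<phi>])
  also have "\<dots> = (\<integral>\<^sup>+t. ennreal (f \<bar>u (exp (- t))\<bar> * exp (- \<beta> * t)) \<partial>lborel)"
  proof (rule nn_integral_cong)
    fix t :: real
    have "exp (- t) powr \<eta> * exp (- t) = exp (- \<beta> * t)"
      by (simp add: powr_def exp_add[symmetric] assms(3) algebra_simps)
    then have eq: "f \<bar>u (exp (- t))\<bar> * exp (- t) powr \<eta> * exp (- t) = f \<bar>u (exp (- t))\<bar> * exp (- \<beta> * t)"
      by (simp only: mult.assoc)
    have "?\<phi> (exp (- t)) * ennreal (exp (- t)) = ennreal (f \<bar>u (exp (- t))\<bar> * exp (- t) powr \<eta> * exp (- t))"
      by (simp add: U_def ennreal_mult''[symmetric])
    then show "?\<phi> (exp (- t)) * ennreal (exp (- t)) = ennreal (f \<bar>u (exp (- t))\<bar> * exp (- \<beta> * t))"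
      by (simp only: eq)
  qed
  finally show ?thesis .
qed

theorem theorem1p2:
  fixes p \<alpha>1 \<eta> \<beta> :: real
  assumes "p > 1" and "\<alpha>1 = p - 1" and "\<eta> > -1" and "\<beta> = \<eta> + 1"
  shows "\<exists>C::real. C > 0 \<and>
    (\<forall>\<alpha>0 \<ge> -1. \<forall>u \<in> X_space p \<alpha>0 \<alpha>1. Lp_norm p \<alpha>1 (deriv u) \<le> 1 \<longrightarrow>
       (\<integral>\<^sup>+r\<in>{0<..}. ennreal (exp_p p (\<beta> * \<bar>u r\<bar> powr (p / (p - 1)))
            / (1 + \<bar>u r\<bar>) powr (p / (p - 1)) * r powr \<eta>) \<partial>lebesgue)
         \<le> ennreal C * ennreal_powr (Lp_norm p \<eta> u) p)"
proof (intro exI[of _ "exact_const p \<beta>"] conjI allI impI ballI)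
  have beta: "\<beta> > 0" using assms by simp
  show "0 < exact_const p \<beta>" by (rule exact_const_pos[OF assms(1) beta])
  fix \<alpha>0 :: real and u assume u: "u \<in> X_space p \<alpha>0 \<alpha>1" and norm: "Lp_norm p \<alpha>1 (deriv u) \<le> 1"
  have AC: "locally_abs_continuous u" and meas: "set_borel_measurable lebesgue {0<..} (deriv u)"
    using u by (auto simp: X_space_def Lp_space_def)
  let ?w = "\<lambda>t. \<bar>u (exp (- t))\<bar>"
  have "(\<integral>\<^sup>+x\<in>{0<..}. ennreal (\<bar>deriv u x\<bar> powr p * x powr (p - 1)) \<partial>lebesgue) \<le> 1"
    using Lp_norm_le_1[OF _ norm] assms(1,2) by simp
  then obtain e where "controlled_function p \<beta> ?w e"
    using controlled_function_log_coordinate[OF assms(1) beta AC meas] by blast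
  then interpret controlled_function p \<beta> ?w e .
  note cu = locally_abs_continuous_imp_continuous_on[OF AC]
  have f: "(\<lambda>y. exp_p p (\<beta> * y powr q) / (1 + y) powr q) \<in> borel_measurable borel"
    using exp_p_borel by measurable
  have "(\<integral>\<^sup>+r\<in>{0<..}. ennreal (exp_p p (\<beta> * \<bar>u r\<bar> powr q) / (1 + \<bar>u r\<bar>) powr q * r powr \<eta>) \<partial>lebesgue)
      = (\<integral>\<^sup>+t. ennreal (g t) \<partial>lborel)"
    unfolding g_def by (rule nn_integral_log_coordinate[OF cu f assms(4)])
  also have "\<dots> \<le> ennreal (exact_const p \<beta>) * J" by (rule exact_growth)
  also have "J = (\<integral>\<^sup>+r\<in>{0<..}. ennreal (\<bar>u r\<bar> powr p * r powr \<eta>) \<partial>lebesgue)"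
    unfolding J_def by (rule nn_integral_log_coordinate[OF cu _ assms(4), symmetric]) simp
  also have "\<dots> = ennreal_powr (Lp_norm p \<eta> u) p" using assms(1) by (simp add: ennreal_powr_Lp_norm)
  finally show "(\<integral>\<^sup>+r\<in>{0<..}. ennreal (exp_p p (\<beta> * \<bar>u r\<bar> powr (p / (p - 1)))
            / (1 + \<bar>u r\<bar>) powr (p / (p - 1)) * r powr \<eta>) \<partial>lebesgue)
         \<le> ennreal (exact_const p \<beta>) * ennreal_powr (Lp_norm p \<eta> u) p"
    unfolding q_def .
qed

end
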